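(* Let $\kappa$ be a one domain wall function with parameter $\kappa_\infty>0$ such that the Spectral Gap Assumption holds for $\mathcal{D}_\kappa$, and let $[-K,K]\subset(-\kappa_\infty,\kappa_\infty)$ be any compact interval. Then there is a constant $\delta_0(K)>0$ such that for all $\delta>\delta_0(K)$ the two domain wall Dirac operator $\mathcal{D}_{\kappa^\delta}$ has precisely two eigenvalues $E^\delta_+$, $E^\delta_-$ in $[-K,K]$, both of them simple. These eigenvalues have expansions $$E^\delta_\pm=\pm 2\gamma^2 e^{-2\int_0^\delta\kappa(y)\,dy}+O(e^{-4\kappa_\infty\delta}).$$ Their associated normalized eigenfunctions $\alpha^\delta_\pm$ (suitably chosen up to a constant phase) satisfy $$\alpha^\delta_+=\frac{1}{\sqrt2}\left(\alpha_\star^{R}+i\,\alpha_\star^{L}\right)+O_{\mathcal H}(e^{-2\kappa_\infty\delta}),\qquad \alpha^\delta_-=\frac{1}{\sqrt2}\left(\alpha_\star^{R}-i\,\alpha_\star^{L}\right)+O_{\mathcal H}(e^{-2\kappa_\infty\delta}).$$ Here the constants implied in the $O$ terms are independent of $\delta$, and $O_{\mathcal H}$ denotes an error measured in the norm of $\mathcal H$.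
   Context: Let $\mathcal H=L^2(\mathbb R;\mathbb C^2)$ with inner product $\langle f|g\rangle_{\mathcal H}=\int_{\mathbb R}\sum_{j=1,2}\overline{f_j(x)}g_j(x)\,dx$ and induced norm, and $\mathcal H^1=H^1(\mathbb R;\mathbb C^2)$. Pauli matrices: $\sigma_1=\begin{pmatrix}0&1\\1&0\end{pmatrix}$, $\sigma_3=\begin{pmatrix}1&0\\0&-1\end{pmatrix}$. For a real function $m$, $\mathcal D_m=i\sigma_3\partial_x+m(x)\sigma_1$, with domain $\mathcal H^1$ (self-adjoint on $\mathcal H$). One domain wall function: a real function $\kappa\in C^1(\mathbb R)$ that is odd, with $\kappa(x)=-\kappa_\infty$ for $x\le-1$ and $\kappa(x)=\kappa_\infty$ for $x\ge1$, where $\kappa_\infty>0$ is a fixed constant. Zero mode of $\mathcal D_\kappa$: $\alpha_\star(x)=\gamma\begin{pmatrix}1\\i\end{pmatrix}e^{-\int_0^x\kappa(y)\,dy}$, with $\gamma=\dfrac{1}{\sqrt2\,\|e^{-\int_0^x\kappa(y)\,dy}\|_{L^2(\mathbb R)}}$, so $\|\alpha_\star\|_{\mathcal H}=1$ and $\mathcal D_\kappa\alpha_\star=0$. Spectral Gap Assumption: $0$ is the unique eigenvalue of $\mathcal D_\kappa$ in $(-\kappa_\infty,\kappa_\infty)$; that is, for all $f\in\mathcal H^1$ with $\langle\alpha_\star|f\rangle_{\mathcal H}=0$ one has $\|\mathcal D_\kappa f\|_{\mathcal H}\ge\kappa_\infty\|f\|_{\mathcal H}$. Two domain wall mass function, for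 $\delta>1$ (a standing assumption): $\kappa^\delta(x)=-\kappa(x+\delta)$ for $x\le0$ and $\kappa^\delta(x)=\kappa(x-\delta)$ for $x\ge0$. The two domain wall Dirac operator is $\mathcal D_{\kappa^\delta}$. Shifted zero modes: $\alpha_\star^R(x)=\alpha_\star(x-\delta)$ and $\alpha_\star^L(x)=\overline{\alpha_\star(x+\delta)}$ (componentwise complex conjugate). *)

theory Defs
  imports "HOL-Analysis.Analysis"
begin

text \<open>
  Elements of \<open>L\<^sup>2(R;C\<^sup>2)\<close> are represented by Borel functions; equality in that space is
  equality almost everywhere.
\<close>

type_synonym spinor_fun = "real \<Rightarrow> complex^2"

definition L2 :: "spinor_fun set" where
  "L2 = {f. f \<in> borel_measurable lborel \<and> integrable lborel (\<lambda>x. (norm (f x))\<^sup>2)}"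

definition inner_H :: "spinor_fun \<Rightarrow> spinor_fun \<Rightarrow> complex" where
  "inner_H f g = (\<integral>x. (\<Sum>j\<in>UNIV. cnj (f x $ j) * g x $ j) \<partial>lborel)"

definition norm_H :: "spinor_fun \<Rightarrow> real" where
  "norm_H f = sqrt (Re (inner_H f f))"

definition test_function :: "(real \<Rightarrow> real) \<Rightarrow> bool" where
  "test_function \<phi> \<longleftrightarrow>
     (\<forall>n x. (deriv ^^ n) \<phi> differentiable (at x)) \<and> compact (closure {x. \<phi> x \<noteq> 0})"

definition has_weak_deriv :: "spinor_fun \<Rightarrow> spinor_fun \<Rightarrow> bool" where
  "has_weak_deriv f g \<longleftrightarrow>
     (\<forall>\<phi>. test_function \<phi> \<longrightarrow>
        (\<integral>x. deriv \<phi> x *\<^sub>R f x \<partial>lborel) = - (\<integral>x. \<phi> x *\<^sub>R g x \<partial>lborel))"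

definition H1 :: "spinor_fun set" where
  "H1 = {f \<in> L2. \<exists>g\<in>L2. has_weak_deriv f g}"

text \<open>
  For \<open>f \<in> H1\<close> this is a representative of the weak derivative, which is unique only up to null
  sets; outside \<open>H1\<close> it carries no meaning.
\<close>

definition weak_deriv :: "spinor_fun \<Rightarrow> spinor_fun" where
  "weak_deriv f = (SOME g. g \<in> L2 \<and> has_weak_deriv f g)"

definition sigma1 :: "complex^2^2" where
  "sigma1 = vector [vector [0, 1], vector [1, 0]]"

definition sigma3 :: "complex^2^2" where
  "sigma3 = vector [vector [1, 0], vector [0, -1]]"

text \<open>The domain is \<open>H1\<close>; every use below restricts the argument to it.\<close>

definition dirac :: "(real \<Rightarrow> real) \<Rightarrow> spinor_fun \<Rightarrow> spinor_fun" where
  "dirac m f = (\<lambda>x. \<i> *s (sigma3 *v weak_deriv f x) + complex_of_real (m x) *s (sigma1 *v f x))"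

definition eigenfunction :: "(real \<Rightarrow> real) \<Rightarrow> real \<Rightarrow> spinor_fun \<Rightarrow> bool" where
  "eigenfunction m E f \<longleftrightarrow>
     f \<in> H1 \<and> \<not> (AE x in lborel. f x = 0) \<and>
     (AE x in lborel. dirac m f x = complex_of_real E *s f x)"

definition eigenvalue :: "(real \<Rightarrow> real) \<Rightarrow> real \<Rightarrow> bool" where
  "eigenvalue m E \<longleftrightarrow> (\<exists>f. eigenfunction m E f)"

text \<open>
  The operators are self-adjoint, so a simple eigenvalue is one whose eigenspace in
  \<open>L\<^sup>2\<close> (modulo null sets) has complex dimension one.
\<close>

definition simple_eigenvalue :: "(real \<Rightarrow> real) \<Rightarrow> real \<Rightarrow> bool" where
  "simple_eigenvalue m E \<longleftrightarrow>
     (\<exists>f. eigenfunction m E f \<and>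
        (\<forall>g. eigenfunction m E g \<longrightarrow> (\<exists>c. AE x in lborel. g x = c *s f x)))"

definition one_domain_wall :: "(real \<Rightarrow> real) \<Rightarrow> real \<Rightarrow> bool" where
  "one_domain_wall \<kappa> \<kappa>inf \<longleftrightarrow>
     \<kappa>inf > 0 \<and> \<kappa> C1_differentiable_on UNIV \<and> (\<forall>x. \<kappa> (- x) = - \<kappa> x) \<and>
     (\<forall>x\<le>-1. \<kappa> x = - \<kappa>inf) \<and> (\<forall>x\<ge>1. \<kappa> x = \<kappa>inf)"

text \<open>The interval integral is oriented, as is needed for \<open>x < 0\<close>.\<close>

definition wall_primitive :: "(real \<Rightarrow> real) \<Rightarrow> real \<Rightarrow> real" where
  "wall_primitive \<kappa> x = (LBINT y=0..x. \<kappa> y)"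

definition gamma_const :: "(real \<Rightarrow> real) \<Rightarrow> real" where
  "gamma_const \<kappa> = 1 / (sqrt 2 * sqrt (\<integral>x. (exp (- wall_primitive \<kappa> x))\<^sup>2 \<partial>lborel))"

definition zero_mode :: "(real \<Rightarrow> real) \<Rightarrow> spinor_fun" where
  "zero_mode \<kappa> x =
     complex_of_real (gamma_const \<kappa> * exp (- wall_primitive \<kappa> x)) *s vector [1, \<i>]"

definition spectral_gap :: "(real \<Rightarrow> real) \<Rightarrow> real \<Rightarrow> bool" where
  "spectral_gap \<kappa> \<kappa>inf \<longleftrightarrow>
     (\<forall>f\<in>H1. inner_H (zero_mode \<kappa>) f = 0 \<longrightarrow> norm_H (dirac \<kappa> f) \<ge> \<kappa>inf * norm_H f)"

text \<open>For \<open>\<delta> > 1\<close> the two branches agree at \<open>x = 0\<close>.\<close>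

definition two_wall :: "(real \<Rightarrow> real) \<Rightarrow> real \<Rightarrow> real \<Rightarrow> real" where
  "two_wall \<kappa> \<delta> x = (if x \<le> 0 then - \<kappa> (x + \<delta>) else \<kappa> (x - \<delta>))"

definition zero_mode_R :: "(real \<Rightarrow> real) \<Rightarrow> real \<Rightarrow> spinor_fun" where
  "zero_mode_R \<kappa> \<delta> x = zero_mode \<kappa> (x - \<delta>)"

definition zero_mode_L :: "(real \<Rightarrow> real) \<Rightarrow> real \<Rightarrow> spinor_fun" where
  "zero_mode_L \<kappa> \<delta> x = (\<chi> j. cnj (zero_mode \<kappa> (x + \<delta>) $ j))"

end

theory Submission imports Defs
begin

text \<open>
  Identify the spinor \<open>f = (u - \<i> w, \<i> u - w)\<close> with the pair \<open>(u, w)\<close>. Then \<open>\<D>\<^sub>m f = E f\<close> becomes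
  the real linear system \<open>u' = - m u - E w\<close>, \<open>w' = m w + E u\<close>. A weak solution in \<open>L2\<close> agrees almost
  everywhere with a classical solution (\<open>eigenfunction_ode\<close>), and square integrable classical
  solutions are eigenfunctions (\<open>dirac_ode_eigenfunction\<close>), so the whole spectral question is one
  about this planar system.

  Write \<open>k\<close> for the limit of \<open>\<kappa>\<close> at infinity. For \<open>\<bar>E\<bar> < k\<close> put \<open>s = sqrt (k\<^sup>2 - E\<^sup>2)\<close> and
  \<open>t = E / (k + s)\<close>. Where \<open>m\<close> is constant the system is solved by exponentials with rates \<open>s\<close> and
  \<open>- s\<close>. Hence a single wall has, up to a factor, one solution that decays at \<open>+\<infinity>\<close>. To the left of
  the wall it is a combination of a part that decays away from the wall, with amplitude \<open>P(E)\<close>, and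
  a part that grows, with amplitude \<open>Q(E)\<close>. If \<open>Q(E) = 0\<close> this solution is an eigenfunction of the
  single wall; it is orthogonal to the zero mode when \<open>E \<noteq> 0\<close>, so the spectral gap forces \<open>Q(E) \<noteq> 0\<close>
  for \<open>0 < \<bar>E\<bar> < k\<close> (\<open>leak_amp_nonzero\<close>).

  The two wall mass is the even function \<open>\<kappa> (\<bar>x\<bar> - \<delta>)\<close>. The map \<open>(u, w) \<mapsto> (w (- x), u (- x))\<close>
  therefore permutes the solutions with energy \<open>E\<close>, and \<open>E\<close> is an eigenvalue exactly when the
  shifted decaying solution satisfies \<open>w = \<sigma> u\<close> at the midpoint for a sign \<open>\<sigma>\<close>
  (\<open>two_wall_eigenvalue_iff\<close>). In terms of amplitudes this reads \<open>Q(E) = \<sigma> P(E) exp (- 2 s (\<delta> - 1))\<close>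
  (\<open>matching_iff\<close>). The right-hand side is exponentially small, whereas \<open>E\<close> and \<open>- Q(E)\<close> have the
  same sign and \<open>\<bar>Q(E)\<bar> \<ge> c \<bar>E\<bar>\<close> on \<open>[-K, K]\<close> (\<open>leak_amp_sign\<close>). So the intermediate value theorem
  gives a root for either sign (\<open>bound_states_exist\<close>), and every root is \<open>O(exp (- 2 k \<delta>))\<close>
  (\<open>bound_state_energy_small\<close>). There is only one root per sign (\<open>bound_states_unique\<close>): the
  Wronskian of two decaying solutions would have to increase from \<open>0\<close> at the midpoint to a negative
  value at the wall.

  The remaining estimates are perturbative around \<open>E = 0\<close>, where the decaying solution is
  \<open>(exp (- W), 0)\<close> with \<open>W\<close> the primitive of \<open>\<kappa>\<close>. They compare the bound states with the pair
  \<open>exp (- W (x - \<delta>))\<close>, \<open>\<sigma> exp (- W (x + \<delta>))\<close> pointwise with an error \<open>O(exp (- 2 k \<delta>))\<close>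
  (\<open>dec_sol_comparison\<close>), which after normalization is the statement on eigenfunctions. Finally
  \<open>(exp (- W) w)' = E exp (- W) u\<close>, integrated from the midpoint to infinity, expresses \<open>E\<close> through
  the value of \<open>u\<close> at the midpoint and yields the expansion of the energies
  (\<open>bound_state_energy_expansion\<close>). The eigenvalue near \<open>+ 2 \<gamma>\<^sup>2 exp (- 2 W \<delta>)\<close> belongs to \<open>\<sigma> = -1\<close>.
\<close>

section \<open>Test functions and weak derivatives\<close>

text \<open>
  This class is closed under differentiation, so that the smoothness of its members is an induction.
  Letting \<open>c\<close> tend to \<open>0\<close> turns the simplest member into the indicator function of an interval.
\<close>

definition bump_term :: "real \<Rightarrow> real \<Rightarrow> real \<Rightarrow> real poly \<Rightarrow> nat \<Rightarrow> real \<Rightarrow> real" where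
  "bump_term a b c p k x =
     (if a < x \<and> x < b
      then poly p x / ((x - a) * (b - x)) ^ k * exp (- c / ((x - a) * (b - x))) else 0)"

text \<open>
  A single term of the exponential series, of order \<open>k + 2\<close>, already beats the power \<open>q ^ k\<close> and
  leaves \<open>q\<^sup>2\<close> to spare; the spare factor makes the bumps differentiable at the ends of their
  support.
\<close>

lemma inverse_power_exp_bound:
  fixes c :: real
  assumes "c > 0"
  shows "\<exists>B\<ge>0. \<forall>q>0. exp (- c / q) / q ^ k \<le> B * q\<^sup>2"
proof (intro exI conjI allI impI)
  show "fact (k + 2) / c ^ (k + 2) \<ge> 0" using assms by simp
  fix q :: real assume q: "q > 0"
  have "(c / q) ^ (k + 2) / fact (k + 2) \<le> exp (c / q)"
  proof -
    have sm: "summable (\<lambda>n. (c/q) ^ n /\<^sub>R fact n)"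
      by (rule summable_exp_generic)
    have "(\<Sum>n\<in>{k + 2}. (c/q) ^ n /\<^sub>R fact n) \<le> (\<Sum>n. (c/q) ^ n /\<^sub>R fact n)"
      by (rule sum_le_suminf[OF sm]) (use assms q in auto)
    then show ?thesis by (simp add: exp_def divide_inverse mult.commute)
  qed
  then have "c ^ (k + 2) / (q ^ (k + 2) * fact (k + 2)) \<le> exp (c / q)"
    by (simp add: power_divide)
  then have "c ^ (k + 2) \<le> exp (c / q) * (q ^ (k + 2) * fact (k + 2))"
    using q by (subst (asm) pos_divide_le_eq) auto
  then have "c ^ (k + 2) * exp (- c / q) \<le> q ^ (k + 2) * fact (k + 2)"
    by (simp add: exp_minus field_simps)
  then show "exp (- c / q) / q ^ k \<le> fact (k + 2) / c ^ (k + 2) * q\<^sup>2"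
    using q assms by (simp add: divide_simps power_add power2_eq_square ac_simps del: fact_Suc)
qed

lemma bump_term_quadratic_bound:
  assumes "c > 0" and "x = a \<or> x = b"
  shows "\<exists>B\<ge>0. \<forall>y. \<bar>bump_term a b c p k y\<bar> \<le> B * (y - x)\<^sup>2"
proof -
  obtain B where B: "B \<ge> 0" "\<And>q. q > 0 \<Longrightarrow> exp (- c / q) / q ^ k \<le> B * q\<^sup>2"
    using inverse_power_exp_bound[OF assms(1)] by blast
  have "compact ((\<lambda>y. poly p y) ` {a..b})"
    by (intro compact_continuous_image continuous_intros) auto
  then have "bounded ((\<lambda>y. poly p y) ` {a..b})" by (rule compact_imp_bounded)
  then obtain M where M: "\<And>y. y \<in> {a..b} \<Longrightarrow> \<bar>poly p y\<bar> \<le> M"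
    unfolding bounded_iff by (metis imageI real_norm_def)
  have "\<bar>bump_term a b c p k y\<bar> \<le> \<bar>M\<bar> * B * (b - a)\<^sup>2 * (y - x)\<^sup>2" for y
  proof (cases "a < y \<and> y < b")
    case True
    define q where "q = (y - a) * (b - y)"
    have q: "q > 0" using True by (simp add: q_def)
    have "q \<le> (b - a) * \<bar>y - x\<bar>"
    proof (rule disjE[OF assms(2)])
      assume "x = a"
      then show ?thesis unfolding q_def using True
        by (subst mult.commute) (intro mult_mono, auto)
    next
      assume "x = b"
      then show ?thesis unfolding q_def using True
        by (intro mult_mono) auto
    qed
    then have "q\<^sup>2 \<le> ((b - a) * \<bar>y - x\<bar>)\<^sup>2" using q by (intro power_mono) auto
    then have q2: "q\<^sup>2 \<le> (b - a)\<^sup>2 * (y - x)\<^sup>2" by (simp add: power_mult_distrib)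
    have "\<bar>bump_term a b c p k y\<bar> = \<bar>poly p y\<bar> * (exp (- c / q) / q ^ k)"
      using True q by (simp add: bump_term_def q_def abs_mult)
    also have "\<dots> \<le> \<bar>M\<bar> * (B * q\<^sup>2)"
      by (rule mult_mono) (use M[of y] True B(2)[OF q] q in auto)
    also have "\<dots> \<le> \<bar>M\<bar> * (B * ((b - a)\<^sup>2 * (y - x)\<^sup>2))"
      using q2 B(1) by (intro mult_left_mono) auto
    finally show ?thesis by (simp add: mult.assoc)
  next
    case False
    then show ?thesis using B(1) by (auto simp: bump_term_def)
  qed
  then show ?thesis using B(1) by (intro exI[of _ "\<bar>M\<bar> * B * (b - a)\<^sup>2"]) auto
qed

lemma has_zero_derivative_if_quadratic:
  fixes f :: "real \<Rightarrow> real"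
  assumes "f x = 0" "B \<ge> 0" "\<And>y. \<bar>f y\<bar> \<le> B * (y - x)\<^sup>2"
  shows "(f has_real_derivative 0) (at x)"
  unfolding has_field_derivative_iff
proof (rule tendsto_norm_zero_cancel)
  show "((\<lambda>y. norm ((f y - f x) / (y - x))) \<longlongrightarrow> 0) (at x)"
  proof (rule tendsto_sandwich[of "\<lambda>_. 0" _ _ "\<lambda>y. B * \<bar>y - x\<bar>"])
    have "norm ((f y - f x) / (y - x)) \<le> B * \<bar>y - x\<bar>" if "y \<noteq> x" for y
      using assms(3)[of y] that assms(1)
      by (simp add: divide_le_eq power2_eq_square mult.assoc)
    then show "\<forall>\<^sub>F y in at x. norm ((f y - f x) / (y - x)) \<le> B * \<bar>y - x\<bar>"
      by (auto simp: eventually_at_filter)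
    have "((\<lambda>y. B * \<bar>y - x\<bar>) \<longlongrightarrow> B * \<bar>x - x\<bar>) (at x)"
      by (intro tendsto_intros)
    then show "((\<lambda>y. B * \<bar>y - x\<bar>) \<longlongrightarrow> 0) (at x)" by simp
  qed auto
qed

text \<open>
  Inside the interval this is the quotient rule over the common denominator \<open>q ^ (k + 2)\<close>; at the
  two endpoints quadratic flatness gives the derivative \<open>0\<close>.
\<close>

lemma bump_term_has_derivative:
  fixes a b c :: real
  assumes "c > 0"
  defines "q \<equiv> [:- (a * b), a + b, -1:]"
  shows "(bump_term a b c p k has_real_derivative
     bump_term a b c (pderiv p * q\<^sup>2 - of_nat k * p * pderiv q * q + smult c (p * pderiv q)) (k + 2) x) (at
         x)"
    (is "(_ has_real_derivative bump_term a b c ?p' _ _) _")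
proof (cases "a < x \<and> x < b")
  case True
  have qx: "poly q y = (y - a) * (b - y)" for y by (simp add: q_def algebra_simps)
  have q0: "poly q x > 0" using True by (simp add: qx)
  have qd: "(poly q has_real_derivative poly (pderiv q) x) (at x)" by (rule poly_DERIV)
  have pd: "(poly p has_real_derivative poly (pderiv p) x) (at x)" by (rule poly_DERIV)
  define r where "r = (\<lambda>y. inverse (poly q y))"
  have rd: "(r has_real_derivative - (poly (pderiv q) x * (r x)\<^sup>2)) (at x)"
    unfolding r_def using q0
    by (auto intro!: derivative_eq_intros qd simp: power2_eq_square)
  have rk: "((\<lambda>y. r y ^ k) has_real_derivative - (of_nat k * poly (pderiv q) x * r x ^ (k + 1))) (at x)"
    by (rule DERIV_cong[OF DERIV_power[OF rd, of k]]) (cases k, simp_all add: power2_eq_square)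
  have re: "((\<lambda>y. exp (- c * r y)) has_real_derivative
      exp (- c * r x) * (c * poly (pderiv q) x * (r x)\<^sup>2)) (at x)"
    by (rule derivative_eq_intros rd refl)+ simp
  have "((\<lambda>y. (poly p y * r y ^ k) * exp (- c * r y)) has_real_derivative
     poly ?p' x * r x ^ (k + 2) * exp (- c * r x)) (at x)"
  proof (rule DERIV_cong[OF DERIV_mult[OF DERIV_mult[OF pd rk] re]])
    have "r x * poly q x = 1" using q0 by (simp add: r_def)
    then have rq: "r x ^ k * r x * poly q x = r x ^ k" "r x ^ k * (r x)\<^sup>2 * (poly q x)\<^sup>2 = r x ^ k"
      by (metis mult.assoc mult.right_neutral, metis mult.assoc mult.right_neutral power_mult_distrib
          power_one)
    have "poly ?p' x * r x ^ (k + 2) =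
        poly (pderiv p) x * (r x ^ k * (r x)\<^sup>2 * (poly q x)\<^sup>2)
        - of_nat k * poly p x * poly (pderiv q) x * r x * (r x ^ k * r x * poly q x)
        + c * poly p x * poly (pderiv q) x * r x ^ (k + 2)"
      by (simp add: algebra_simps power2_eq_square)
    also have "\<dots> = poly (pderiv p) x * r x ^ k
        - of_nat k * poly p x * poly (pderiv q) x * r x * r x ^ k
        + c * poly p x * poly (pderiv q) x * r x ^ (k + 2)"
      unfolding rq ..
    finally show "(poly (pderiv p) x * r x ^ k +
        - (of_nat k * poly (pderiv q) x * r x ^ (k + 1)) * poly p x) * exp (- c * r x) +
      exp (- c * r x) * (c * poly (pderiv q) x * (r x)\<^sup>2) * (poly p x * r x ^ k) =
      poly ?p' x * r x ^ (k + 2) * exp (- c * r x)"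
      by (simp only:) (simp add: algebra_simps power2_eq_square)
  qed
  then have "((\<lambda>y. poly p y / poly q y ^ k * exp (- c / poly q y)) has_real_derivative
     poly ?p' x / poly q x ^ (k + 2) * exp (- c / poly q x)) (at x)"
    by (simp only: r_def divide_inverse power_inverse)
  then have "((\<lambda>y. poly p y / poly q y ^ k * exp (- c / poly q y)) has_real_derivative
     bump_term a b c ?p' (k + 2) x) (at x)"
    using True by (simp add: bump_term_def qx)
  then show ?thesis
    by (rule has_field_derivative_transform_within_open[where S = "{a<..<b}"])
       (use True in \<open>auto simp: bump_term_def qx\<close>)
next
  case False
  then have z: "bump_term a b c p' k' x = 0" for p' k' by (auto simp: bump_term_def)
  show ?thesis
  proof (cases "x = a \<or> x = b")
    case True
    then obtain B where "B \<ge> 0" "\<And>y. \<bar>bump_term a b c p k y\<bar> \<le> B * (y - x)\<^sup>2"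
      using bump_term_quadratic_bound[OF assms(1) True] by blast
    from has_zero_derivative_if_quadratic[OF z this] show ?thesis by (simp add: z)
  next
    case outside: False
    have "((\<lambda>y. 0) has_real_derivative bump_term a b c ?p' (k + 2) x) (at x)"
      by (simp add: z)
    then show ?thesis
      by (rule has_field_derivative_transform_within_open[where S = "- {a..b}"])
         (use False outside in \<open>auto simp: bump_term_def\<close>)
  qed
qed

lemma iterated_deriv_bump_term:
  assumes "c > 0"
  shows "\<exists>p' k'. (deriv ^^ n) (bump_term a b c p k) = bump_term a b c p' k'"
proof (induction n)
  case 0
  then show ?case by auto
next
  case (Suc n)
  then obtain p' k' where *: "(deriv ^^ n) (bump_term a b c p k) = bump_term a b c p' k'" by blast
  have "deriv (bump_term a b c p' k') = bump_term a b c (pderiv p' * [:- (a * b), a + b, -1:]\<^sup>2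
      - of_nat k' * p' * pderiv [:- (a * b), a + b, -1:] * [:- (a * b), a + b, -1:]
      + smult c (p' * pderiv [:- (a * b), a + b, -1:])) (k' + 2)"
    by (intro ext DERIV_imp_deriv bump_term_has_derivative assms)
  then show ?case using * by (auto simp del: pderiv.simps)
qed

definition bump :: "real \<Rightarrow> real \<Rightarrow> real \<Rightarrow> real \<Rightarrow> real" where
  "bump a b c = bump_term a b c 1 0"

lemma bump_eq: "bump a b c x = (if a < x \<and> x < b then exp (- c / ((x - a) * (b - x))) else 0)"
  by (simp add: bump_def bump_term_def)

lemma test_function_bump:
  assumes "c > 0"
  shows "test_function (bump a b c)"
  unfolding test_function_def
proof (intro conjI allI)
  show "(deriv ^^ n) (bump a b c) differentiable at x" for n x
  proof -
    obtain p' k' where "(deriv ^^ n) (bump a b c) = bump_term a b c p' k'"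
      using iterated_deriv_bump_term[OF assms] by (metis bump_def)
    then show ?thesis
      using bump_term_has_derivative[OF assms] real_differentiable_def by metis
  qed
  have "bounded {x. bump a b c x \<noteq> 0}"
    by (rule bounded_subset[of "{a..b}"]) (auto simp: bump_eq split: if_splits)
  then show "compact (closure {x. bump a b c x \<noteq> 0})" by (simp add: compact_closure)
qed

lemma test_function_differentiable:
  "test_function \<phi> \<Longrightarrow> (\<phi> has_real_derivative deriv \<phi> x) (at x)"
  unfolding test_function_def by (metis DERIV_deriv_iff_real_differentiable funpow_0)

lemma test_function_deriv_cont:
  assumes "test_function \<phi>"
  shows "continuous_on S \<phi>" "continuous_on S (deriv \<phi>)"
proof -
  have "(deriv ^^ n) \<phi> differentiable at x" for n x
    using assms by (simp add: test_function_def)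
  then have "isCont ((deriv ^^ n) \<phi>) x" for n x
    using differentiable_imp_continuous_within by blast
  then have "isCont ((deriv ^^ 0) \<phi>) x" "isCont ((deriv ^^ 1) \<phi>) x" for x by blast+
  then show "continuous_on S \<phi>" "continuous_on S (deriv \<phi>)"
    by (simp_all add: continuous_at_imp_continuous_on)
qed

lemma test_function_support:
  assumes "test_function \<phi>"
  obtains R where "R > 0" "\<And>x. \<bar>x\<bar> \<ge> R \<Longrightarrow> \<phi> x = 0" "\<And>x. \<bar>x\<bar> \<ge> R \<Longrightarrow> deriv \<phi> x = 0"
proof -
  have "bounded {x. \<phi> x \<noteq> 0}"
    using assms bounded_subset[OF compact_imp_bounded closure_subset]
    unfolding test_function_def by blast
  then obtain R where R: "R > 0" "\<And>x. \<phi> x \<noteq> 0 \<Longrightarrow> \<bar>x\<bar> \<le> R"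
    by (auto simp: bounded_pos)
  have z: "\<phi> x = 0" if "\<bar>x\<bar> > R" for x using R(2)[of x] that by auto
  have "deriv \<phi> x = 0" if "\<bar>x\<bar> > R" for x
  proof -
    have "((\<lambda>_. 0) has_real_derivative 0) (at x)" by simp
    then have "(\<phi> has_real_derivative 0) (at x)"
      by (rule has_field_derivative_transform_within_open[where S = "- {-R..R}"])
         (use that z in auto)
    then show ?thesis by (rule DERIV_imp_deriv)
  qed
  with z R(1) show ?thesis by (intro that[of "R + 1"]) auto
qed

lemma test_function_antiderivative:
  assumes \<psi>: "test_function \<psi>" and d: "\<And>x. (\<phi> has_real_derivative \<psi> x) (at x)"
    and s: "\<And>x. \<bar>x\<bar> \<ge> R \<Longrightarrow> \<phi> x = 0"
  shows "test_function \<phi>"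
  unfolding test_function_def
proof (intro conjI allI)
  have "deriv \<phi> = \<psi>" using d by (auto intro: DERIV_imp_deriv)
  then show "(deriv ^^ n) \<phi> differentiable at x" for n x
    using \<psi> d by (cases n) (auto simp: test_function_def funpow_swap1 real_differentiable_def)
  have "bounded {x. \<phi> x \<noteq> 0}"
  proof (rule bounded_subset[of "{-R..R}"])
    show "{x. \<phi> x \<noteq> 0} \<subseteq> {-R..R}"
    proof
      fix x assume "x \<in> {x. \<phi> x \<noteq> 0}"
      then have "\<not> \<bar>x\<bar> \<ge> R" using s by auto
      then show "x \<in> {-R..R}" by auto
    qed
  qed simp
  then show "compact (closure {x. \<phi> x \<noteq> 0})" by (simp add: compact_closure)
qed

definition locally_integrable :: "(real \<Rightarrow> 'a :: {banach, second_countable_topology}) \<Rightarrow> bool" where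
  "locally_integrable f \<longleftrightarrow> (\<forall>a b. set_integrable lborel {a..b} f)"

text \<open>
  Open intervals generate the Borel sets and are stable under intersection, hence on every bounded
  window the integrals over all Borel sets vanish.
\<close>

lemma AE_zero_if_interval_integrals_zero:
  fixes g :: "real \<Rightarrow> 'a :: {banach, second_countable_topology}"
  assumes loc: "locally_integrable g"
    and z: "\<And>a b. a < b \<Longrightarrow> (LINT x:{a<..<b}|lborel. g x) = 0"
  shows "AE x in lborel. g x = 0"
proof -
  have int: "set_integrable lborel {a<..<b} g" for a b
    by (rule set_integrable_subset[of _ "{a..b}"]) (use loc in \<open>auto simp: locally_integrable_def\<close>)
  have *: "AE x in lborel. indicator {- real n<..<real n} x *\<^sub>R g x = 0" for n
  proof -
    define h where "h = (\<lambda>x. indicator {- real n<..<real n} x *\<^sub>R g x)"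
    have hi: "integrable lborel h" using int unfolding h_def set_integrable_def .
    have hset: "set_integrable lborel A h" if "A \<in> sets borel" for A
      using hi that unfolding set_integrable_def by (intro integrable_mult_indicator) auto
    have hsplit: "(LINT x:(- A)|lborel. h x) = (LINT x|lborel. h x) - (LINT x:A|lborel. h x)"
      if "A \<in> sets borel" for A
      using set_integral_Un[of A "- A" lborel h] hset[OF that] hset[of "- A"] that
      by (simp add: set_lebesgue_integral_def)
    have hI: "(LINT x:{a<..<b}|lborel. h x) = 0" for a b
    proof -
      have "(LINT x:{a<..<b}|lborel. h x) = (LINT x:{max a (- real n)<..<min b (real n)}|lborel. g x)"
        unfolding set_lebesgue_integral_def h_def
        by (intro Bochner_Integration.integral_cong) (auto simp: indicator_def)
      also have "\<dots> = 0"
        using z by (cases "max a (- real n) < min b (real n)") (auto simp: set_lebesgue_integral_def)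
      finally show ?thesis .
    qed
    have h0: "(LINT x|lborel. h x) = 0"
      using hI[of "- real n" "real n"] unfolding set_lebesgue_integral_def h_def
      by (simp add: indicator_inter_arith[symmetric])
    have hA: "(LINT x:A|lborel. h x) = 0" if "A \<in> sets borel" for A
    proof -
      have "Int_stable (range (\<lambda>(a,b). {a<..<b::real}))" "range (\<lambda>(a,b). {a<..<b::real}) \<subseteq> Pow UNIV"
        "A \<in> sigma_sets UNIV (range (\<lambda>(a,b). {a<..<b::real}))"
        using that by (auto simp: borel_eq_box Int_stable_def)
      then show ?thesis
      proof (induction rule: sigma_sets_induct_disjoint)
        case (basic A)
        then show ?case using hI by auto
      next
        case empty
        then show ?case by (simp add: set_lebesgue_integral_def)
      next
        case (compl A)
        then have "A \<in> sets borel" by (simp add: borel_eq_box)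
        then show ?case using hsplit compl h0 by (simp add: Compl_eq_Diff_UNIV)
      next
        case (union F)
        then have F: "\<And>i. F i \<in> sets borel" by (auto simp: borel_eq_box)
        have "(LINT x:(\<Union>i. F i)|lborel. h x) = (\<Sum>i. (LINT x:(F i)|lborel. h x))"
          by (rule lebesgue_integral_countable_add)
             (use F union(1) hset in \<open>auto simp: disjoint_family_on_def\<close>)
        then show ?case using union by simp
      qed
    qed
    show ?thesis
      using sigma_finite_measure.density_zero[OF sigma_finite_lborel hi] hA unfolding h_def by simp
  qed
  then have "AE x in lborel. \<forall>n. indicator {- real n<..<real n} x *\<^sub>R g x = 0"
    unfolding AE_all_countable by blast
  then show ?thesis
  proof eventually_elim
    case (elim x)
    obtain n where "\<bar>x\<bar> < real n" using reals_Archimedean2 by blast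
    then show ?case using elim[rule_format, of n] by (auto simp: indicator_def)
  qed
qed

text \<open>
  The fundamental lemma of the calculus of variations: the bumps on \<open>(a, b)\<close> with parameter
  \<open>1 / (n + 1)\<close> converge to the indicator function of \<open>(a, b)\<close> and are dominated by it.
\<close>

lemma AE_zero_if_test_integrals_zero:
  fixes g :: "real \<Rightarrow> 'a :: {banach, second_countable_topology}"
  assumes loc: "locally_integrable g"
    and z: "\<And>\<phi>. test_function \<phi> \<Longrightarrow> (\<integral>x. \<phi> x *\<^sub>R g x \<partial>lborel) = 0"
  shows "AE x in lborel. g x = 0"
proof (rule AE_zero_if_interval_integrals_zero[OF loc])
  have int: "set_integrable lborel {a<..<b} g" for a b
    by (rule set_integrable_subset[of _ "{a..b}"]) (use loc in \<open>auto simp: locally_integrable_def\<close>)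
  fix a b :: real assume "a < b"
  let ?\<phi> = "\<lambda>n::nat. bump a b (1 / real (Suc n))"
  have [measurable]: "?\<phi> n \<in> borel_measurable borel" for n
    using test_function_deriv_cont(1)[OF test_function_bump]
    by (intro borel_measurable_continuous_onI) auto
  have eq: "?\<phi> n x *\<^sub>R g x = ?\<phi> n x *\<^sub>R (indicator {a<..<b} x *\<^sub>R g x)" for n x
    by (auto simp: bump_eq)
  have [measurable]: "(\<lambda>x. indicator {a<..<b} x *\<^sub>R g x) \<in> borel_measurable lborel"
    using int[of a b] unfolding set_integrable_def by auto
  have "(\<lambda>n. \<integral>x. ?\<phi> n x *\<^sub>R g x \<partial>lborel) \<longlonglongrightarrow> (\<integral>x. indicator {a<..<b} x *\<^sub>R g x \<partial>lborel)"
    unfolding eq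
  proof (rule integral_dominated_convergence[where w = "\<lambda>x. norm (indicator {a<..<b} x *\<^sub>R g x)"])
    show "integrable lborel (\<lambda>x. norm (indicator {a<..<b} x *\<^sub>R g x))"
      using int[of a b] unfolding set_integrable_def by (rule integrable_norm)
    have "(\<lambda>n. ?\<phi> n x *\<^sub>R indicator {a<..<b} x *\<^sub>R g x) \<longlonglongrightarrow> indicator {a<..<b} x *\<^sub>R g x" for x
    proof (cases "a < x \<and> x < b")
      case True
      have "(\<lambda>n. exp (- (1 / real (Suc n)) * (1 / ((x - a) * (b - x))))) \<longlonglongrightarrow>
          exp (- 0 * (1 / ((x - a) * (b - x))))"
        by (intro tendsto_intros LIMSEQ_Suc lim_inverse_n')
      then have "(\<lambda>n. ?\<phi> n x) \<longlonglongrightarrow> 1" using True by (simp add: bump_eq)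
      from tendsto_scaleR[OF this tendsto_const[of "g x"]] show ?thesis
        using True by simp
    qed (auto simp: indicator_def)
    then show "AE x in lborel. (\<lambda>n. ?\<phi> n x *\<^sub>R indicator {a<..<b} x *\<^sub>R g x) \<longlonglongrightarrow> indicator {a<..<b} x *\<^sub>R g x"
      by auto
    have "?\<phi> n x \<le> 1 \<and> 0 \<le> ?\<phi> n x" for n x by (auto simp: bump_eq intro!: divide_nonneg_nonneg)
    then show "AE x in lborel. norm (?\<phi> n x *\<^sub>R indicator {a<..<b} x *\<^sub>R g x)
        \<le> norm (indicator {a<..<b} x *\<^sub>R g x)" for n
      by (intro AE_I2) (auto intro!: mult_left_le_one_le simp: bump_eq indicator_def)
    show "(\<lambda>x. ?\<phi> n x *\<^sub>R indicator {a<..<b} x *\<^sub>R g x) \<in> borel_measurable lborel" for n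
      by measurable
    show "(\<lambda>x. indicator {a<..<b} x *\<^sub>R g x) \<in> borel_measurable lborel" by measurable
  qed
  moreover have "(\<integral>x. ?\<phi> n x *\<^sub>R g x \<partial>lborel) = 0" for n
    by (intro z test_function_bump) simp
  ultimately show "(LINT x:{a<..<b}|lborel. g x) = 0"
    unfolding set_lebesgue_integral_def by (simp add: LIMSEQ_const_iff)
qed


lemma integrable_compact_support_mult:
  fixes f :: "real \<Rightarrow> 'a :: {banach, second_countable_topology}"
  assumes "continuous_on UNIV h" "\<And>x. \<bar>x\<bar> \<ge> R \<Longrightarrow> h x = (0::real)" "locally_integrable f"
  shows "integrable lborel (\<lambda>x. h x *\<^sub>R f x)"
proof -
  have "compact (h ` {-R..R})"
    by (intro compact_continuous_image continuous_on_subset[OF assms(1)]) auto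
  then have "bounded (h ` {-R..R})" by (rule compact_imp_bounded)
  then obtain M where M: "\<And>y. y \<in> {-R..R} \<Longrightarrow> \<bar>h y\<bar> \<le> M"
    unfolding bounded_iff by (metis imageI real_norm_def)
  have [measurable]: "h \<in> borel_measurable borel"
    by (rule borel_measurable_continuous_onI[OF assms(1)])
  have fi: "integrable lborel (\<lambda>x. indicator {-R..R} x *\<^sub>R f x)"
    using assms(3) by (auto simp: locally_integrable_def set_integrable_def)
  then have [measurable]: "(\<lambda>x. indicator {-R..R} x *\<^sub>R f x) \<in> borel_measurable lborel" by auto
  have "integrable lborel (\<lambda>x. h x *\<^sub>R (indicator {-R..R} x *\<^sub>R f x))"
  proof (rule Bochner_Integration.integrable_bound)
    show "integrable lborel (\<lambda>x. \<bar>M\<bar> *\<^sub>R (indicator {-R..R} x *\<^sub>R f x))"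
      using fi by (rule integrable_scaleR_right)
    have "norm (h x *\<^sub>R indicator {- R..R} x *\<^sub>R f x) \<le> norm (\<bar>M\<bar> *\<^sub>R indicator {- R..R} x *\<^sub>R f x)" for x
      using M[of x] by (auto simp: indicator_def intro!: mult_right_mono)
    then show "AE x in lborel. norm (h x *\<^sub>R indicator {- R..R} x *\<^sub>R f x)
        \<le> norm (\<bar>M\<bar> *\<^sub>R indicator {- R..R} x *\<^sub>R f x)"
      by simp
  qed measurable
  also have "(\<lambda>x. h x *\<^sub>R (indicator {-R..R} x *\<^sub>R f x)) = (\<lambda>x. h x *\<^sub>R f x)"
  proof
    fix x show "h x *\<^sub>R (indicator {-R..R} x *\<^sub>R f x) = h x *\<^sub>R f x"
      using assms(2)[of x] by (cases "\<bar>x\<bar> \<ge> R") (auto simp: indicator_def abs_le_iff)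
  qed
  finally show ?thesis .
qed

lemma locally_integrable_continuous:
  fixes f :: "real \<Rightarrow> 'a :: {banach, second_countable_topology}"
  assumes "continuous_on UNIV f"
  shows "locally_integrable f"
  unfolding locally_integrable_def set_integrable_def
  using borel_integrable_compact[of "{_.._}" f] continuous_on_subset[OF assms] by auto

lemma locally_integrable_diff:
  fixes f g :: "real \<Rightarrow> 'a :: {banach, second_countable_topology}"
  assumes "locally_integrable f" "locally_integrable g"
  shows "locally_integrable (\<lambda>x. f x - g x)"
  using assms unfolding locally_integrable_def by auto

text \<open>
  The integral from \<open>0\<close>, oriented so that it is a primitive on the whole line.
\<close>

definition primitive :: "(real \<Rightarrow> 'a :: banach) \<Rightarrow> real \<Rightarrow> 'a" where
  "primitive g x = (if 0 \<le> x then integral {0..x} g else - integral {x..0} g)"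

lemma primitive_shift:
  assumes "\<And>a b. g integrable_on {a..b}" "a \<le> x"
  shows "primitive g x = primitive g a + integral {a..x} g"
proof -
  have "integral {u..v} g + integral {v..w} g = integral {u..w} g" if "u \<le> v" "v \<le> w" for u v w
    using that assms(1) by (rule Henstock_Kurzweil_Integration.integral_combine)
  from this[of 0 a x] this[of a 0 x] this[of a x 0] assms(2) show ?thesis
    by (auto simp: primitive_def algebra_simps)
qed

lemma primitive_continuous:
  assumes "\<And>a b. g integrable_on {a..b}"
  shows "continuous_on UNIV (primitive g)"
proof (rule continuous_at_imp_continuous_on, rule ballI)
  fix x :: real
  define N where "N = \<bar>x\<bar> + 1"
  have "continuous_on {-N..N} (\<lambda>y. primitive g (-N) + integral {-N..y} g)"
    by (intro continuous_intros indefinite_integral_continuous_1 assms)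
  then have "continuous_on {-N<..<N} (primitive g)"
  proof -
    assume "continuous_on {-N..N} (\<lambda>y. primitive g (-N) + integral {-N..y} g)"
    then have "continuous_on {-N<..<N} (\<lambda>y. primitive g (-N) + integral {-N..y} g)"
      by (rule continuous_on_subset) auto
    moreover have "primitive g (-N) + integral {-N..y} g = primitive g y" if "y \<in> {-N<..<N}" for y
      using primitive_shift[OF assms, of "-N" y] that by simp
    ultimately show ?thesis
      using continuous_on_cong[OF refl] by (metis (no_types, lifting))
  qed
  then show "isCont (primitive g) x"
    by (auto simp: continuous_on_eq_continuous_at N_def elim!: bspec)
qed

lemma primitive_has_vector_derivative:
  assumes "continuous_on UNIV g"
  shows "(primitive g has_vector_derivative g x) (at x)"
proof -
  have int: "g integrable_on {a..b}" for a b
    by (intro integrable_continuous_real continuous_on_subset[OF assms]) auto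
  define N where "N = \<bar>x\<bar> + 1"
  have x: "x \<in> {-N<..<N}" by (auto simp: N_def)
  have "((\<lambda>u. integral {-N..u} g) has_vector_derivative g x) (at x within {-N..N})"
    by (rule integral_has_vector_derivative) (use x continuous_on_subset[OF assms] in auto)
  then have "((\<lambda>u. integral {-N..u} g) has_vector_derivative g x) (at x)"
    using x by (subst (asm) at_within_interior) auto
  then have "((\<lambda>u. primitive g (-N) + integral {-N..u} g) has_vector_derivative 0 + g x) (at x)"
    by (intro derivative_intros)
  then have "((\<lambda>u. primitive g (-N) + integral {-N..u} g) has_vector_derivative g x) (at x)"
    by simp
  then show ?thesis
  proof (rule has_vector_derivative_transform_within_open[where S = "{-N<..<N}"])
    show "primitive g (- N) + integral {- N..y} g = primitive g y" if "y \<in> {-N<..<N}" for y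
      using primitive_shift[OF int, of "-N" y] that by simp
  qed (use x in auto)
qed

lemma locally_integrable_HK:
  fixes g :: "real \<Rightarrow> 'a :: euclidean_space"
  assumes "locally_integrable g"
  shows "g integrable_on {a..b}"
    and "(\<integral>y. indicator {a..b} y *\<^sub>R g y \<partial>lborel) = integral {a..b} g"
  using set_borel_integral_eq_integral[of "{a..b}" g] assms
  by (auto simp: locally_integrable_def set_lebesgue_integral_def)

lemma integral_deriv_test_function:
  assumes "test_function \<phi>" "\<And>x. \<bar>x\<bar> \<ge> R \<Longrightarrow> \<phi> x = 0" "-R \<le> y" "y \<le> R"
  shows "(\<integral>x. indicator {y..R} x *\<^sub>R deriv \<phi> x \<partial>lborel) = - \<phi> y"
proof -
  have "(\<integral>x. indicator {y..R} x *\<^sub>R deriv \<phi> x \<partial>lborel) = \<phi> R - \<phi> y"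
  proof (rule integral_FTC_Icc)
    show "(\<phi> has_vector_derivative deriv \<phi> x) (at x within {y..R})" for x
      using test_function_differentiable[OF assms(1)]
      by (meson has_field_derivative_at_within has_real_derivative_iff_has_vector_derivative)
  qed (use assms test_function_deriv_cont[OF assms(1)] in auto)
  then show ?thesis using assms(2)[of R] assms(3,4) by simp
qed

text \<open>
  Integration by parts for a merely integrable \<open>g\<close>: Fubini's theorem on the triangle
  \<open>- R \<le> y \<le> x \<le> R\<close>, where \<open>R\<close> bounds the support of \<open>\<phi>\<close>.
\<close>

lemma primitive_weak_deriv:
  fixes g :: "real \<Rightarrow> 'a :: euclidean_space"
  assumes g: "locally_integrable g" and \<phi>: "test_function \<phi>"
  shows "(\<integral>x. deriv \<phi> x *\<^sub>R primitive g x \<partial>lborel) = - (\<integral>x. \<phi> x *\<^sub>R g x \<partial>lborel)"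
proof -
  obtain R where R: "R > 0" "\<And>x. \<bar>x\<bar> \<ge> R \<Longrightarrow> \<phi> x = 0" "\<And>x. \<bar>x\<bar> \<ge> R \<Longrightarrow> deriv \<phi> x = 0"
    using test_function_support[OF \<phi>] by blast
  note cont = test_function_deriv_cont[OF \<phi>]
  have [measurable]: "\<phi> \<in> borel_measurable borel" "deriv \<phi> \<in> borel_measurable borel"
    using cont[of UNIV] by (auto intro: borel_measurable_continuous_onI)
  define h where "h = (\<lambda>y. indicator {-R..R} y *\<^sub>R g y)"
  have hi: "integrable lborel h"
    using g by (auto simp: h_def locally_integrable_def set_integrable_def)
  then have [measurable]: "h \<in> borel_measurable borel" by auto
  define F where "F = (\<lambda>(x, y). (if y \<le> x \<and> x \<le> R then deriv \<phi> x *\<^sub>R h y else 0))"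
  have Fm[measurable]: "F \<in> borel_measurable (lborel \<Otimes>\<^sub>M lborel)"
    unfolding F_def by measurable
  have "compact (deriv \<phi> ` {-R..R})"
    by (intro compact_continuous_image cont) auto
  then have "bounded (deriv \<phi> ` {-R..R})" by (rule compact_imp_bounded)
  then obtain M where M: "\<And>y. y \<in> {-R..R} \<Longrightarrow> \<bar>deriv \<phi> y\<bar> \<le> M"
    unfolding bounded_iff by (metis imageI real_norm_def)
  have bd: "norm (F (x, y)) \<le> indicator {-R..R} x * \<bar>M\<bar> * norm (h y)" for x y
    using M[of x] R(3)[of x] unfolding F_def
    by (cases "x \<in> {-R..R}") (auto simp: indicator_def abs_le_iff intro!: mult_right_mono)
  have int2: "integrable lborel (\<lambda>y. F (x, y))" for x
  proof (rule Bochner_Integration.integrable_bound)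
    show "integrable lborel (\<lambda>y. indicator {-R..R} x * \<bar>M\<bar> * norm (h y))"
      using hi by auto
    show "AE y in lborel. norm (F (x, y)) \<le> norm (indicator {-R..R} x * \<bar>M\<bar> * norm (h y))"
      using bd by (auto intro!: AE_I2 order_trans[OF bd])
  qed measurable
  have int1: "integrable lborel (\<lambda>x. \<integral>y. norm (F (x, y)) \<partial>lborel)"
  proof (rule Bochner_Integration.integrable_bound)
    show "integrable lborel (\<lambda>x. indicator {-R..R} x * (\<bar>M\<bar> * (\<integral>y. norm (h y) \<partial>lborel)))"
      by (intro integrable_mult_left) (simp add: integrable_indicator_iff emeasure_lborel_Icc_eq)
    have "norm (\<integral>y. norm (F (x, y)) \<partial>lborel) \<le> norm (indicator {-R..R} x * (\<bar>M\<bar> * (\<integral>y. norm (h y) \<partial>lborel)))"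
        for x
    proof -
      have "(\<integral>y. norm (F (x, y)) \<partial>lborel) \<le> (\<integral>y. indicator {-R..R} x * \<bar>M\<bar> * norm (h y) \<partial>lborel)"
        by (rule integral_mono) (use int2 hi bd in auto)
      then show ?thesis by (auto simp: abs_mult)
    qed
    then show "AE x in lborel. norm (\<integral>y. norm (F (x, y)) \<partial>lborel)
        \<le> norm (indicator {-R..R} x * (\<bar>M\<bar> * (\<integral>y. norm (h y) \<partial>lborel)))"
      by simp
  qed measurable
  have Fint: "integrable (lborel \<Otimes>\<^sub>M lborel) F"
    using int1 int2 by (intro lborel_pair.Fubini_integrable) auto
  have swap: "(\<integral>y. \<integral>x. F (x, y) \<partial>lborel \<partial>lborel) = (\<integral>x. \<integral>y. F (x, y) \<partial>lborel \<partial>lborel)"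
    using lborel_pair.Fubini_integral[of "\<lambda>x y. F (x, y)"] Fint by simp
  have in1: "(\<integral>x. F (x, y) \<partial>lborel) = - (\<phi> y *\<^sub>R g y)" for y
  proof (cases "y \<in> {-R..R}")
    case True
    have "(\<integral>x. F (x, y) \<partial>lborel) = (\<integral>x. (indicator {y..R} x *\<^sub>R deriv \<phi> x) *\<^sub>R g y \<partial>lborel)"
      using True unfolding F_def h_def
      by (intro Bochner_Integration.integral_cong) (auto simp: indicator_def)
    also have "\<dots> = (\<integral>x. indicator {y..R} x *\<^sub>R deriv \<phi> x \<partial>lborel) *\<^sub>R g y"
      by (rule integral_scaleR_left)
         (use borel_integrable_compact[of "{y..R}" "deriv \<phi>"] cont in auto)
    also have "\<dots> = - (\<phi> y *\<^sub>R g y)"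
      using True by (subst integral_deriv_test_function[OF \<phi> R(2)]) auto
    finally show ?thesis .
  next
    case False
    then have "h y = 0" "\<phi> y = 0" using R(2)[of y] by (auto simp: h_def)
    then show ?thesis by (simp add: F_def cong: if_cong)
  qed
  have in2: "(\<integral>y. F (x, y) \<partial>lborel) = deriv \<phi> x *\<^sub>R (primitive g x - primitive g (-R))" for x
  proof (cases "x \<in> {-R..R}")
    case True
    have "(\<integral>y. F (x, y) \<partial>lborel) = (\<integral>y. deriv \<phi> x *\<^sub>R (indicator {-R..x} y *\<^sub>R g y) \<partial>lborel)"
      using True unfolding F_def h_def
      by (intro Bochner_Integration.integral_cong) (auto simp: indicator_def)
    also have "\<dots> = deriv \<phi> x *\<^sub>R (\<integral>y. indicator {-R..x} y *\<^sub>R g y \<partial>lborel)"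
      by (rule integral_scaleR_right)
    also have "\<dots> = deriv \<phi> x *\<^sub>R (primitive g x - primitive g (-R))"
      using True by (simp add: locally_integrable_HK[OF g] primitive_shift[OF locally_integrable_HK(1)[OF g],
          of "-R" x])
    finally show ?thesis .
  next
    case False
    then have "deriv \<phi> x = 0" using R(3)[of x] by auto
    then show ?thesis by (simp add: F_def cong: if_cong)
  qed
  have Pi: "integrable lborel (\<lambda>x. deriv \<phi> x *\<^sub>R primitive g x)"
    by (rule integrable_compact_support_mult[OF cont(2) R(3)])
       (auto intro!: locally_integrable_continuous primitive_continuous locally_integrable_HK g)
  have Di: "integrable lborel (\<lambda>x. deriv \<phi> x *\<^sub>R primitive g (-R))"
    by (rule integrable_compact_support_mult[OF cont(2) R(3)])
       (auto intro!: locally_integrable_continuous)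
  have "integrable lborel (\<lambda>x. deriv \<phi> x *\<^sub>R (1::real))"
    by (rule integrable_compact_support_mult[OF cont(2) R(3)])
       (auto intro!: locally_integrable_continuous)
  then have Di': "integrable lborel (deriv \<phi>)" by simp
  have D0: "(\<integral>x. deriv \<phi> x \<partial>lborel) = 0"
  proof -
    have "(\<integral>x. deriv \<phi> x \<partial>lborel) = (\<integral>x. indicator {-R..R} x *\<^sub>R deriv \<phi> x \<partial>lborel)"
    proof (intro Bochner_Integration.integral_cong refl)
      fix x show "deriv \<phi> x = indicator {- R..R} x *\<^sub>R deriv \<phi> x"
        using R(3)[of x] by (cases "\<bar>x\<bar> \<ge> R") (auto simp: indicator_def)
    qed
    also have "\<dots> = - \<phi> (-R)"
      by (rule integral_deriv_test_function[OF \<phi> R(2)]) (use R(1) in auto)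
    finally show ?thesis using R(1) R(2)[of "-R"] by simp
  qed
  have "(\<integral>x. \<integral>y. F (x, y) \<partial>lborel \<partial>lborel) = (\<integral>x. deriv \<phi> x *\<^sub>R primitive g x \<partial>lborel)"
    unfolding in2 scaleR_diff_right using Pi Di Di' D0 by simp
  then show ?thesis using swap unfolding in1 by simp
qed


lemma test_function_diff_scale:
  assumes "test_function f" "test_function g"
  shows "test_function (\<lambda>x. f x - k * g x)"
proof -
  have d: "((deriv ^^ n) f has_real_derivative (deriv ^^ Suc n) f x) (at x)"
    "((deriv ^^ n) g has_real_derivative (deriv ^^ Suc n) g x) (at x)" for n x
    using assms by (auto simp: test_function_def DERIV_deriv_iff_real_differentiable)
  have D: "((\<lambda>x. (deriv ^^ n) f x - k * (deriv ^^ n) g x) has_real_derivative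
      (deriv ^^ Suc n) f x - k * (deriv ^^ Suc n) g x) (at x)" for n x
    by (intro DERIV_diff DERIV_cmult d)
  have eq: "(deriv ^^ n) (\<lambda>x. f x - k * g x) = (\<lambda>x. (deriv ^^ n) f x - k * (deriv ^^ n) g x)" for n
  proof (induction n)
    case (Suc n)
    have "(deriv ^^ Suc n) (\<lambda>x. f x - k * g x) = deriv (\<lambda>x. (deriv ^^ n) f x - k * (deriv ^^ n) g x)"
      using Suc by simp
    also have "\<dots> = (\<lambda>x. (deriv ^^ Suc n) f x - k * (deriv ^^ Suc n) g x)"
      by (intro ext DERIV_imp_deriv D)
    finally show ?case .
  qed simp
  obtain R1 where R1: "\<And>x. \<bar>x\<bar> \<ge> R1 \<Longrightarrow> f x = 0" using test_function_support[OF assms(1)] by metis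
  obtain R2 where R2: "\<And>x. \<bar>x\<bar> \<ge> R2 \<Longrightarrow> g x = 0" using test_function_support[OF assms(2)] by metis
  have "{x. f x - k * g x \<noteq> 0} \<subseteq> {- max R1 R2..max R1 R2}"
  proof
    fix x assume "x \<in> {x. f x - k * g x \<noteq> 0}"
    then have "\<not> (\<bar>x\<bar> \<ge> R1 \<and> \<bar>x\<bar> \<ge> R2)" using R1 R2 by auto
    then show "x \<in> {- max R1 R2..max R1 R2}" by auto
  qed
  then have "bounded {x. f x - k * g x \<noteq> 0}" by (rule bounded_subset[rotated]) simp
  then show ?thesis
    unfolding test_function_def eq using D by (auto simp: compact_closure real_differentiable_def)
qed

lemma test_function_integrable:
  fixes f :: "real \<Rightarrow> 'a :: {banach, second_countable_topology}"
  assumes "test_function \<phi>" "locally_integrable f"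
  shows "integrable lborel (\<lambda>x. \<phi> x *\<^sub>R f x)" "integrable lborel (\<lambda>x. deriv \<phi> x *\<^sub>R f x)"
proof -
  obtain R where R: "\<And>x. \<bar>x\<bar> \<ge> R \<Longrightarrow> \<phi> x = 0" "\<And>x. \<bar>x\<bar> \<ge> R \<Longrightarrow> deriv \<phi> x = 0"
    using test_function_support[OF assms(1)] by metis
  show "integrable lborel (\<lambda>x. \<phi> x *\<^sub>R f x)" "integrable lborel (\<lambda>x. deriv \<phi> x *\<^sub>R f x)"
    by (rule integrable_compact_support_mult[where R = R];
        use test_function_deriv_cont[OF assms(1)] assms(2) R in blast)+
qed

text \<open>
  A mean value of zero is what makes the primitive vanish to the right of the support.
\<close>

lemma test_function_mean_zero_primitive:
  assumes \<eta>: "test_function \<eta>" and z: "(\<integral>x. \<eta> x \<partial>lborel) = 0"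
  shows "\<exists>\<phi>. test_function \<phi> \<and> deriv \<phi> = \<eta>"
proof -
  obtain R where R: "R > 0" "\<And>x. \<bar>x\<bar> \<ge> R \<Longrightarrow> \<eta> x = 0" using test_function_support[OF \<eta>] by metis
  have cont: "continuous_on UNIV \<eta>" by (rule test_function_deriv_cont[OF \<eta>])
  have loc: "locally_integrable \<eta>" by (rule locally_integrable_continuous[OF cont])
  note HK = locally_integrable_HK[OF loc]
  define \<phi> where "\<phi> = (\<lambda>x. primitive \<eta> x - primitive \<eta> (-R))"
  have d: "(\<phi> has_real_derivative \<eta> x) (at x)" for x
    unfolding \<phi>_def using primitive_has_vector_derivative[OF cont, of x]
    by (auto intro!: derivative_eq_intros simp: has_real_derivative_iff_has_vector_derivative)
  have left: "\<phi> x = 0" if "x \<le> -R" for x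
  proof -
    have "integral {x..-R} \<eta> = integral {x..-R} (\<lambda>_. 0)"
      by (rule Henstock_Kurzweil_Integration.integral_cong) (use R in auto)
    then show ?thesis
      using primitive_shift[OF HK(1) that] by (simp add: \<phi>_def)
  qed
  have right: "\<phi> x = 0" if "x \<ge> R" for x
  proof -
    have "\<phi> x = integral {-R..x} \<eta>"
      using primitive_shift[OF HK(1), of "-R" x] that R(1) by (simp add: \<phi>_def)
    also have "\<dots> = (\<integral>y. indicator {-R..x} y *\<^sub>R \<eta> y \<partial>lborel)" by (rule HK(2)[symmetric])
    also have "\<dots> = (\<integral>y. \<eta> y \<partial>lborel)"
    proof (intro Bochner_Integration.integral_cong refl)
      fix y show "indicator {-R..x} y *\<^sub>R \<eta> y = \<eta> y"
        using R(2)[of y] that by (cases "\<bar>y\<bar> \<ge> R") (auto simp: indicator_def)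
    qed
    finally show ?thesis using z by simp
  qed
  have "\<phi> x = 0" if "\<bar>x\<bar> \<ge> R" for x
    using left[of x] right[of x] that by linarith
  then have "test_function \<phi>" using test_function_antiderivative[OF \<eta> d] by blast
  moreover have "deriv \<phi> = \<eta>" using d by (auto intro: DERIV_imp_deriv)
  ultimately show ?thesis by blast
qed

lemma integral_bump_pos: "(\<integral>x. bump 0 1 1 x \<partial>lborel) > 0"
proof -
  have int: "integrable lborel (bump 0 1 1)"
    using test_function_integrable(1)[OF test_function_bump[of 1 0 1] locally_integrable_continuous[of "\<lambda>_.
        1::real"]]
    by simp
  have nn: "bump 0 1 1 x \<ge> 0" for x by (simp add: bump_eq)
  have "(\<integral>x. bump 0 1 1 x \<partial>lborel) \<noteq> 0"
  proof
    assume "(\<integral>x. bump 0 1 1 x \<partial>lborel) = 0"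
    then have "AE x in lborel. bump 0 1 1 x = 0"
      using integral_nonneg_eq_0_iff_AE[OF int] nn by simp
    then have "AE x in lborel. x \<notin> {0<..<1::real}"
      by eventually_elim (auto simp: bump_eq)
    then have "emeasure lborel {0<..<1::real} = 0"
      using AE_iff_measurable[of "{0<..<1::real}" lborel "\<lambda>x. x \<notin> {0<..<1}"]
      by (auto simp: greaterThanLessThan_def greaterThan_def lessThan_def Int_def)
    then show False by (simp del: greaterThanLessThan_iff)
  qed
  moreover have "(\<integral>x. bump 0 1 1 x \<partial>lborel) \<ge> 0" using nn by simp
  ultimately show ?thesis by simp
qed

text \<open>
  The lemma of du Bois-Reymond. After subtracting a multiple of one fixed bump, an arbitrary test
  function has mean value zero and is the derivative of a test function.
\<close>

lemma AE_constant_if_weak_deriv_zero: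
  fixes F :: "real \<Rightarrow> 'a :: euclidean_space"
  assumes loc: "locally_integrable F"
    and z: "\<And>\<phi>. test_function \<phi> \<Longrightarrow> (\<integral>x. deriv \<phi> x *\<^sub>R F x \<partial>lborel) = 0"
  shows "\<exists>c. AE x in lborel. F x = c"
proof -
  let ?\<beta> = "bump 0 1 1"
  have \<beta>: "test_function ?\<beta>" by (rule test_function_bump) simp
  define J where "J = (\<integral>x. ?\<beta> x \<partial>lborel)"
  have J: "J > 0" using integral_bump_pos by (simp add: J_def)
  define c where "c = (1 / J) *\<^sub>R (\<integral>x. ?\<beta> x *\<^sub>R F x \<partial>lborel)"
  have one: "integrable lborel \<psi>" if "test_function \<psi>" for \<psi>
    using test_function_integrable(1)[OF that locally_integrable_continuous[of "\<lambda>_. 1::real"]] by simp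
  have locc: "locally_integrable (\<lambda>_. c)" by (intro locally_integrable_continuous continuous_intros)
  have "AE x in lborel. F x - c = 0"
  proof (rule AE_zero_if_test_integrals_zero)
    show "locally_integrable (\<lambda>x. F x - c)" by (intro locally_integrable_diff loc locc)
    fix \<psi> assume \<psi>: "test_function \<psi>"
    define k where "k = (\<integral>x. \<psi> x \<partial>lborel) / J"
    have \<eta>: "test_function (\<lambda>x. \<psi> x - k * ?\<beta> x)" by (rule test_function_diff_scale[OF \<psi> \<beta>])
    have "(\<integral>x. \<psi> x - k * ?\<beta> x \<partial>lborel) = 0"
      using one[OF \<psi>] one[OF \<beta>] J by (simp add: k_def J_def)
    then obtain \<phi> where "test_function \<phi>" "deriv \<phi> = (\<lambda>x. \<psi> x - k * ?\<beta> x)"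
      using test_function_mean_zero_primitive[OF \<eta>] by blast
    then have "(\<integral>x. (\<psi> x - k * ?\<beta> x) *\<^sub>R F x \<partial>lborel) = 0" using z by metis
    moreover have "(\<integral>x. (\<psi> x - k * ?\<beta> x) *\<^sub>R F x \<partial>lborel) =
        (\<integral>x. \<psi> x *\<^sub>R F x - k *\<^sub>R (?\<beta> x *\<^sub>R F x) \<partial>lborel)"
      by (simp add: scaleR_diff_left)
    moreover have "\<dots> = (\<integral>x. \<psi> x *\<^sub>R F x \<partial>lborel) - (\<integral>x. k *\<^sub>R (?\<beta> x *\<^sub>R F x) \<partial>lborel)"
      by (intro Bochner_Integration.integral_diff integrable_scaleR_right
          test_function_integrable(1) \<psi> \<beta> loc)
    moreover have "(\<integral>x. k *\<^sub>R (?\<beta> x *\<^sub>R F x) \<partial>lborel) = k *\<^sub>R (\<integral>x. ?\<beta> x *\<^sub>R F x \<partial>lborel)"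
      by (rule integral_scaleR_right)
    moreover have "(\<integral>x. \<psi> x *\<^sub>R (F x - c) \<partial>lborel) =
        (\<integral>x. \<psi> x *\<^sub>R F x \<partial>lborel) - (\<integral>x. \<psi> x \<partial>lborel) *\<^sub>R c"
      using test_function_integrable(1)[OF \<psi> loc] one[OF \<psi>] by (simp add: scaleR_diff_right)
    moreover have "(\<integral>x. \<psi> x \<partial>lborel) *\<^sub>R c = k *\<^sub>R (\<integral>x. ?\<beta> x *\<^sub>R F x \<partial>lborel)"
      by (simp add: c_def k_def)
    ultimately show "(\<integral>x. \<psi> x *\<^sub>R (F x - c) \<partial>lborel) = 0" by simp
  qed
  then show ?thesis by auto
qed

lemma weak_deriv_AE_primitive:
  fixes f g :: "real \<Rightarrow> 'a :: euclidean_space"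
  assumes f: "locally_integrable f" and g: "locally_integrable g"
    and w: "\<And>\<phi>. test_function \<phi> \<Longrightarrow>
        (\<integral>x. deriv \<phi> x *\<^sub>R f x \<partial>lborel) = - (\<integral>x. \<phi> x *\<^sub>R g x \<partial>lborel)"
  shows "\<exists>c. AE x in lborel. f x = c + primitive g x"
proof -
  have P: "locally_integrable (primitive g)"
    by (intro locally_integrable_continuous primitive_continuous locally_integrable_HK g)
  have "\<exists>c. AE x in lborel. f x - primitive g x = c"
  proof (rule AE_constant_if_weak_deriv_zero)
    show "locally_integrable (\<lambda>x. f x - primitive g x)" by (rule locally_integrable_diff[OF f P])
    fix \<phi> assume \<phi>: "test_function \<phi>"
    show "(\<integral>x. deriv \<phi> x *\<^sub>R (f x - primitive g x) \<partial>lborel) = 0"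
      using w[OF \<phi>] primitive_weak_deriv[OF g \<phi>] test_function_integrable(2)[OF \<phi> f]
        test_function_integrable(2)[OF \<phi> P]
      by (simp add: scaleR_diff_right)
  qed
  then obtain c where "AE x in lborel. f x - primitive g x = c" by blast
  then have "AE x in lborel. f x = c + primitive g x"
    by eventually_elim (simp add: algebra_simps)
  then show ?thesis by blast
qed

lemma weak_deriv_AE_unique:
  fixes g h :: "real \<Rightarrow> 'a :: euclidean_space"
  assumes g: "locally_integrable g" and h: "locally_integrable h"
    and eq: "\<And>\<phi>. test_function \<phi> \<Longrightarrow> (\<integral>x. \<phi> x *\<^sub>R g x \<partial>lborel) = (\<integral>x. \<phi> x *\<^sub>R h x \<partial>lborel)"
  shows "AE x in lborel. g x = h x"
proof -
  have "AE x in lborel. g x - h x = 0"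
  proof (rule AE_zero_if_test_integrals_zero)
    show "locally_integrable (\<lambda>x. g x - h x)" by (rule locally_integrable_diff[OF g h])
    show "(\<integral>x. \<phi> x *\<^sub>R (g x - h x) \<partial>lborel) = 0" if "test_function \<phi>" for \<phi>
      using eq[OF that] test_function_integrable(1)[OF that g] test_function_integrable(1)[OF that h]
      by (simp add: scaleR_diff_right)
  qed
  then show ?thesis by simp
qed

lemma C1_weak_deriv:
  fixes G g :: "real \<Rightarrow> 'a :: euclidean_space"
  assumes d: "\<And>x. (G has_vector_derivative g x) (at x)" and g: "continuous_on UNIV g"
    and \<phi>: "test_function \<phi>"
  shows "(\<integral>x. deriv \<phi> x *\<^sub>R G x \<partial>lborel) = - (\<integral>x. \<phi> x *\<^sub>R g x \<partial>lborel)"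
proof -
  obtain R where R: "R > 0" "\<And>x. \<bar>x\<bar> \<ge> R \<Longrightarrow> \<phi> x = 0" "\<And>x. \<bar>x\<bar> \<ge> R \<Longrightarrow> deriv \<phi> x = 0"
    using test_function_support[OF \<phi>] by blast
  note cont = test_function_deriv_cont[OF \<phi>]
  have G: "continuous_on UNIV G"
    using d by (meson continuous_at_imp_continuous_on has_vector_derivative_continuous)
  have i: "integrable lborel (\<lambda>x. deriv \<phi> x *\<^sub>R G x)" "integrable lborel (\<lambda>x. \<phi> x *\<^sub>R g x)"
    using test_function_integrable[OF \<phi>] locally_integrable_continuous[OF G]
      locally_integrable_continuous[OF g] by blast+
  have "(\<integral>x. deriv \<phi> x *\<^sub>R G x + \<phi> x *\<^sub>R g x \<partial>lborel)
      = (\<integral>x. indicator {-R..R} x *\<^sub>R (deriv \<phi> x *\<^sub>R G x + \<phi> x *\<^sub>R g x) \<partial>lborel)"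
  proof (intro Bochner_Integration.integral_cong refl)
    fix x show "deriv \<phi> x *\<^sub>R G x + \<phi> x *\<^sub>R g x =
        indicator {-R..R} x *\<^sub>R (deriv \<phi> x *\<^sub>R G x + \<phi> x *\<^sub>R g x)"
      using R(2,3)[of x] by (cases "\<bar>x\<bar> \<ge> R") (auto simp: indicator_def)
  qed
  also have "\<dots> = \<phi> R *\<^sub>R G R - \<phi> (-R) *\<^sub>R G (-R)"
  proof (rule integral_FTC_Icc)
    show "((\<lambda>x. \<phi> x *\<^sub>R G x) has_vector_derivative deriv \<phi> x *\<^sub>R G x + \<phi> x *\<^sub>R g x) (at x within {-R..R})" for
        x
    proof -
      have "((\<lambda>x. \<phi> x *\<^sub>R G x) has_vector_derivative \<phi> x *\<^sub>R g x + deriv \<phi> x *\<^sub>R G x) (at x)"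
        by (intro has_vector_derivative_scaleR test_function_differentiable \<phi> d)
      then show ?thesis by (simp add: has_vector_derivative_at_within add.commute)
    qed
    show "continuous_on {-R..R} (\<lambda>x. deriv \<phi> x *\<^sub>R G x + \<phi> x *\<^sub>R g x)"
      by (intro continuous_intros cont continuous_on_subset[OF G] continuous_on_subset[OF g]) auto
  qed (use R in auto)
  finally have "(\<integral>x. deriv \<phi> x *\<^sub>R G x + \<phi> x *\<^sub>R g x \<partial>lborel) = 0"
    using R(2)[of R] R(2)[of "-R"] R(1) by simp
  with i show ?thesis by (simp add: eq_neg_iff_add_eq_0)
qed

section \<open>The real Dirac system as a linear ODE\<close>

text \<open>
  The system satisfied by the two real components of a spinor with \<open>\<D>\<^sub>m f = E f\<close>. Derivatives are
  two-sided also on a proper subset \<open>S\<close> of the line, because the solutions that are compared on \<open>S\<close>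
  exist on all of the line.
\<close>

definition dirac_ode :: "(real \<Rightarrow> real) \<Rightarrow> real \<Rightarrow> real set \<Rightarrow> (real \<Rightarrow> real) \<Rightarrow> (real \<Rightarrow> real) \<Rightarrow> bool" where
  "dirac_ode m E S u w \<longleftrightarrow> (\<forall>x\<in>S.
     (u has_real_derivative - m x * u x - E * w x) (at x) \<and>
     (w has_real_derivative m x * w x + E * u x) (at x))"

lemma dirac_odeD:
  assumes "dirac_ode m E S u w" "x \<in> S"
  shows "(u has_real_derivative - m x * u x - E * w x) (at x)"
    and "(w has_real_derivative m x * w x + E * u x) (at x)"
  using assms by (auto simp: dirac_ode_def)

lemma dirac_ode_mono: "dirac_ode m E S u w \<Longrightarrow> T \<subseteq> S \<Longrightarrow> dirac_ode m E T u w"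
  by (auto simp: dirac_ode_def)

lemma dirac_ode_linear:
  assumes "dirac_ode m E S u w" "dirac_ode m E S u' w'"
  shows "dirac_ode m E S (\<lambda>x. a * u x + b * u' x) (\<lambda>x. a * w x + b * w' x)"
  unfolding dirac_ode_def
proof (intro ballI conjI)
  fix x assume x: "x \<in> S"
  note d = dirac_odeD[OF assms(1) x] dirac_odeD[OF assms(2) x]
  show "((\<lambda>x. a * u x + b * u' x) has_real_derivative
      - m x * (a * u x + b * u' x) - E * (a * w x + b * w' x)) (at x)"
    by (rule DERIV_cong[OF DERIV_add[OF DERIV_cmult[OF d(1)] DERIV_cmult[OF d(3)]]])
       (simp add: algebra_simps)
  show "((\<lambda>x. a * w x + b * w' x) has_real_derivative
      m x * (a * w x + b * w' x) + E * (a * u x + b * u' x)) (at x)"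
    by (rule DERIV_cong[OF DERIV_add[OF DERIV_cmult[OF d(2)] DERIV_cmult[OF d(4)]]])
       (simp add: algebra_simps)
qed

lemma DERIV_nondecreasing:
  fixes f :: "real \<Rightarrow> real"
  assumes "a \<le> b" "\<And>x. a \<le> x \<Longrightarrow> x \<le> b \<Longrightarrow> (f has_real_derivative f' x) (at x)"
    "\<And>x. a \<le> x \<Longrightarrow> x \<le> b \<Longrightarrow> f' x \<ge> 0"
  shows "f a \<le> f b"
  using DERIV_nonneg_imp_nondecreasing[of a b f] assms by blast

text \<open>
  The step of the Picard iteration: integrating a bound of order \<open>n\<close> improves it to order \<open>n + 1\<close>,
  on both sides of \<open>0\<close>.
\<close>

lemma abs_primitive_monomial_bound:
  fixes f :: "real \<Rightarrow> real"
  assumes f: "\<And>x. (f has_real_derivative f' x) (at x)" "f 0 = 0"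
    and b: "\<And>x. \<bar>f' x\<bar> \<le> C * M ^ Suc n * \<bar>x\<bar> ^ n / fact n"
  shows "\<bar>f x\<bar> \<le> C * M ^ Suc n * \<bar>x\<bar> ^ Suc n / fact (Suc n)"
proof -
  let ?g = "\<lambda>x::real. C * M ^ Suc n * x ^ Suc n / fact (Suc n)"
  have g: "(?g has_real_derivative C * M ^ Suc n * x ^ n / fact n) (at x)" for x
  proof -
    have "((\<lambda>x. C * M ^ Suc n / fact (Suc n) * x ^ Suc n) has_real_derivative
        C * M ^ Suc n / fact (Suc n) * (real (Suc n) * x ^ n)) (at x)"
      using DERIV_cmult[OF DERIV_pow[of "Suc n" x UNIV], of "C * M ^ Suc n / fact (Suc n)"] by simp
    moreover have "C * M ^ Suc n / fact (Suc n) * (real (Suc n) * x ^ n) = C * M ^ Suc n * x ^ n / fact n"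
      by (simp add: fact_Suc)
    ultimately show ?thesis by (simp add: mult.assoc)
  qed
  have *: "h x \<le> ?g x" if h: "\<And>x. (h has_real_derivative h' x) (at x)" "h 0 = 0"
    "\<And>x. x \<ge> 0 \<Longrightarrow> \<bar>h' x\<bar> \<le> C * M ^ Suc n * x ^ n / fact n" and x: "x \<ge> 0" for h h' x
  proof -
    have "?g 0 - h 0 \<le> ?g x - h x"
    proof (rule DERIV_nondecreasing[OF x])
      show "((\<lambda>x. ?g x - h x) has_real_derivative C * M ^ Suc n * y ^ n / fact n - h' y) (at y)" for y
        by (rule DERIV_diff[OF g h(1)])
      show "0 \<le> C * M ^ Suc n * y ^ n / fact n - h' y" if "0 \<le> y" for y
        using h(3)[OF that] by linarith
    qed
    then show ?thesis using h(2) by simp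
  qed
  have f2: "((\<lambda>x. - f x) has_real_derivative - f' x) (at x)" for x
    by (rule DERIV_minus[OF f(1)])
  have f3: "((\<lambda>x. f (- x)) has_real_derivative - f' (- x)) (at x)" for x
    using DERIV_mirror[of f "f' (-x)" "x"] f(1)[of "-x"] by simp
  have f4: "((\<lambda>x. - f (- x)) has_real_derivative f' (- x)) (at x)" for x
    using DERIV_minus[OF f3] by simp
  have b': "\<bar>f' (- x)\<bar> \<le> C * M ^ Suc n * x ^ n / fact n" if "x \<ge> 0" for x
    using b[of "- x"] that by simp
  have b'': "\<bar>f' x\<bar> \<le> C * M ^ Suc n * x ^ n / fact n" if "x \<ge> 0" for x
    using b[of "x"] that by simp
  show ?thesis
  proof (cases "x \<ge> 0")
    case True
    then show ?thesis
      using *[OF f(1) f(2) b'' True] *[OF f2 _ _ True] f(2) b'' by (simp add: abs_le_iff)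
  next
    case False
    then have x: "- x \<ge> 0" by simp
    then show ?thesis
      using *[OF f3 _ _ x] *[OF f4 _ _ x] f(2) b' by (simp add: abs_le_iff)
  qed
qed

text \<open>
  The increments between consecutive Picard iterates; the solution with initial values \<open>a\<close>, \<open>b\<close> at
  \<open>0\<close> is their sum.
\<close>

fun picard_u :: "(real \<Rightarrow> real) \<Rightarrow> real \<Rightarrow> real \<Rightarrow> real \<Rightarrow> nat \<Rightarrow> real \<Rightarrow> real"
and picard_w :: "(real \<Rightarrow> real) \<Rightarrow> real \<Rightarrow> real \<Rightarrow> real \<Rightarrow> nat \<Rightarrow> real \<Rightarrow> real" where
  "picard_u m E a b 0 = (\<lambda>_. a)"
| "picard_u m E a b (Suc n) =
     primitive (\<lambda>y. - m y * picard_u m E a b n y - E * picard_w m E a b n y)"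
| "picard_w m E a b 0 = (\<lambda>_. b)"
| "picard_w m E a b (Suc n) =
     primitive (\<lambda>y. m y * picard_w m E a b n y + E * picard_u m E a b n y)"

lemma primitive_has_real_derivative:
  "continuous_on UNIV g \<Longrightarrow> (primitive g has_real_derivative g x) (at x)"
  by (simp add: has_real_derivative_iff_has_vector_derivative primitive_has_vector_derivative)

lemma primitive_0 [simp]: "primitive g 0 = 0"
  by (simp add: primitive_def)

lemma picard_continuous:
  assumes "continuous_on UNIV m"
  shows "continuous_on UNIV (picard_u m E a b n) \<and> continuous_on UNIV (picard_w m E a b n)"
proof (induction n)
  case (Suc n)
  then show ?case
    by (auto intro!: primitive_continuous integrable_continuous_real continuous_intros
        intro: continuous_on_subset[OF assms] continuous_on_subset)
qed auto

lemma picard_derivative: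
  assumes "continuous_on UNIV m"
  shows "(picard_u m E a b (Suc n) has_real_derivative
      - m x * picard_u m E a b n x - E * picard_w m E a b n x) (at x)"
    "(picard_w m E a b (Suc n) has_real_derivative
      m x * picard_w m E a b n x + E * picard_u m E a b n x) (at x)"
  unfolding picard_u.simps picard_w.simps
  using picard_continuous[OF assms, of E a b n]
  by (auto intro!: primitive_has_real_derivative continuous_intros assms)

lemma picard_bound:
  assumes "continuous_on UNIV m" and m: "\<And>x. \<bar>m x\<bar> \<le> B"
  shows "\<bar>picard_u m E a b n x\<bar> \<le> (\<bar>a\<bar> + \<bar>b\<bar>) * (B + \<bar>E\<bar>) ^ n * \<bar>x\<bar> ^ n / fact n \<and>
    \<bar>picard_w m E a b n x\<bar> \<le> (\<bar>a\<bar> + \<bar>b\<bar>) * (B + \<bar>E\<bar>) ^ n * \<bar>x\<bar> ^ n / fact n"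
proof (induction n arbitrary: x)
  case (Suc n)
  let ?U = "picard_u m E a b n" and ?W = "picard_w m E a b n"
  let ?R = "\<lambda>x. (\<bar>a\<bar> + \<bar>b\<bar>) * (B + \<bar>E\<bar>) ^ n * \<bar>x\<bar> ^ n / fact n"
  have st: "\<bar>m x\<bar> * \<bar>p\<bar> + \<bar>E\<bar> * \<bar>q\<bar> \<le> (\<bar>a\<bar> + \<bar>b\<bar>) * (B + \<bar>E\<bar>) ^ Suc n * \<bar>x\<bar> ^ n / fact n"
    if "\<bar>p\<bar> \<le> ?R x" "\<bar>q\<bar> \<le> ?R x" for p q x
  proof -
    have "\<bar>m x\<bar> * \<bar>p\<bar> + \<bar>E\<bar> * \<bar>q\<bar> \<le> B * ?R x + \<bar>E\<bar> * ?R x"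
      using that m[of x] order_trans[OF abs_ge_zero m[of x]] by (intro add_mono mult_mono) auto
    then show ?thesis by (simp add: algebra_simps add_divide_distrib)
  qed
  have u: "\<bar>- m x * ?U x - E * ?W x\<bar> \<le> (\<bar>a\<bar> + \<bar>b\<bar>) * (B + \<bar>E\<bar>) ^ Suc n * \<bar>x\<bar> ^ n / fact n" for x
    using st[of "?U x" x "?W x"] Suc[of x] abs_triangle_ineq4[of "- m x * ?U x" "E * ?W x"]
    by (simp add: abs_mult)
  have w: "\<bar>m x * ?W x + E * ?U x\<bar> \<le> (\<bar>a\<bar> + \<bar>b\<bar>) * (B + \<bar>E\<bar>) ^ Suc n * \<bar>x\<bar> ^ n / fact n" for x
    using st[of "?W x" x "?U x"] Suc[of x] abs_triangle_ineq[of "m x * ?W x" "E * ?U x"]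
    by (simp add: abs_mult)
  show ?case
    using abs_primitive_monomial_bound[OF picard_derivative(1)[OF assms(1)] _ u]
      abs_primitive_monomial_bound[OF picard_derivative(2)[OF assms(1)] _ w] by simp
qed simp

text \<open>
  The increments are dominated by \<open>C (M \<bar>x\<bar>)\<^sup>n / n!\<close>, so their series may be differentiated term by
  term on bounded intervals; differentiating shifts the index by one and reproduces the system.
\<close>

lemma dirac_ode_exists_0:
  assumes m: "continuous_on UNIV m" and B: "\<And>x. \<bar>m x\<bar> \<le> B"
  shows "\<exists>u w. dirac_ode m E UNIV u w \<and> u 0 = a \<and> w 0 = b"
proof -
  let ?U = "picard_u m E a b" and ?W = "picard_w m E a b"
  define C where "C = \<bar>a\<bar> + \<bar>b\<bar>"
  define M where "M = B + \<bar>E\<bar>"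
  have M: "M \<ge> 0" using B[of 0] by (simp add: M_def)
  have bd: "\<bar>?U n x\<bar> \<le> C * (M ^ n * \<bar>x\<bar> ^ n / fact n)" "\<bar>?W n x\<bar> \<le> C * (M ^ n * \<bar>x\<bar> ^ n / fact n)" for n x
    using picard_bound[OF m B, of E a b n x] by (simp_all add: C_def M_def mult.assoc)
  have sm: "summable (\<lambda>n. D * ((M * R) ^ n / fact n))" for D R
    using summable_exp[of "M * R"] by (intro summable_mult) (simp add: divide_inverse mult.commute)
  have sU: "summable (\<lambda>n. ?U n x)" and sW: "summable (\<lambda>n. ?W n x)" for x
    using bd by (auto intro!: summable_comparison_test'[OF sm[of C "\<bar>x\<bar>"]] simp: power_mult_distrib)
  define DU where "DU = (\<lambda>n x. case n of 0 \<Rightarrow> 0 | Suc j \<Rightarrow> - m x * ?U j x - E * ?W j x)"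
  define DW where "DW = (\<lambda>n x. case n of 0 \<Rightarrow> 0 | Suc j \<Rightarrow> m x * ?W j x + E * ?U j x)"
  have dU: "(?U n has_real_derivative DU n x) (at x)"
      and dW: "(?W n has_real_derivative DW n x) (at x)" for n x
    unfolding DU_def DW_def using picard_derivative[OF m] by (cases n; force)+
  have uc: "uniformly_convergent_on {-R..R} (\<lambda>n x. \<Sum>i<n. D i x)"
    if D: "\<And>x. D 0 x = 0" "\<And>n x. \<bar>D (Suc n) x\<bar> \<le> M * C * (M ^ n * \<bar>x\<bar> ^ n / fact n)"
    for D :: "nat \<Rightarrow> real \<Rightarrow> real" and R
  proof (rule Weierstrass_m_test')
    let ?b = "\<lambda>n. case n of 0 \<Rightarrow> 0 | Suc j \<Rightarrow> M * C * ((M * \<bar>R\<bar>) ^ j / fact j)"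
    show "norm (D n x) \<le> ?b n" if "x \<in> {-R..R}" for n x
    proof (cases n)
      case (Suc j)
      have "M * C * (M ^ j * \<bar>x\<bar> ^ j / fact j) \<le> M * C * (M ^ j * \<bar>R\<bar> ^ j / fact j)"
        using that M by (intro mult_left_mono divide_right_mono power_mono) (auto simp: C_def)
      then show ?thesis using D(2)[of j x] by (simp add: Suc power_mult_distrib)
    qed (simp add: D)
    show "summable ?b"
      using sm[of "M * C" "\<bar>R\<bar>"] by (subst summable_Suc_iff[symmetric]) simp
  qed
  have bU: "\<bar>DU (Suc n) x\<bar> \<le> M * C * (M ^ n * \<bar>x\<bar> ^ n / fact n)"
    and bW: "\<bar>DW (Suc n) x\<bar> \<le> M * C * (M ^ n * \<bar>x\<bar> ^ n / fact n)" for n x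
  proof -
    let ?r = "C * (M ^ n * \<bar>x\<bar> ^ n / fact n)"
    have r: "\<bar>m x\<bar> * \<bar>p\<bar> + \<bar>E\<bar> * \<bar>q\<bar> \<le> M * ?r" if "\<bar>p\<bar> \<le> ?r" "\<bar>q\<bar> \<le> ?r" for p q
    proof -
      have "\<bar>m x\<bar> * \<bar>p\<bar> + \<bar>E\<bar> * \<bar>q\<bar> \<le> B * ?r + \<bar>E\<bar> * ?r"
        using that B[of x] by (intro add_mono mult_mono) auto
      also have "\<dots> = M * ?r" by (simp only: M_def distrib_right)
      finally show ?thesis .
    qed
    show "\<bar>DU (Suc n) x\<bar> \<le> M * C * (M ^ n * \<bar>x\<bar> ^ n / fact n)"
      using r[OF bd(1)[of n x] bd(2)[of n x]] abs_triangle_ineq4[of "- m x * ?U n x" "E * ?W n x"]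
      unfolding DU_def by (simp add: abs_mult mult.assoc)
    show "\<bar>DW (Suc n) x\<bar> \<le> M * C * (M ^ n * \<bar>x\<bar> ^ n / fact n)"
      using r[OF bd(2)[of n x] bd(1)[of n x]] abs_triangle_ineq[of "m x * ?W n x" "E * ?U n x"]
      unfolding DW_def by (simp add: abs_mult mult.assoc)
  qed
  have z: "DU 0 x = 0" "DW 0 x = 0" for x by (simp_all add: DU_def DW_def)
  define u where "u = (\<lambda>x. \<Sum>n. ?U n x)"
  define w where "w = (\<lambda>x. \<Sum>n. ?W n x)"
  have "(u has_real_derivative - m x * u x - E * w x) (at x) \<and>
        (w has_real_derivative m x * w x + E * u x) (at x)" for x
  proof -
    define R where "R = \<bar>x\<bar> + 1"
    have x: "x \<in> interior {-R..R}" "0 \<in> {-R..R}" by (auto simp: R_def)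
    have conv: "convex {-R..R}" by simp
    have du: "(u has_real_derivative (\<Sum>n. DU n x)) (at x)" unfolding u_def
      by (rule has_field_derivative_series'(2)[OF conv has_field_derivative_at_within[OF dU] uc[OF z(1) bU]
          x(2) sU x(1)])
    have dw: "(w has_real_derivative (\<Sum>n. DW n x)) (at x)" unfolding w_def
      by (rule has_field_derivative_series'(2)[OF conv has_field_derivative_at_within[OF dW] uc[OF z(2) bW]
          x(2) sW x(1)])
    have "(\<lambda>n. - m x * ?U n x - E * ?W n x) sums (- m x * u x - E * w x)" unfolding u_def w_def
      by (intro sums_diff sums_mult summable_sums sU sW)
    then have "(\<lambda>n. DU (Suc n) x) sums (- m x * u x - E * w x)" by (simp add: DU_def)
    then have "(\<Sum>n. DU n x) = - m x * u x - E * w x" 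
      using z(1) by (subst (asm) sums_Suc_iff) (auto simp: sums_iff)
    moreover have "(\<lambda>n. m x * ?W n x + E * ?U n x) sums (m x * w x + E * u x)" unfolding u_def w_def
      by (intro sums_add sums_mult summable_sums sU sW)
    then have "(\<lambda>n. DW (Suc n) x) sums (m x * w x + E * u x)" by (simp add: DW_def)
    then have "(\<Sum>n. DW n x) = m x * w x + E * u x"
      using z(2) by (subst (asm) sums_Suc_iff) (auto simp: sums_iff)
    ultimately show ?thesis using du dw by simp
  qed
  then have "dirac_ode m E UNIV u w" by (simp add: dirac_ode_def)
  moreover have "?U n 0 = (if n = 0 then a else 0)" "?W n 0 = (if n = 0 then b else 0)" for n
    by (cases n; simp)+
  then have "u 0 = a" "w 0 = b" unfolding u_def w_def
    using sums_single[of 0 "\<lambda>_. a"] sums_single[of 0 "\<lambda>_. b"] by (simp_all add: sums_iff)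
  ultimately show ?thesis by blast
qed

lemma dirac_ode_shift:
  assumes "dirac_ode m E S u w"
  shows "dirac_ode (\<lambda>x. m (x - d)) E ((\<lambda>x. x + d) ` S) (\<lambda>x. u (x - d)) (\<lambda>x. w (x - d))"
  unfolding dirac_ode_def
proof (intro ballI conjI)
  fix x assume "x \<in> (\<lambda>x. x + d) ` S"
  then have x: "x - d \<in> S" by auto
  show "((\<lambda>x. u (x - d)) has_real_derivative - m (x - d) * u (x - d) - E * w (x - d)) (at x)"
    "((\<lambda>x. w (x - d)) has_real_derivative m (x - d) * w (x - d) + E * u (x - d)) (at x)"
    using dirac_odeD[OF assms x] DERIV_shift[of _ _ x "- d"] by simp_all
qed

lemma dirac_ode_exists:
  assumes m: "continuous_on UNIV m" and B: "\<And>x. \<bar>m x\<bar> \<le> B"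
  shows "\<exists>u w. dirac_ode m E UNIV u w \<and> u x0 = a \<and> w x0 = b"
proof -
  have "continuous_on UNIV (\<lambda>x. m (x + x0))"
    by (intro continuous_on_compose2[OF m] continuous_intros) auto
  then obtain u w where uw: "dirac_ode (\<lambda>x. m (x + x0)) E UNIV u w" "u 0 = a" "w 0 = b"
    using dirac_ode_exists_0[of "\<lambda>x. m (x + x0)" B E a b] B by blast
  have "range (\<lambda>x. x + x0) = UNIV" by (rule surjI[of _ "\<lambda>x. x - x0"]) simp
  then have "dirac_ode m E UNIV (\<lambda>x. u (x - x0)) (\<lambda>x. w (x - x0))"
    using dirac_ode_shift[OF uw(1), of x0] by simp
  then show ?thesis using uw(2,3) by (intro exI[of _ "\<lambda>x. u (x - x0)"] exI[of _ "\<lambda>x. w (x - x0)"]) simp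
qed

text \<open>
  For an even mass, reflection together with the exchange of the components preserves both the
  system and the energy.
\<close>

lemma dirac_ode_reflect:
  assumes "dirac_ode m E S u w" "\<And>x. m (- x) = m x"
  shows "dirac_ode m E (uminus ` S) (\<lambda>x. w (- x)) (\<lambda>x. u (- x))"
  unfolding dirac_ode_def
proof (intro ballI conjI)
  fix x assume "x \<in> uminus ` S"
  then have x: "- x \<in> S" by auto
  note d = dirac_odeD[OF assms(1) x, unfolded assms(2)]
  have "((\<lambda>x. w (- x)) has_real_derivative - (m x * w (- x) + E * u (- x))) (at x)"
    by (rule DERIV_mirror[THEN iffD1, OF d(2)])
  then show "((\<lambda>x. w (- x)) has_real_derivative - m x * w (- x) - E * u (- x)) (at x)"
    by (rule DERIV_cong) simp
  have "((\<lambda>x. u (- x)) has_real_derivative - (- m x * u (- x) - E * w (- x))) (at x)"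
    by (rule DERIV_mirror[THEN iffD1, OF d(1)])
  then show "((\<lambda>x. u (- x)) has_real_derivative m x * u (- x) + E * w (- x)) (at x)"
    by (rule DERIV_cong) simp
qed

text \<open>
  The Gronwall inequality for \<open>u\<^sup>2 + w\<^sup>2\<close>: the terms with \<open>E\<close> cancel in its derivative, which is
  therefore at most \<open>2 B (u\<^sup>2 + w\<^sup>2)\<close> in absolute value.
\<close>

lemma dirac_ode_energy_bound:
  assumes S: "is_interval S" and ode: "dirac_ode m E S u w" and B: "\<And>x. x \<in> S \<Longrightarrow> \<bar>m x\<bar> \<le> B"
    and x: "x \<in> S" "y \<in> S"
  shows "(u y)\<^sup>2 + (w y)\<^sup>2 \<le> ((u x)\<^sup>2 + (w x)\<^sup>2) * exp (2 * B * \<bar>y - x\<bar>)"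
proof -
  define N where "N = (\<lambda>x. (u x)\<^sup>2 + (w x)\<^sup>2)"
  have dN: "(N has_real_derivative 2 * m z * ((w z)\<^sup>2 - (u z)\<^sup>2)) (at z)" if "z \<in> S" for z
    unfolding N_def using dirac_odeD[OF ode that]
    by (auto intro!: derivative_eq_intros simp: power2_eq_square algebra_simps)
  have bN: "\<bar>2 * m z * ((w z)\<^sup>2 - (u z)\<^sup>2)\<bar> \<le> 2 * B * N z" if "z \<in> S" for z
  proof -
    have "\<bar>(w z)\<^sup>2 - (u z)\<^sup>2\<bar> \<le> N z" by (simp add: N_def abs_le_iff)
    then have "\<bar>m z\<bar> * \<bar>(w z)\<^sup>2 - (u z)\<^sup>2\<bar> \<le> B * N z"
      using B[OF that] by (intro mult_mono) auto
    then show ?thesis by (simp add: abs_mult)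
  qed
  have int: "z \<in> S" if "a \<in> S" "b \<in> S" "a \<le> z" "z \<le> b" for a b z
    using S that by (meson is_interval_1)
  show ?thesis
  proof (cases "x \<le> y")
    case True
    have "- N x * exp (- 2 * B * x) \<le> - N y * exp (- 2 * B * y)"
    proof (rule DERIV_nondecreasing[OF True])
      fix z assume "x \<le> z" "z \<le> y"
      then have z: "z \<in> S" using int x by blast
      show "((\<lambda>z. - N z * exp (- 2 * B * z)) has_real_derivative
          (2 * B * N z - 2 * m z * ((w z)\<^sup>2 - (u z)\<^sup>2)) * exp (- 2 * B * z)) (at z)"
        by (auto intro!: derivative_eq_intros dN[OF z] simp: algebra_simps)
      show "0 \<le> (2 * B * N z - 2 * m z * ((w z)\<^sup>2 - (u z)\<^sup>2)) * exp (- 2 * B * z)"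
        using bN[OF z] by (intro mult_nonneg_nonneg) (auto simp: abs_le_iff)
    qed
    then have "N y * exp (- 2 * B * y) * exp (2 * B * y) \<le> N x * exp (- 2 * B * x) * exp (2 * B * y)"
      by (intro mult_right_mono) auto
    then show ?thesis using True by (simp add: N_def mult.assoc exp_add[symmetric] algebra_simps)
  next
    case False
    then have yx: "y \<le> x" by simp
    have "N y * exp (2 * B * y) \<le> N x * exp (2 * B * x)"
    proof (rule DERIV_nondecreasing[OF yx])
      fix z assume "y \<le> z" "z \<le> x"
      then have z: "z \<in> S" using int x by blast
      show "((\<lambda>z. N z * exp (2 * B * z)) has_real_derivative
          (2 * B * N z + 2 * m z * ((w z)\<^sup>2 - (u z)\<^sup>2)) * exp (2 * B * z)) (at z)"
        by (auto intro!: derivative_eq_intros dN[OF z] simp: algebra_simps)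
      show "0 \<le> (2 * B * N z + 2 * m z * ((w z)\<^sup>2 - (u z)\<^sup>2)) * exp (2 * B * z)"
        using bN[OF z] by (intro mult_nonneg_nonneg) (auto simp: abs_le_iff)
    qed
    then have "N y * exp (2 * B * y) * exp (- 2 * B * y) \<le> N x * exp (2 * B * x) * exp (- 2 * B * y)"
      by (intro mult_right_mono) auto
    then show ?thesis using yx by (simp add: N_def mult.assoc exp_add[symmetric] algebra_simps)
  qed
qed

lemma dirac_ode_unique:
  assumes S: "is_interval S" and "dirac_ode m E S u w" "dirac_ode m E S u' w'"
    and B: "\<And>x. x \<in> S \<Longrightarrow> \<bar>m x\<bar> \<le> B" and x: "x \<in> S" "y \<in> S" and eq: "u x = u' x" "w x = w' x"
  shows "u y = u' y \<and> w y = w' y"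
proof -
  have "(1 * u y + (-1) * u' y)\<^sup>2 + (1 * w y + (-1) * w' y)\<^sup>2
      \<le> ((1 * u x + (-1) * u' x)\<^sup>2 + (1 * w x + (-1) * w' x)\<^sup>2) * exp (2 * B * \<bar>y - x\<bar>)"
    by (rule dirac_ode_energy_bound[OF S dirac_ode_linear[OF assms(2,3)] B x])
  then have "(u y - u' y)\<^sup>2 + (w y - w' y)\<^sup>2 \<le> 0" using eq by simp
  then show ?thesis by (simp add: sum_power2_le_zero_iff)
qed

text \<open>
  The Gronwall inequality for the difference of two solutions, integrated backwards from \<open>b\<close>. It
  gives Lipschitz dependence on the energy and on the data at \<open>b\<close> at the same time.
\<close>

lemma dirac_ode_parameter_bound:
  assumes ab: "a \<le> b" and ode: "dirac_ode m E {a..b} u w" "dirac_ode m E' {a..b} u' w'"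
    and B: "\<And>x. x \<in> {a..b} \<Longrightarrow> \<bar>m x\<bar> \<le> B" "B \<ge> 0"
    and U: "\<And>x. x \<in> {a..b} \<Longrightarrow> (u' x)\<^sup>2 + (w' x)\<^sup>2 \<le> U"
    and y: "y \<in> {a..b}"
  shows "(u y - u' y)\<^sup>2 + (w y - w' y)\<^sup>2
    \<le> ((u b - u' b)\<^sup>2 + (w b - w' b)\<^sup>2 + (E - E')\<^sup>2 * U) * exp ((2 * B + 1) * (b - a))"
proof -
  define N where "N = (\<lambda>x. (u x - u' x)\<^sup>2 + (w x - w' x)\<^sup>2)"
  define N' where "N' = (\<lambda>x. 2 * m x * ((w x - w' x)\<^sup>2 - (u x - u' x)\<^sup>2)
      + 2 * (E - E') * ((w x - w' x) * u' x - (u x - u' x) * w' x))"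
  define c where "c = 2 * B + 1"
  define r where "r = (E - E')\<^sup>2 * U"
  have c: "c \<ge> 1" using B(2) by (simp add: c_def)
  have r: "r \<ge> 0"
    using U[OF y] unfolding r_def by (intro mult_nonneg_nonneg) (auto intro: order_trans[rotated])
  have dN: "(N has_real_derivative N' x) (at x)" if "x \<in> {a..b}" for x
    unfolding N_def N'_def using dirac_odeD[OF ode(1) that] dirac_odeD[OF ode(2) that]
    by (auto intro!: derivative_eq_intros simp: power2_eq_square algebra_simps)
  have bN: "N' x + c * N x + r \<ge> 0" if x: "x \<in> {a..b}" for x
  proof -
    have "\<bar>(w x - w' x)\<^sup>2 - (u x - u' x)\<^sup>2\<bar> \<le> N x" by (simp add: N_def abs_le_iff)
    then have "\<bar>m x\<bar> * \<bar>(w x - w' x)\<^sup>2 - (u x - u' x)\<^sup>2\<bar> \<le> B * N x"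
      using B(1)[OF x] by (intro mult_mono) auto
    then have 1: "- (2 * B * N x) \<le> 2 * m x * ((w x - w' x)\<^sup>2 - (u x - u' x)\<^sup>2)"
      by (simp add: abs_mult[symmetric] abs_le_iff)
    (* Completing the squares absorbs the inhomogeneous terms at the cost of the summand 1 in c = 2 B + 1. *)
    have "0 \<le> ((w x - w' x) + (E - E') * u' x)\<^sup>2 + ((u x - u' x) - (E - E') * w' x)\<^sup>2" by simp
    also have "\<dots> = N x + 2 * (E - E') * ((w x - w' x) * u' x - (u x - u' x) * w' x)
        + (E - E')\<^sup>2 * ((u' x)\<^sup>2 + (w' x)\<^sup>2)"
      by (simp add: N_def power2_eq_square algebra_simps)
    also have "(E - E')\<^sup>2 * ((u' x)\<^sup>2 + (w' x)\<^sup>2) \<le> r"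
      unfolding r_def using U[OF x] by (intro mult_left_mono) auto
    finally show ?thesis using 1 by (simp add: N'_def c_def algebra_simps)
  qed
  (* The shift by r / c turns N' + c N + r >= 0 into the monotonicity of one function. *)
  have "(N y + r / c) * exp (c * y) \<le> (N b + r / c) * exp (c * b)"
  proof (rule DERIV_nondecreasing[of y b])
    fix x assume "y \<le> x" "x \<le> b"
    then have x: "x \<in> {a..b}" using y by auto
    have "c * (r / c) = r" "c \<noteq> 0" using c by auto
    then show "((\<lambda>x. (N x + r / c) * exp (c * x)) has_real_derivative (N' x + c * N x + r) * exp (c * x)) (at
        x)"
      by (auto intro!: derivative_eq_intros dN[OF x] simp: distrib_left distrib_right)
    show "0 \<le> (N' x + c * N x + r) * exp (c * x)" using bN[OF x] by simp
  qed (use y in auto)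
  then have "(N y + r / c) * exp (c * y) * exp (- c * y) \<le> (N b + r / c) * exp (c * b) * exp (- c * y)"
    by (intro mult_right_mono) auto
  then have "N y + r / c \<le> (N b + r / c) * exp (c * (b - y))"
    by (simp add: mult.assoc exp_add[symmetric] algebra_simps)
  also have "\<dots> \<le> (N b + r / c) * exp (c * (b - a))"
    using y c r by (intro mult_left_mono) (auto simp: N_def)
  also have "\<dots> \<le> (N b + r) * exp (c * (b - a))"
    using c r by (intro mult_right_mono add_left_mono) (auto simp: divide_le_eq mult_le_cancel_left1)
  finally have "N y \<le> (N b + r) * exp (c * (b - a))"
    using c r by (smt (verit) divide_nonneg_nonneg)
  then show ?thesis by (simp add: N_def r_def c_def)
qed

text \<open>
  For equal energies the Wronskian is constant; for different ones this derivative is the reason why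
  the energies with one matching sign are unique.
\<close>

lemma dirac_ode_wronskian:
  assumes "dirac_ode m E S u w" "dirac_ode m E' S u' w'" "x \<in> S"
  shows "((\<lambda>x. u x * w' x - w x * u' x) has_real_derivative (E' - E) * (u x * u' x + w x * w' x)) (at x)"
  using dirac_odeD[OF assms(1,3)] dirac_odeD[OF assms(2,3)]
  by (auto intro!: derivative_eq_intros simp: algebra_simps)

section \<open>Energies in the gap and decaying solutions at one wall\<close>

text \<open>
  Where the mass is the constant \<open>k\<close>, the coefficient matrix of the system has the eigenvalues \<open>- s\<close>
  and \<open>s\<close>, with eigenvectors \<open>(1, - t)\<close> and \<open>(- t, 1)\<close>, for \<open>s\<close> the decay rate and \<open>t\<close> the tail
  slope. Where the mass is \<open>- k\<close> the eigenvectors are \<open>(1, t)\<close> for \<open>s\<close> and \<open>(t, 1)\<close> for \<open>- s\<close>.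
\<close>

definition decay_rate :: "real \<Rightarrow> real \<Rightarrow> real" where
  "decay_rate k E = sqrt (k\<^sup>2 - E\<^sup>2)"

definition tail_slope :: "real \<Rightarrow> real \<Rightarrow> real" where
  "tail_slope k E = E / (k + decay_rate k E)"

text \<open>
  All of this follows from \<open>s\<^sup>2 = k\<^sup>2 - E\<^sup>2\<close>, that is \<open>(k - s) (k + s) = E\<^sup>2\<close>.
\<close>

lemma gap_facts:
  assumes "k > 0" "\<bar>E\<bar> < k"
  defines "s \<equiv> decay_rate k E" and "t \<equiv> tail_slope k E"
  shows "0 < s" "s \<le> k" "s\<^sup>2 = k\<^sup>2 - E\<^sup>2" "t * (k + s) = E" "E * t = k - s" "k * t - E = - (s * t)"
    "\<bar>t\<bar> < 1" "t\<^sup>2 < 1" "\<bar>t\<bar> \<le> \<bar>E\<bar> / k" "\<bar>E\<bar> \<le> 2 * k * \<bar>t\<bar>" "k - s \<le> E\<^sup>2 / k" "sgn t = sgn E"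
proof -
  have E2: "E\<^sup>2 < k\<^sup>2" using assms(1,2) by (metis abs_ge_zero power2_abs power_strict_mono zero_less_numeral)
  show s0: "0 < s" using E2 by (simp add: s_def decay_rate_def)
  show s2: "s\<^sup>2 = k\<^sup>2 - E\<^sup>2" using E2 by (simp add: s_def decay_rate_def)
  show sk: "s \<le> k" using assms(1) by (auto simp: s_def decay_rate_def intro!: real_le_lsqrt)
  have ks: "k + s > 0" using s0 assms(1) by simp
  show t1: "t * (k + s) = E" using ks by (simp add: t_def tail_slope_def s_def)
  have "E * t * (k + s) = (k - s) * (k + s)"
    using t1 s2 by (simp add: power2_eq_square algebra_simps)
  then show Et: "E * t = k - s" using ks by simp
  show "k * t - E = - (s * t)" using t1 by (simp add: algebra_simps)
  have at: "\<bar>t\<bar> * (k + s) = \<bar>E\<bar>" using t1 ks by (metis abs_mult abs_of_pos)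
  have "\<bar>t\<bar> * k \<le> \<bar>E\<bar>" using at s0 by (simp add: algebra_simps flip: at)
  then show tE: "\<bar>t\<bar> \<le> \<bar>E\<bar> / k" using assms(1) by (simp add: pos_le_divide_eq)
  then show "\<bar>t\<bar> < 1" using assms(1,2) by (meson divide_less_eq_1_pos order_le_less_trans)
  then show "t\<^sup>2 < 1" by (simp add: abs_square_less_1)
  have "\<bar>E\<bar> \<le> \<bar>t\<bar> * (2 * k)"
    unfolding at[symmetric] using sk by (intro mult_left_mono) auto
  then show "\<bar>E\<bar> \<le> 2 * k * \<bar>t\<bar>" by (simp only: mult.commute)
  have "E * t \<le> \<bar>E\<bar> * \<bar>t\<bar>" unfolding abs_mult[symmetric] by (rule abs_ge_self)
  also have "\<dots> \<le> \<bar>E\<bar> * (\<bar>E\<bar> / k)" by (rule mult_left_mono[OF tE]) simp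
  also have "\<dots> = E\<^sup>2 / k" by (simp add: power2_eq_square)
  finally show "k - s \<le> E\<^sup>2 / k" unfolding Et .
  show "sgn t = sgn E" using ks by (simp add: t_def tail_slope_def s_def[symmetric] sgn_divide)
qed

text \<open>
  Up to a factor, \<open>w + t u\<close> is the coordinate along the growing eigenvector.
\<close>

lemma dirac_ode_growing_tail:
  assumes k: "k > 0" "\<bar>E\<bar> < k" and m: "\<And>x. x \<ge> a \<Longrightarrow> m x = k"
    and ode: "dirac_ode m E {a..} u w" and x: "x \<ge> a"
  shows "w x + tail_slope k E * u x = (w a + tail_slope k E * u a) * exp (decay_rate k E * (x - a))"
proof -
  let ?s = "decay_rate k E" and ?t = "tail_slope k E"
  note g = gap_facts[OF k]
  have d: "((\<lambda>y. (w y + ?t * u y) * exp (- ?s * (y - a))) has_real_derivative 0) (at y)" if "y \<ge> a" for y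
  proof -
    note d = dirac_odeD[OF ode, of y, unfolded m[OF that]]
    have "((\<lambda>y. w y + ?t * u y) has_real_derivative (k * w y + E * u y) + ?t * (- k * u y - E * w y)) (at y)"
      using d that by (intro DERIV_add DERIV_cmult) auto
    moreover have "(k * w y + E * u y) + ?t * (- k * u y - E * w y)
        = (k - E * ?t) * w y - (k * ?t - E) * u y" by (simp add: algebra_simps)
    moreover have "\<dots> = ?s * (w y + ?t * u y)" unfolding g(5,6) by (simp add: algebra_simps)
    ultimately have "((\<lambda>y. w y + ?t * u y) has_real_derivative ?s * (w y + ?t * u y)) (at y)" by simp
    moreover have "((\<lambda>y. exp (- ?s * (y - a))) has_real_derivative - ?s * exp (- ?s * (y - a))) (at y)"
      by (auto intro!: derivative_eq_intros)
    ultimately show ?thesis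
      by (rule DERIV_cong[OF DERIV_mult]) (simp add: algebra_simps)
  qed
  have "(w x + ?t * u x) * exp (- ?s * (x - a)) = (w a + ?t * u a) * exp (- ?s * (a - a))"
    using DERIV_nondecreasing[OF x d] DERIV_nondecreasing[OF x DERIV_minus[OF d]] by fastforce
  then have "(w x + ?t * u x) * exp (- ?s * (x - a)) * exp (?s * (x - a))
      = (w a + ?t * u a) * exp (?s * (x - a))"
    by simp
  then show ?thesis by (simp add: mult.assoc exp_add[symmetric])
qed

text \<open>
  A nonzero growing coordinate would bound \<open>u\<^sup>2 + w\<^sup>2\<close> from below by a positive constant on a half
  line.
\<close>

lemma dirac_ode_L2_tail:
  assumes k: "k > 0" "\<bar>E\<bar> < k" and m: "\<And>x. x \<ge> a \<Longrightarrow> m x = k"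
    and ode: "dirac_ode m E {a..} u w" and L2: "integrable lborel (\<lambda>x. (u x)\<^sup>2 + (w x)\<^sup>2)"
  shows "w a = - tail_slope k E * u a"
proof (rule ccontr)
  let ?s = "decay_rate k E" and ?t = "tail_slope k E"
  note g = gap_facts[OF k]
  define q where "q = w a + ?t * u a"
  assume "w a \<noteq> - ?t * u a"
  then have q: "q \<noteq> 0" by (simp add: q_def)
  have low: "q\<^sup>2 \<le> 2 * ((u x)\<^sup>2 + (w x)\<^sup>2)" if "x \<ge> a" for x
  proof -
    have "q\<^sup>2 * 1 \<le> q\<^sup>2 * (exp (?s * (x - a)))\<^sup>2"
      using that g(1) by (intro mult_left_mono) (auto simp: one_le_power)
    also have "\<dots> = (w x + ?t * u x)\<^sup>2"
      using dirac_ode_growing_tail[OF k m ode that] by (simp add: q_def power_mult_distrib)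
    also have "\<dots> \<le> 2 * ((w x)\<^sup>2 + (?t * u x)\<^sup>2)"
      using sum_squares_bound[of "w x" "?t * u x"] by (simp add: power2_sum)
    also have "\<dots> \<le> 2 * ((w x)\<^sup>2 + 1 * (u x)\<^sup>2)"
      unfolding power_mult_distrib using g(8)
      by (intro mult_left_mono add_left_mono mult_right_mono) auto
    finally show ?thesis by simp
  qed
  define I where "I = (\<integral>x. 2 * ((u x)\<^sup>2 + (w x)\<^sup>2) \<partial>lborel)"
  have "real n * q\<^sup>2 \<le> I" for n
  proof -
    have "real n * q\<^sup>2 = (\<integral>x. indicator {a..a + real n} x * q\<^sup>2 \<partial>lborel)" by simp
    also have "\<dots> \<le> I" unfolding I_def
    proof (rule integral_mono)
      show "integrable lborel (\<lambda>x. indicator {a..a + real n} x * q\<^sup>2)"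
        by (intro integrable_mult_left) (simp add: integrable_indicator_iff emeasure_lborel_Icc_eq)
      show "integrable lborel (\<lambda>x. 2 * ((u x)\<^sup>2 + (w x)\<^sup>2))" using L2 by (rule integrable_mult_right)
      show "indicator {a..a + real n} x * q\<^sup>2 \<le> 2 * ((u x)\<^sup>2 + (w x)\<^sup>2)" for x
        using low[of x] by (auto simp: indicator_def)
    qed
    finally show ?thesis .
  qed
  moreover obtain n where "I / q\<^sup>2 < real n" using reals_Archimedean2 by blast
  ultimately show False using q
    by (metis not_less pos_divide_less_eq zero_less_power2)
qed

text \<open>
  One wall, without the spectral gap assumption; \<open>k\<close> is the limit of \<open>\<kappa>\<close> at infinity.
\<close>

locale domain_wall =
  fixes \<kappa> :: "real \<Rightarrow> real" and k :: real
  assumes wall: "one_domain_wall \<kappa> k"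
begin

lemma k_pos: "k > 0" and kappa_odd: "\<kappa> (- x) = - \<kappa> x"
  and kappa_left: "x \<le> -1 \<Longrightarrow> \<kappa> x = - k" and kappa_right: "x \<ge> 1 \<Longrightarrow> \<kappa> x = k"
  using wall by (auto simp: one_domain_wall_def)

lemma kappa_continuous: "continuous_on S \<kappa>"
  using wall C1_differentiable_imp_continuous_on continuous_on_subset
  unfolding one_domain_wall_def by blast

definition kmax :: real where "kmax = (SOME B. \<forall>x. \<bar>\<kappa> x\<bar> \<le> B)"

lemma kappa_bound: "\<bar>\<kappa> x\<bar> \<le> kmax"
proof -
  have "bounded (\<kappa> ` {-1..1})"
    by (intro compact_imp_bounded compact_continuous_image kappa_continuous) auto
  then obtain B where B: "\<And>y. y \<in> {-1..1} \<Longrightarrow> \<bar>\<kappa> y\<bar> \<le> B"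
    unfolding bounded_iff by (metis imageI real_norm_def)
  have "\<bar>\<kappa> x\<bar> \<le> max B k" for x
    using B[of x] kappa_left[of x] kappa_right[of x] k_pos by (cases "x \<in> {-1..1}") auto
  then have "\<exists>B. \<forall>x. \<bar>\<kappa> x\<bar> \<le> B" by blast
  from someI_ex[OF this] show ?thesis unfolding kmax_def by blast
qed

abbreviation W :: "real \<Rightarrow> real" where "W \<equiv> wall_primitive \<kappa>"

lemma W_eq_primitive: "W x = primitive \<kappa> x"
proof (cases "0 \<le> x")
  case True
  have "set_integrable lborel {0..x} \<kappa>"
    by (intro borel_integrable_atLeastAtMost' kappa_continuous)
  then show ?thesis using True interval_integral_eq_integral[of 0 x]
    by (simp add: wall_primitive_def primitive_def zero_ereal_def)
next
  case False
  have "set_integrable lborel {x..0} \<kappa>"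
    by (intro borel_integrable_atLeastAtMost' kappa_continuous)
  then show ?thesis using False interval_integral_eq_integral[of x 0]
      interval_integral_endpoints_reverse[of "ereal 0" "ereal x" \<kappa>]
    by (simp add: wall_primitive_def primitive_def zero_ereal_def)
qed

lemma W_deriv: "(W has_real_derivative \<kappa> x) (at x)"
proof -
  have "W = primitive \<kappa>" using W_eq_primitive by (rule ext)
  then show ?thesis using primitive_has_real_derivative[OF kappa_continuous, of x] by simp
qed

lemma W_0: "W 0 = 0"
  by (simp add: W_eq_primitive)

lemma W_even: "W (- x) = W x"
proof -
  have "((\<lambda>x. W (- x)) has_real_derivative - \<kappa> (- x)) (at x)" for x
    using DERIV_mirror[THEN iffD1, OF W_deriv[of "- x"]] .
  then have "((\<lambda>x. W (- x) - W x) has_real_derivative 0) (at x)" for x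
    using DERIV_diff[OF _ W_deriv[of x], of "\<lambda>x. W (- x)" "\<kappa> x"] by (simp add: kappa_odd)
  then have "W (- x) - W x = W (- 0) - W 0"
    using DERIV_isconst_all by blast
  then show ?thesis by simp
qed

lemma W_right: "x \<ge> 1 \<Longrightarrow> W x = W 1 + k * (x - 1)"
proof -
  assume x: "x \<ge> 1"
  have d: "((\<lambda>y. W y - k * y) has_real_derivative 0) (at y)" if "1 \<le> y" for y
    using that by (auto intro!: derivative_eq_intros W_deriv simp: kappa_right)
  have "W x - k * x = W 1 - k * 1"
    using DERIV_nondecreasing[OF x d] DERIV_nondecreasing[OF x DERIV_minus[OF d]] by fastforce
  then show ?thesis by (simp add: algebra_simps)
qed

lemma W_abs: "\<bar>x\<bar> \<ge> 1 \<Longrightarrow> W x = W 1 + k * (\<bar>x\<bar> - 1)"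
  using W_right[of x] W_right[of "- x"] W_even[of x] by (auto simp: abs_real_def)

lemma W_continuous: "continuous_on S W"
  using W_deriv by (meson DERIV_isCont continuous_at_imp_continuous_on)

text \<open>
  Outside \<open>[-1, 1]\<close> the primitive is affine in \<open>\<bar>x\<bar>\<close> with slope \<open>k\<close>, and \<open>[-1, 1]\<close> is compact.
\<close>

lemma exp_W_bound: "\<exists>A>0. \<forall>x. exp (- W x) \<le> A * exp (- k * \<bar>x\<bar>)"
proof -
  have "bounded ((\<lambda>x. exp (- W x)) ` {-1..1})"
    by (intro compact_imp_bounded compact_continuous_image continuous_intros W_continuous) auto
  then obtain B where B: "\<And>y. y \<in> {-1..1} \<Longrightarrow> exp (- W y) \<le> B"
    unfolding bounded_iff by (metis abs_exp_cancel imageI real_norm_def)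
  have B0: "B > 0" using B[of 0] W_0 by simp
  define A where "A = (B + exp (- W 1)) * exp k"
  have "exp (- W x) \<le> A * exp (- k * \<bar>x\<bar>)" for x
  proof (cases "\<bar>x\<bar> \<ge> 1")
    case True
    have "exp (- W x) = exp (- W 1) * exp k * exp (- k * \<bar>x\<bar>)"
      by (simp add: W_abs[OF True] exp_add[symmetric] algebra_simps)
    also have "\<dots> \<le> A * exp (- k * \<bar>x\<bar>)"
      unfolding A_def using B0 by (intro mult_right_mono) auto
    finally show ?thesis .
  next
    case False
    then have "exp (- W x) \<le> B" by (intro B) auto
    also have "\<dots> \<le> B * (exp k * exp (- k * \<bar>x\<bar>))"
      using B0 False k_pos by (simp add: mult_le_cancel_left1 exp_add[symmetric])
    also have "\<dots> \<le> A * exp (- k * \<bar>x\<bar>)"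
      unfolding A_def using B0 by (simp add: algebra_simps)
    finally show ?thesis .
  qed
  moreover have "A > 0" using B0 by (simp add: A_def add_pos_pos)
  ultimately show ?thesis by blast
qed

text \<open>
  The solution at one wall that decays at \<open>+\<infinity>\<close>: its data at \<open>1\<close>, where the constant region begins,
  lie on the decaying eigenvector, and are scaled so that the energy \<open>0\<close> gives \<open>exp (- W)\<close>.
\<close>

definition dec_sol :: "real \<Rightarrow> (real \<Rightarrow> real) \<times> (real \<Rightarrow> real)" where
  "dec_sol E = (SOME p. dirac_ode \<kappa> E UNIV (fst p) (snd p) \<and>
     fst p 1 = exp (- W 1) \<and> snd p 1 = - tail_slope k E * exp (- W 1))"

definition dec_u :: "real \<Rightarrow> real \<Rightarrow> real" where "dec_u E = fst (dec_sol E)"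
definition dec_w :: "real \<Rightarrow> real \<Rightarrow> real" where "dec_w E = snd (dec_sol E)"

lemma dec_sol: "dirac_ode \<kappa> E UNIV (dec_u E) (dec_w E)"
  and dec_u_1: "dec_u E 1 = exp (- W 1)" and dec_w_1: "dec_w E 1 = - tail_slope k E * exp (- W 1)"
proof -
  obtain u w where "dirac_ode \<kappa> E UNIV u w" "u 1 = exp (- W 1)" "w 1 = - tail_slope k E * exp (- W 1)"
    using dirac_ode_exists[OF kappa_continuous kappa_bound] by blast
  then have "\<exists>p. dirac_ode \<kappa> E UNIV (fst p) (snd p) \<and>
     fst p 1 = exp (- W 1) \<and> snd p 1 = - tail_slope k E * exp (- W 1)"
    by (intro exI[of _ "(u, w)"]) simp
  from someI_ex[OF this] show "dirac_ode \<kappa> E UNIV (dec_u E) (dec_w E)"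
    "dec_u E 1 = exp (- W 1)" "dec_w E 1 = - tail_slope k E * exp (- W 1)"
    by (simp_all add: dec_u_def dec_w_def dec_sol_def)
qed

lemma dec_sol_deriv:
  "(dec_u E has_real_derivative - \<kappa> y * dec_u E y - E * dec_w E y) (at y)"
  "(dec_w E has_real_derivative \<kappa> y * dec_w E y + E * dec_u E y) (at y)"
  using dirac_odeD[OF dec_sol] by auto

lemma dec_sol_tail:
  assumes E: "\<bar>E\<bar> < k" and y: "y \<ge> 1"
  shows "dec_u E y = exp (- W 1) * exp (- decay_rate k E * (y - 1))"
    and "dec_w E y = - tail_slope k E * (exp (- W 1) * exp (- decay_rate k E * (y - 1)))"
proof -
  let ?s = "decay_rate k E" and ?t = "tail_slope k E"
  note g = gap_facts[OF k_pos E]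
  let ?u = "\<lambda>y. exp (- W 1) * exp (- ?s * (y - 1))"
  have "dirac_ode \<kappa> E {1..} ?u (\<lambda>y. - ?t * ?u y)"
    unfolding dirac_ode_def
  proof (intro ballI conjI)
    fix x :: real assume "x \<in> {1..}"
    then have kx: "\<kappa> x = k" by (simp add: kappa_right)
    have d: "(?u has_real_derivative - ?s * ?u x) (at x)"
      by (auto intro!: derivative_eq_intros)
    show "(?u has_real_derivative - \<kappa> x * ?u x - E * (- ?t * ?u x)) (at x)"
    proof (rule DERIV_cong[OF d])
      have "- \<kappa> x * ?u x - E * (- ?t * ?u x) = (E * ?t - k) * ?u x" by (simp add: kx algebra_simps)
      then show "- ?s * ?u x = - \<kappa> x * ?u x - E * (- ?t * ?u x)" unfolding g(5) by simp
    qed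
    show "((\<lambda>y. - ?t * ?u y) has_real_derivative \<kappa> x * (- ?t * ?u x) + E * ?u x) (at x)"
    proof (rule DERIV_cong[OF DERIV_cmult[OF d]])
      have "\<kappa> x * (- ?t * ?u x) + E * ?u x = - (k * ?t - E) * ?u x" by (simp add: kx algebra_simps)
      then show "- ?t * (- ?s * ?u x) = \<kappa> x * (- ?t * ?u x) + E * ?u x"
        unfolding g(6) by simp
    qed
  qed
  from dirac_ode_unique[OF _ dirac_ode_mono[OF dec_sol] this kappa_bound, of 1 y] y
  show "dec_u E y = ?u y" "dec_w E y = - ?t * ?u y"
    by (auto simp: dec_u_1 dec_w_1)
qed

text \<open>
  To the left of the wall, up to the common factor \<open>1 / (1 - t\<^sup>2)\<close>, the decaying solution is
  \<open>bound_amp\<close> times the mode \<open>(1, t) exp (s (y + 1))\<close>, which decays away from the wall, plus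
  \<open>leak_amp\<close> times \<open>(t, 1) exp (- s (y + 1))\<close>, which grows. These are the \<open>P(E)\<close> and \<open>Q(E)\<close> of the
  introduction.
\<close>

definition bound_amp :: "real \<Rightarrow> real" where "bound_amp E = dec_u E (-1) - tail_slope k E * dec_w E (-1)"
definition leak_amp :: "real \<Rightarrow> real" where "leak_amp E = dec_w E (-1) - tail_slope k E * dec_u E (-1)"

lemma dec_sol_left:
  assumes E: "\<bar>E\<bar> < k" and y: "y \<le> -1"
  defines "s \<equiv> decay_rate k E" and "t \<equiv> tail_slope k E"
  shows "dec_u E y = (bound_amp E * exp (s * (y + 1)) + t * (leak_amp E * exp (- s * (y + 1)))) / (1 - t\<^sup>2)"
    and "dec_w E y = (t * (bound_amp E * exp (s * (y + 1))) + leak_amp E * exp (- s * (y + 1))) / (1 - t\<^sup>2)"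
proof -
  note g = gap_facts[OF k_pos E, folded s_def t_def]
  define p where "p = (\<lambda>y. bound_amp E / (1 - t\<^sup>2) * exp (s * (y + 1)))"
  define q where "q = (\<lambda>y. leak_amp E / (1 - t\<^sup>2) * exp (- s * (y + 1)))"
  have t2: "1 - t\<^sup>2 > 0" using g(8) by simp
  have t21: "1 - t\<^sup>2 \<noteq> 0" using t2 by auto
  have ode: "dirac_ode \<kappa> E {..-1} (\<lambda>y. p y + t * q y) (\<lambda>y. t * p y + q y)"
    unfolding dirac_ode_def
  proof (intro ballI conjI)
    fix x :: real assume "x \<in> {..-1}"
    then have kx: "\<kappa> x = - k" by (simp add: kappa_left)
    have d: "(p has_real_derivative s * p x) (at x)" "(q has_real_derivative - s * q x) (at x)"
    proof -
      have "((\<lambda>y. b * exp (a * (y + 1))) has_real_derivative a * (b * exp (a * (x + 1)))) (at x)" for a b ::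
          real
        by (auto intro!: derivative_eq_intros)
      then show "(p has_real_derivative s * p x) (at x)" "(q has_real_derivative - s * q x) (at x)"
        unfolding p_def q_def by blast+
    qed
    show "((\<lambda>y. p y + t * q y) has_real_derivative - \<kappa> x * (p x + t * q x) - E * (t * p x + q x)) (at x)"
    proof (rule DERIV_cong[OF DERIV_add[OF d(1) DERIV_cmult[OF d(2)]]])
      have "- \<kappa> x * (p x + t * q x) - E * (t * p x + q x) = (k - E * t) * p x + (k * t - E) * q x"
        by (simp add: kx algebra_simps)
      then show "s * p x + t * (- s * q x) = - \<kappa> x * (p x + t * q x) - E * (t * p x + q x)"
        unfolding g(5,6) by simp
    qed
    show "((\<lambda>y. t * p y + q y) has_real_derivative \<kappa> x * (t * p x + q x) + E * (p x + t * q x)) (at x)"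
    proof (rule DERIV_cong[OF DERIV_add[OF DERIV_cmult[OF d(1)] d(2)]])
      have "\<kappa> x * (t * p x + q x) + E * (p x + t * q x) = - (k * t - E) * p x - (k - E * t) * q x"
        by (simp add: kx algebra_simps)
      then show "t * (s * p x) + - s * q x = \<kappa> x * (t * p x + q x) + E * (p x + t * q x)"
        unfolding g(5,6) by simp
    qed
  qed
  have "dec_u E (-1) * (1 - t\<^sup>2) = bound_amp E + t * leak_amp E" "dec_w E (-1) * (1 - t\<^sup>2)
      = t * bound_amp E + leak_amp E"
    by (simp_all add: bound_amp_def leak_amp_def t_def[symmetric] algebra_simps power2_eq_square)
  then have "dec_u E (-1) = (bound_amp E + t * leak_amp E) / (1 - t\<^sup>2)" "dec_w E (-1)
      = (t * bound_amp E + leak_amp E) / (1 - t\<^sup>2)"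
    unfolding nonzero_eq_divide_eq[OF t21] .
  then have "dec_u E (-1) = p (-1) + t * q (-1)" "dec_w E (-1) = t * p (-1) + q (-1)"
    by (simp_all only: p_def q_def) (simp_all add: add_divide_distrib)
  with dirac_ode_unique[OF _ dirac_ode_mono[OF dec_sol] ode kappa_bound, of "-1" y] y
  have "dec_u E y = p y + t * q y \<and> dec_w E y = t * p y + q y" by auto
  then show "dec_u E y = (bound_amp E * exp (s * (y + 1)) + t * (leak_amp E * exp (- s * (y + 1)))) / (1 -
      t\<^sup>2)"
    and "dec_w E y = (t * (bound_amp E * exp (s * (y + 1))) + leak_amp E * exp (- s * (y + 1))) / (1 - t\<^sup>2)"
    by (simp_all add: p_def q_def add_divide_distrib)
qed

lemma dec_sol_nonzero: "(dec_u E y)\<^sup>2 + (dec_w E y)\<^sup>2 > 0"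
proof (rule ccontr)
  assume "\<not> ?thesis"
  then have "(dec_u E y)\<^sup>2 + (dec_w E y)\<^sup>2 \<le> 0" by simp
  moreover have "(dec_u E 1)\<^sup>2 + (dec_w E 1)\<^sup>2 \<le> ((dec_u E y)\<^sup>2 + (dec_w E y)\<^sup>2) * exp (2 * kmax * \<bar>1 - y\<bar>)"
    by (rule dirac_ode_energy_bound[OF _ dec_sol kappa_bound]) auto
  ultimately have "(dec_u E 1)\<^sup>2 + (dec_w E 1)\<^sup>2 \<le> 0"
    by (meson exp_ge_zero mult_nonpos_nonneg order_trans)
  then show False by (simp add: dec_u_1 sum_power2_le_zero_iff)
qed

lemma dec_sol_zero: "dec_u 0 y = exp (- W y)" "dec_w 0 y = 0"
proof -
  have "dirac_ode \<kappa> 0 UNIV (\<lambda>y. exp (- W y)) (\<lambda>y. 0)"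
    unfolding dirac_ode_def by (auto intro!: derivative_eq_intros W_deriv)
  from dirac_ode_unique[OF _ dec_sol this kappa_bound, of 1 y]
  show "dec_u 0 y = exp (- W y)" "dec_w 0 y = 0" by (auto simp: dec_u_1 dec_w_1 tail_slope_def)
qed

text \<open>
  Both the coefficients of the system and the data at \<open>1\<close> depend on the energy, the latter through
  the tail slope only.
\<close>

lemma dec_sol_parameter:
  "\<exists>C\<ge>0. \<forall>E E'. \<bar>E\<bar> < k \<longrightarrow> \<bar>E'\<bar> < k \<longrightarrow> (\<forall>y\<in>{-1..1}.
     (dec_u E y - dec_u E' y)\<^sup>2 + (dec_w E y - dec_w E' y)\<^sup>2
       \<le> C * ((tail_slope k E - tail_slope k E')\<^sup>2 + (E - E')\<^sup>2))"
proof -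
  define U where "U = 2 * (exp (- W 1))\<^sup>2 * exp (2 * kmax * 2)"
  define X where "X = exp ((2 * kmax + 1) * (1 - (-1)))"
  define C where "C = ((exp (- W 1))\<^sup>2 + U) * X"
  have k0: "kmax \<ge> 0" using order_trans[OF abs_ge_zero kappa_bound[of 0]] .
  have "(dec_u E y - dec_u E' y)\<^sup>2 + (dec_w E y - dec_w E' y)\<^sup>2
       \<le> C * ((tail_slope k E - tail_slope k E')\<^sup>2 + (E - E')\<^sup>2)"
    if E: "\<bar>E\<bar> < k" "\<bar>E'\<bar> < k" and y: "y \<in> {-1..1}" for E E' y
  proof -
    have U: "(dec_u E' x)\<^sup>2 + (dec_w E' x)\<^sup>2 \<le> U" if x: "x \<in> {-1..1}" for x
    proof -
      have "(dec_u E' x)\<^sup>2 + (dec_w E' x)\<^sup>2 \<le> ((dec_u E' 1)\<^sup>2 + (dec_w E' 1)\<^sup>2) * exp (2 * kmax * \<bar>x - 1\<bar>)"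
        by (rule dirac_ode_energy_bound[OF _ dec_sol kappa_bound]) auto
      also have "\<dots> \<le> (2 * (exp (- W 1))\<^sup>2) * exp (2 * kmax * 2)"
      proof (rule mult_mono)
        have "(tail_slope k E')\<^sup>2 * (exp (- W 1))\<^sup>2 \<le> 1 * (exp (- W 1))\<^sup>2"
          using gap_facts(8)[OF k_pos E(2)] by (intro mult_right_mono) auto
        then show "(dec_u E' 1)\<^sup>2 + (dec_w E' 1)\<^sup>2 \<le> 2 * (exp (- W 1))\<^sup>2"
          by (simp add: dec_u_1 dec_w_1 power_mult_distrib)
        show "exp (2 * kmax * \<bar>x - 1\<bar>) \<le> exp (2 * kmax * 2)"
          unfolding exp_le_cancel_iff using x k0 by (intro mult_left_mono) auto
      qed auto
      finally show ?thesis by (simp add: U_def)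
    qed
    have "(dec_u E y - dec_u E' y)\<^sup>2 + (dec_w E y - dec_w E' y)\<^sup>2
        \<le> ((dec_u E 1 - dec_u E' 1)\<^sup>2 + (dec_w E 1 - dec_w E' 1)\<^sup>2 + (E - E')\<^sup>2 * U) * X"
      unfolding X_def
      by (rule dirac_ode_parameter_bound[OF _ dirac_ode_mono[OF dec_sol] dirac_ode_mono[OF dec_sol]
          kappa_bound k0 U y])
         auto
    also have "\<dots> = ((tail_slope k E - tail_slope k E')\<^sup>2 * (exp (- W 1))\<^sup>2 + (E - E')\<^sup>2 * U) * X"
      by (simp add: dec_u_1 dec_w_1 power_mult_distrib[symmetric]) (simp add: algebra_simps power2_eq_square)
    also have "\<dots> \<le> C * ((tail_slope k E - tail_slope k E')\<^sup>2 + (E - E')\<^sup>2)"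
    proof -
      have "(tail_slope k E - tail_slope k E')\<^sup>2 * (exp (- W 1))\<^sup>2 + (E - E')\<^sup>2 * U
          \<le> ((exp (- W 1))\<^sup>2 + U) * ((tail_slope k E - tail_slope k E')\<^sup>2 + (E - E')\<^sup>2)"
      proof -
        have "p * a + q * U \<le> (a + U) * (p + q)" if "p \<ge> 0" "q \<ge> 0" "a \<ge> 0" for p q a :: real
        proof -
          have "(a + U) * (p + q) = (p * a + q * U) + (a * q + U * p)" by (simp add: algebra_simps)
          moreover have "a * q + U * p \<ge> 0" using that by (simp add: U_def)
          ultimately show ?thesis by simp
        qed
        then show ?thesis by simp
      qed
      then have "((tail_slope k E - tail_slope k E')\<^sup>2 * (exp (- W 1))\<^sup>2 + (E - E')\<^sup>2 * U) * X
          \<le> ((exp (- W 1))\<^sup>2 + U) * ((tail_slope k E - tail_slope k E')\<^sup>2 + (E - E')\<^sup>2) * X"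
        by (rule mult_right_mono) (simp add: X_def)
      also have "\<dots> = C * ((tail_slope k E - tail_slope k E')\<^sup>2 + (E - E')\<^sup>2)"
        unfolding C_def by (simp only: mult_ac)
      finally show ?thesis .
    qed
    finally show ?thesis .
  qed
  moreover have "C \<ge> 0" by (simp add: C_def U_def X_def)
  ultimately show ?thesis by blast
qed

end

section \<open>Spinors and the real system\<close>

lemma L2_locally_integrable:
  assumes "f \<in> L2"
  shows "locally_integrable f"
  unfolding locally_integrable_def set_integrable_def
proof (intro allI)
  fix a b :: real
  show "integrable lborel (\<lambda>x. indicator {a..b} x *\<^sub>R f x)"
  proof (rule Bochner_Integration.integrable_bound)
  have [measurable]: "f \<in> borel_measurable borel" and i: "integrable lborel (\<lambda>x. (norm (f x))\<^sup>2)"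
    using assms by (auto simp: L2_def)
  show "integrable lborel (\<lambda>x. indicator {a..b} x + (norm (f x))\<^sup>2)"
    by (intro Bochner_Integration.integrable_add i) (simp add: integrable_indicator_iff
        emeasure_lborel_Icc_eq)
  show "(\<lambda>x. indicator {a..b} x *\<^sub>R f x) \<in> borel_measurable lborel" by measurable
  have "norm y \<le> 1 + (norm y)\<^sup>2" for y :: "complex^2"
  proof -
    have "2 * norm y \<le> 1 + (norm y)\<^sup>2" using sum_squares_bound[of 1 "norm y"] by simp
    then show ?thesis using norm_ge_zero[of y] by linarith
  qed
  then show "AE x in lborel. norm (indicator {a..b} x *\<^sub>R f x) \<le> norm (indicator {a..b} x + (norm (f x))\<^sup>2)"
    by (auto simp: indicator_def)
  qed
qed

lemma weak_deriv_props:
  assumes "f \<in> H1"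
  shows "weak_deriv f \<in> L2" "has_weak_deriv f (weak_deriv f)"
proof -
  have "\<exists>g. g \<in> L2 \<and> has_weak_deriv f g" using assms by (auto simp: H1_def)
  from someI_ex[OF this] show "weak_deriv f \<in> L2" "has_weak_deriv f (weak_deriv f)"
    by (simp_all add: weak_deriv_def)
qed

text \<open>
  The classical derivative is a weak derivative, and weak derivatives are unique almost everywhere.
\<close>

lemma C1_in_H1:
  assumes d: "\<And>x. (G has_vector_derivative g x) (at x)" and g: "continuous_on UNIV g"
    and L: "G \<in> L2" "g \<in> L2"
  shows "G \<in> H1" "AE x in lborel. weak_deriv G x = g x"
proof -
  have w: "has_weak_deriv G g"
    unfolding has_weak_deriv_def using C1_weak_deriv[OF d g] by blast
  then show H: "G \<in> H1" using L by (auto simp: H1_def)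
  show "AE x in lborel. weak_deriv G x = g x"
  proof (rule weak_deriv_AE_unique)
    show "locally_integrable (weak_deriv G)" "locally_integrable g"
      using L2_locally_integrable weak_deriv_props(1)[OF H] L by blast+
    show "(\<integral>x. \<phi> x *\<^sub>R weak_deriv G x \<partial>lborel) = (\<integral>x. \<phi> x *\<^sub>R g x \<partial>lborel)" if "test_function \<phi>" for \<phi>
      using w weak_deriv_props(2)[OF H] that unfolding has_weak_deriv_def by fastforce
  qed
qed

text \<open>
  The vectors \<open>(1, \<i>)\<close> and \<open>(- \<i>, - 1)\<close> are multiples of the spinors carried by the zero modes of a
  wall and of its reflection. In this basis the equation \<open>\<D>\<^sub>m f = E f\<close> has real coefficients.
\<close>

definition spinor :: "real \<Rightarrow> real \<Rightarrow> complex^2" where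
  "spinor a b = a *\<^sub>R vector [1, \<i>] + b *\<^sub>R vector [-\<i>, -1]"

lemma spinor_nth [simp]:
  "spinor a b $ 1 = complex_of_real a - \<i> * complex_of_real b"
  "spinor a b $ 2 = \<i> * complex_of_real a - complex_of_real b"
  by (simp_all add: spinor_def scaleR_conv_of_real[where 'a=complex] mult.commute)

lemma vec2_norm_sq: "(norm (v :: complex^2))\<^sup>2 = (cmod (v $ 1))\<^sup>2 + (cmod (v $ 2))\<^sup>2"
  by (simp add: norm_vec_def L2_set_def sum_2)

lemma norm_spinor_sq: "(norm (spinor a b))\<^sup>2 = 2 * (a\<^sup>2 + b\<^sup>2)"
  by (simp add: vec2_norm_sq cmod_power2 algebra_simps)

lemma norm_H_eq: "norm_H f = sqrt (\<integral>x. (norm (f x))\<^sup>2 \<partial>lborel)"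
proof -
  have "(\<Sum>j\<in>UNIV. cnj (f x $ j) * f x $ j) = complex_of_real ((norm (f x))\<^sup>2)" for x
    by (simp only: sum_2 vec2_norm_sq of_real_add complex_norm_square mult.commute[of "cnj _"])
  then show ?thesis by (simp add: norm_H_def inner_H_def del: of_real_power)
qed

lemma vec2_eq_iff: "(v :: 'a^2) = w \<longleftrightarrow> v $ 1 = w $ 1 \<and> v $ 2 = w $ 2"
  by (simp add: vec_eq_iff forall_2)

lemma dirac_nth:
  "dirac m f x $ 1 = \<i> * (weak_deriv f x $ 1) + complex_of_real (m x) * (f x $ 2)"
  "dirac m f x $ 2 = - (\<i> * (weak_deriv f x $ 2)) + complex_of_real (m x) * (f x $ 1)"
  by (simp_all add: dirac_def sigma1_def sigma3_def matrix_vector_mult_def sum_2)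

lemma spinor_has_vector_derivative:
  assumes "(u has_real_derivative u') (at x)" "(w has_real_derivative w') (at x)"
  shows "((\<lambda>x. spinor (u x) (w x)) has_vector_derivative spinor u' w') (at x)"
  unfolding spinor_def
  by (intro has_vector_derivative_add)
     (use has_vector_derivative_scaleR[OF assms(1) has_vector_derivative_const]
       has_vector_derivative_scaleR[OF assms(2) has_vector_derivative_const] in simp_all)

lemma spinor_continuous_on [continuous_intros]:
  "continuous_on S u \<Longrightarrow> continuous_on S w \<Longrightarrow> continuous_on S (\<lambda>x. spinor (u x) (w x))"
  unfolding spinor_def by (intro continuous_intros)

lemma spinor_L2:
  assumes "continuous_on UNIV u" "continuous_on UNIV w"
    and "integrable lborel (\<lambda>x. (u x)\<^sup>2 + (w x)\<^sup>2)"
  shows "(\<lambda>x. spinor (u x) (w x)) \<in> L2"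
  unfolding L2_def mem_Collect_eq norm_spinor_sq
  using assms integrable_mult_right[OF assms(3), of 2]
  by (auto intro!: borel_measurable_continuous_onI continuous_intros simp del: distrib_left_numeral)

lemma dirac_ode_continuous:
  assumes "dirac_ode m E UNIV u w"
  shows "continuous_on UNIV u" "continuous_on UNIV w"
  using dirac_odeD[OF assms] by (meson DERIV_isCont UNIV_I continuous_at_imp_continuous_on)+

text \<open>
  Square integrability of the derivative follows from the system, as the mass is bounded.
\<close>

lemma dirac_ode_eigen_eq:
  assumes m: "continuous_on UNIV m" "\<And>x. \<bar>m x\<bar> \<le> B" and ode: "dirac_ode m E UNIV u w"
    and L2: "integrable lborel (\<lambda>x. (u x)\<^sup>2 + (w x)\<^sup>2)"
  shows "(\<lambda>x. spinor (u x) (w x)) \<in> H1"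
    and "AE x in lborel. dirac m (\<lambda>x. spinor (u x) (w x)) x = complex_of_real E *s spinor (u x) (w x)"
proof -
  let ?f = "\<lambda>x. spinor (u x) (w x)"
  let ?u' = "\<lambda>x. - m x * u x - E * w x" and ?w' = "\<lambda>x. m x * w x + E * u x"
  note c = dirac_ode_continuous[OF ode]
  have d: "(?f has_vector_derivative spinor (?u' x) (?w' x)) (at x)" for x
    by (rule spinor_has_vector_derivative) (use dirac_odeD[OF ode] in auto)
  have c': "continuous_on UNIV ?u'" "continuous_on UNIV ?w'"
    by (intro continuous_intros m c)+
  have [measurable]: "u \<in> borel_measurable borel" "w \<in> borel_measurable borel" "m \<in> borel_measurable borel"
    using c m(1) by (auto intro: borel_measurable_continuous_onI)
  have i': "integrable lborel (\<lambda>x. (?u' x)\<^sup>2 + (?w' x)\<^sup>2)"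
  proof (rule Bochner_Integration.integrable_bound)
    show "integrable lborel (\<lambda>x. 2 * (B\<^sup>2 + E\<^sup>2) * ((u x)\<^sup>2 + (w x)\<^sup>2))"
      using L2 by (rule integrable_mult_right)
    have "(?u' x)\<^sup>2 + (?w' x)\<^sup>2 \<le> 2 * (B\<^sup>2 + E\<^sup>2) * ((u x)\<^sup>2 + (w x)\<^sup>2)" for x
    proof -
      have "(?u' x)\<^sup>2 + (?w' x)\<^sup>2 + ((m x * u x - E * w x)\<^sup>2 + (m x * w x - E * u x)\<^sup>2)
          = 2 * ((m x)\<^sup>2 + E\<^sup>2) * ((u x)\<^sup>2 + (w x)\<^sup>2)"
        by (simp add: power2_eq_square algebra_simps)
      moreover have "(m x)\<^sup>2 \<le> B\<^sup>2" using m(2)[of x] by (metis abs_ge_zero power2_abs power_mono)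
      then have "2 * ((m x)\<^sup>2 + E\<^sup>2) * ((u x)\<^sup>2 + (w x)\<^sup>2) \<le> 2 * (B\<^sup>2 + E\<^sup>2) * ((u x)\<^sup>2 + (w x)\<^sup>2)"
        by (intro mult_right_mono mult_left_mono add_right_mono) auto
      moreover have "0 \<le> (m x * u x - E * w x)\<^sup>2 + (m x * w x - E * u x)\<^sup>2" by simp
      ultimately show ?thesis by linarith
    qed
    then show "AE x in lborel. norm ((?u' x)\<^sup>2 + (?w' x)\<^sup>2) \<le> norm (2 * (B\<^sup>2 + E\<^sup>2) * ((u x)\<^sup>2 + (w x)\<^sup>2))"
      by auto
  qed measurable
  have cf: "continuous_on UNIV (\<lambda>x. spinor (?u' x) (?w' x))"
    by (intro spinor_continuous_on c')
  note H = C1_in_H1[OF d cf spinor_L2[OF c L2] spinor_L2[OF c' i']]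
  show "?f \<in> H1" by (rule H(1))
  from H(2) show "AE x in lborel. dirac m ?f x = complex_of_real E *s ?f x"
  proof eventually_elim
    case (elim x)
    show ?case
      unfolding vec2_eq_iff dirac_nth elim
      by (simp add: algebra_simps)
  qed
qed

lemma continuous_AE_zero:
  fixes f :: "real \<Rightarrow> 'a :: real_normed_vector"
  assumes "continuous_on UNIV f" "AE x in lborel. f x = 0"
  shows "f x = 0"
proof (rule ccontr)
  assume nz: "f x \<noteq> 0"
  have "open (f -` (- {0}))"
    using assms(1) by (intro open_vimage) auto
  moreover have "x \<in> f -` (- {0})" using nz by simp
  ultimately obtain e where e: "e > 0" "ball x e \<subseteq> f -` (- {0})" by (meson openE)
  have "AE y in lborel. y \<notin> {x - e<..<x + e}"
    using assms(2)
  proof eventually_elim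
    case (elim y)
    show ?case
    proof
      assume "y \<in> {x - e<..<x + e}"
      then have "y \<in> ball x e" by (auto simp: dist_real_def)
      then show False using e(2) elim by auto
    qed
  qed
  then have "emeasure lborel {x - e<..<x + e} = 0"
    using AE_iff_measurable[of "{x - e<..<x + e}" lborel "\<lambda>y. y \<notin> {x - e<..<x + e}"]
    by (auto simp: greaterThanLessThan_def greaterThan_def lessThan_def Int_def)
  then show False using e(1) by (simp del: greaterThanLessThan_iff)
qed

lemma dirac_ode_eigenfunction:
  assumes m: "continuous_on UNIV m" "\<And>x. \<bar>m x\<bar> \<le> B" and ode: "dirac_ode m E UNIV u w"
    and L2: "integrable lborel (\<lambda>x. (u x)\<^sup>2 + (w x)\<^sup>2)" and nz: "(u x0)\<^sup>2 + (w x0)\<^sup>2 > 0"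
  shows "eigenfunction m E (\<lambda>x. spinor (u x) (w x))"
  unfolding eigenfunction_def
proof (intro conjI dirac_ode_eigen_eq[OF m ode L2] notI)
  assume "AE x in lborel. spinor (u x) (w x) = 0"
  then have "spinor (u x0) (w x0) = 0"
    by (rule continuous_AE_zero[rotated]) (intro spinor_continuous_on dirac_ode_continuous[OF ode])
  then have "(norm (spinor (u x0) (w x0)))\<^sup>2 = 0" by simp
  then show False using nz unfolding norm_spinor_sq by simp
qed

text \<open>
  The complex coordinates of a vector with respect to the basis \<open>(1, \<i>)\<close>, \<open>(- \<i>, - 1)\<close>.
\<close>

definition comp_u :: "complex^2 \<Rightarrow> complex" where "comp_u v = (v $ 1 - \<i> * v $ 2) / 2"
definition comp_w :: "complex^2 \<Rightarrow> complex" where "comp_w v = \<i> * (v $ 1 + \<i> * v $ 2) / 2"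

lemma spinor_decomp:
  "v = spinor (Re (comp_u v)) (Re (comp_w v)) + \<i> *s spinor (Im (comp_u v)) (Im (comp_w v))"
  unfolding vec2_eq_iff by (simp add: comp_u_def comp_w_def complex_eq_iff field_simps)

lemma comp_norm: "(norm v)\<^sup>2 = 2 * ((Re (comp_u v))\<^sup>2 + (Re (comp_w v))\<^sup>2 + ((Im (comp_u v))\<^sup>2 + (Im (comp_w
    v))\<^sup>2))"
  unfolding vec2_norm_sq cmod_power2
  by (simp add: comp_u_def comp_w_def) (simp add: power2_eq_square field_simps)

lemma comp_bounded_linear:
  "bounded_linear (\<lambda>v. Re (comp_u v))" "bounded_linear (\<lambda>v. Im (comp_u v))"
  "bounded_linear (\<lambda>v. Re (comp_w v))" "bounded_linear (\<lambda>v. Im (comp_w v))"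
  unfolding linear_conv_bounded_linear[symmetric]
  by (auto intro!: linearI simp: comp_u_def comp_w_def field_simps)

text \<open>
  Regularity of eigenfunctions. The eigenvalue equation expresses the weak derivative through \<open>f\<close>
  itself, so \<open>f\<close> agrees with the primitive of a continuous function and solves the system
  classically. The coefficients are real, hence real and imaginary parts of the coordinates are
  solutions separately.
\<close>

lemma eigenfunction_ode:
  assumes m: "continuous_on UNIV m" and f: "eigenfunction m E f"
  shows "\<exists>u w u' w'. dirac_ode m E UNIV u w \<and> dirac_ode m E UNIV u' w' \<and>
      integrable lborel (\<lambda>x. (u x)\<^sup>2 + (w x)\<^sup>2) \<and> integrable lborel (\<lambda>x. (u' x)\<^sup>2 + (w' x)\<^sup>2) \<and>
      (AE x in lborel. f x = spinor (u x) (w x) + \<i> *s spinor (u' x) (w' x))"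
proof -
  define g where "g = weak_deriv f"
  have fH: "f \<in> H1" and fE: "AE x in lborel. dirac m f x = complex_of_real E *s f x"
    using f by (auto simp: eigenfunction_def)
  have g: "g \<in> L2" "has_weak_deriv f g" using weak_deriv_props[OF fH] by (auto simp: g_def)
  have fL: "f \<in> L2" using fH by (auto simp: H1_def)
  have loc: "locally_integrable f" "locally_integrable g"
    using L2_locally_integrable fL g(1) by auto
  obtain c where c: "AE x in lborel. f x = c + primitive g x"
    using weak_deriv_AE_primitive[OF loc] g(2) unfolding has_weak_deriv_def by blast
  define F where "F = (\<lambda>x. c + primitive g x)"
  have Fc: "continuous_on UNIV F"
    unfolding F_def by (intro continuous_intros primitive_continuous locally_integrable_HK loc)
  have fF: "AE x in lborel. f x = F x" using c by (simp add: F_def)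
  (* The eigenvalue equation solved for the derivative, with the continuous representative F in place of f. *)
  define G where "G = (\<lambda>x. vector [\<i> * complex_of_real (m x) * F x $ 2 - \<i> * complex_of_real E * F x $ 1,
      \<i> * complex_of_real E * F x $ 2 - \<i> * complex_of_real (m x) * F x $ 1] :: complex^2)"
  have Gn: "G x $ 1 = \<i> * complex_of_real (m x) * F x $ 2 - \<i> * complex_of_real E * F x $ 1"
    "G x $ 2 = \<i> * complex_of_real E * F x $ 2 - \<i> * complex_of_real (m x) * F x $ 1" for x
    by (simp_all add: G_def)
  have Gc: "continuous_on UNIV G"
  proof -
    have "continuous_on UNIV (\<lambda>x. \<chi> i. G x $ i)"
    proof (rule continuous_on_vec_lambda)
      fix i :: 2
      have "i = 1 \<or> i = 2" using exhaust_2 by blast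
      then show "continuous_on UNIV (\<lambda>x. G x $ i)"
      proof (elim disjE)
        assume "i = 1"
        then show ?thesis by (simp only: Gn) (intro continuous_intros m Fc)
      next
        assume "i = 2"
        then show ?thesis by (simp only: Gn) (intro continuous_intros m Fc)
      qed
    qed
    then show ?thesis by simp
  qed
  have gG: "AE x in lborel. g x = G x"
    using fE fF
  proof eventually_elim
    case (elim x)
    have "\<i> * (g x $ 1) + complex_of_real (m x) * (F x $ 2) = complex_of_real E * F x $ 1"
      "- (\<i> * (g x $ 2)) + complex_of_real (m x) * (F x $ 1) = complex_of_real E * F x $ 2"
      using elim dirac_nth[of m f x] by (simp_all add: g_def)
    then show ?case
      unfolding vec2_eq_iff Gn by (auto simp: complex_eq_iff)
  qed
  have pg: "primitive g = primitive G"
  proof -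
    have "integral {a..b} g = integral {a..b} G" for a b
    proof -
      have "integral {a..b} g = (\<integral>y. indicator {a..b} y *\<^sub>R g y \<partial>lborel)"
        by (rule locally_integrable_HK(2)[OF loc(2), symmetric])
      also have "\<dots> = (\<integral>y. indicator {a..b} y *\<^sub>R G y \<partial>lborel)"
      proof (rule integral_cong_AE)
        show "(\<lambda>y. indicator {a..b} y *\<^sub>R g y) \<in> borel_measurable lborel"
          using g(1) by (auto simp: L2_def)
        show "(\<lambda>y. indicator {a..b} y *\<^sub>R G y) \<in> borel_measurable lborel"
          using borel_measurable_continuous_onI[OF Gc] by auto
        show "AE y in lborel. indicator {a..b} y *\<^sub>R g y = indicator {a..b} y *\<^sub>R G y"
          using gG by eventually_elim simp
      qed
      also have "\<dots> = integral {a..b} G"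
        by (rule locally_integrable_HK(2)[OF locally_integrable_continuous[OF Gc]])
      finally show ?thesis .
    qed
    then show ?thesis by (auto simp: primitive_def fun_eq_iff)
  qed
  have Fd: "(F has_vector_derivative G x) (at x)" for x
    unfolding F_def pg using primitive_has_vector_derivative[OF Gc, of x]
    by (auto intro!: derivative_eq_intros)
  have FL: "integrable lborel (\<lambda>x. (norm (F x))\<^sup>2)"
  proof (rule integrable_cong_AE_imp)
    show "integrable lborel (\<lambda>x. (norm (f x))\<^sup>2)" using fL by (simp add: L2_def)
    show "(\<lambda>x. (norm (F x))\<^sup>2) \<in> borel_measurable lborel"
      using borel_measurable_continuous_onI[OF Fc] by auto
    show "AE x in lborel. (norm (f x))\<^sup>2 = (norm (F x))\<^sup>2"
      using fF by eventually_elim simp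
  qed
  define u w u' w' where "u = (\<lambda>x. Re (comp_u (F x)))" "w = (\<lambda>x. Re (comp_w (F x)))"
    "u' = (\<lambda>x. Im (comp_u (F x)))" "w' = (\<lambda>x. Im (comp_w (F x)))"
  note defs = this
  have ode: "dirac_ode m E UNIV u w" "dirac_ode m E UNIV u' w'"
    unfolding dirac_ode_def defs
  proof safe
    fix x
    note d = comp_bounded_linear[THEN bounded_linear.has_vector_derivative, OF Fd[of x]]
    show "((\<lambda>x. Re (comp_u (F x))) has_real_derivative
        - m x * Re (comp_u (F x)) - E * Re (comp_w (F x))) (at x)"
      by (rule DERIV_cong[OF d(1)[folded has_real_derivative_iff_has_vector_derivative]])
         (simp add: comp_u_def comp_w_def Gn field_simps)
    show "((\<lambda>x. Re (comp_w (F x))) has_real_derivative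
        m x * Re (comp_w (F x)) + E * Re (comp_u (F x))) (at x)"
      by (rule DERIV_cong[OF d(3)[folded has_real_derivative_iff_has_vector_derivative]])
         (simp add: comp_u_def comp_w_def Gn field_simps)
    show "((\<lambda>x. Im (comp_u (F x))) has_real_derivative
        - m x * Im (comp_u (F x)) - E * Im (comp_w (F x))) (at x)"
      by (rule DERIV_cong[OF d(2)[folded has_real_derivative_iff_has_vector_derivative]])
         (simp add: comp_u_def comp_w_def Gn field_simps)
    show "((\<lambda>x. Im (comp_w (F x))) has_real_derivative
        m x * Im (comp_w (F x)) + E * Im (comp_u (F x))) (at x)"
      by (rule DERIV_cong[OF d(4)[folded has_real_derivative_iff_has_vector_derivative]])
         (simp add: comp_u_def comp_w_def Gn field_simps)
  qed
  have i: "integrable lborel (\<lambda>x. (u x)\<^sup>2 + (w x)\<^sup>2)" "integrable lborel (\<lambda>x. (u' x)\<^sup>2 + (w' x)\<^sup>2)"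
    using dirac_ode_continuous[OF ode(1)] dirac_ode_continuous[OF ode(2)]
    by (auto intro!: Bochner_Integration.integrable_bound[OF FL] borel_measurable_continuous_onI
        continuous_intros simp: comp_norm defs)
  have "AE x in lborel. f x = spinor (u x) (w x) + \<i> *s spinor (u' x) (w' x)"
    using fF
  proof eventually_elim
    case (elim x)
    then show ?case using spinor_decomp[of "F x"] by (simp add: defs)
  qed
  then show ?thesis using ode i by blast
qed

lemma integrable_exp_minus_abs:
  assumes "\<mu> > (0::real)"
  shows "integrable lborel (\<lambda>x. exp (- \<mu> * \<bar>x\<bar>))"
proof -
  have 1: "integrable lborel (\<lambda>x. indicator {0..} x *\<^sub>R exp (- \<mu> * x))"
  proof (rule integrableI_nonneg)
    have "(\<integral>\<^sup>+ x. ennreal (exp (- \<mu> * x)) * indicator {0..} x \<partial>lborel) = ennreal (0 - (- exp (- \<mu> * 0) / \<mu>))"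
    proof (rule nn_integral_FTC_atLeast)
      show "((\<lambda>x. - exp (- \<mu> * x) / \<mu>) has_real_derivative exp (- \<mu> * x)) (at x)" for x
        using assms by (auto intro!: derivative_eq_intros)
      have "((\<lambda>x. exp (- \<mu> * x)) \<longlongrightarrow> 0) at_top"
        using assms by (intro filterlim_compose[OF exp_at_bot] filterlim_tendsto_neg_mult_at_bot[OF
            tendsto_const] filterlim_ident) auto
      then have "((\<lambda>x. - exp (- \<mu> * x) / \<mu>) \<longlongrightarrow> - 0 / \<mu>) at_top"
        using assms by (intro tendsto_intros) auto
      then show "((\<lambda>x. - exp (- \<mu> * x) / \<mu>) \<longlongrightarrow> 0) at_top" by simp
    qed auto
    then show "(\<integral>\<^sup>+ x. ennreal (indicator {0..} x *\<^sub>R exp (- \<mu> * x)) \<partial>lborel) < \<infinity>"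
      by (simp add: mult.commute indicator_mult_ennreal)
  qed auto
  have 2: "integrable lborel (\<lambda>x. indicator {0..} (0 + (-1) * x) *\<^sub>R exp (- \<mu> * (0 + (-1) * x)))"
    using lborel_integrable_real_affine[OF 1, of "-1" 0] by simp
  show ?thesis
  proof (rule Bochner_Integration.integrable_bound[OF Bochner_Integration.integrable_add[OF 1 2]])
    show "AE x in lborel. norm (exp (- \<mu> * \<bar>x\<bar>)) \<le> norm (indicator {0..} x *\<^sub>R exp (- \<mu> * x) +
        indicator {0..} (0 + (-1) * x) *\<^sub>R exp (- \<mu> * (0 + (-1) * x)))"
      by (intro AE_I2) (auto simp: indicator_def abs_real_def)
  qed simp
qed

lemma integrable_exp_bound:
  fixes f :: "real \<Rightarrow> real"
  assumes "\<mu> > 0" "continuous_on UNIV f" "\<And>x. \<bar>f x\<bar> \<le> C * exp (- \<mu> * \<bar>x\<bar>)"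
  shows "integrable lborel f"
proof (rule Bochner_Integration.integrable_bound)
  show "integrable lborel (\<lambda>x. C * exp (- \<mu> * \<bar>x\<bar>))"
    by (intro integrable_mult_right integrable_exp_minus_abs assms)
  show "AE x in lborel. norm (f x) \<le> norm (C * exp (- \<mu> * \<bar>x\<bar>))"
    using assms(3) by (auto intro!: AE_I2 order_trans[OF assms(3)])
qed (use borel_measurable_continuous_onI[OF assms(2)] in simp)

text \<open>
  The boundary terms of the fundamental theorem of calculus on \<open>[- n, n]\<close> tend to \<open>0\<close>.
\<close>

lemma integral_derivative_decaying:
  fixes f F :: "real \<Rightarrow> real"
  assumes "\<mu> > 0" and d: "\<And>x. (F has_real_derivative f x) (at x)" and c: "continuous_on UNIV f"
    and f: "integrable lborel f" and F: "\<And>x. \<bar>F x\<bar> \<le> C * exp (- \<mu> * \<bar>x\<bar>)"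
  shows "(\<integral>x. f x \<partial>lborel) = 0"
proof -
  have e: "(\<lambda>n. exp (- \<mu> * real n)) \<longlonglongrightarrow> 0"
    using assms(1) by (intro filterlim_compose[OF exp_at_bot] filterlim_tendsto_neg_mult_at_bot[OF
        tendsto_const] filterlim_real_sequentially) auto
  have "(\<lambda>n. \<integral>x. indicator {- real n..real n} x *\<^sub>R f x \<partial>lborel) \<longlonglongrightarrow> (\<integral>x. f x \<partial>lborel)"
  proof (rule integral_dominated_convergence[where w = "\<lambda>x. norm (f x)"])
    show "AE x in lborel. (\<lambda>n. indicator {- real n..real n} x *\<^sub>R f x) \<longlonglongrightarrow> f x"
    proof (intro AE_I2 tendsto_eventually)
      fix x :: real
      obtain N where "\<bar>x\<bar> < real N" using reals_Archimedean2 by blast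
      then show "\<forall>\<^sub>F n in sequentially. indicator {- real n..real n} x *\<^sub>R f x = f x"
        by (intro eventually_sequentiallyI[of N]) (auto simp: indicator_def)
    qed
  qed (use f in \<open>auto simp: indicator_def\<close>)
  moreover have "(\<integral>x. indicator {- real n..real n} x *\<^sub>R f x \<partial>lborel) = F (real n) - F (- real n)" for n
    by (rule integral_FTC_Icc)
       (use d in \<open>auto intro: continuous_on_subset[OF c] has_vector_derivative_at_within
          simp flip: has_real_derivative_iff_has_vector_derivative intro: has_field_derivative_at_within\<close>)
  moreover have "(\<lambda>n. F (real n) - F (- real n)) \<longlonglongrightarrow> 0"
  proof (rule Lim_null_comparison)
    show "\<forall>\<^sub>F n in sequentially. norm (F (real n) - F (- real n)) \<le> 2 * C * exp (- \<mu> * real n)"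
    proof (intro always_eventually allI)
      fix n
      show "norm (F (real n) - F (- real n)) \<le> 2 * C * exp (- \<mu> * real n)"
        using F[of "real n"] F[of "- real n"] abs_triangle_ineq4[of "F (real n)" "F (- real n)"] by simp
    qed
    show "(\<lambda>n. 2 * C * exp (- \<mu> * real n)) \<longlonglongrightarrow> 0"
      using tendsto_mult_left[OF e, of "2 * C"] by simp
  qed
  ultimately show ?thesis using LIMSEQ_unique by auto
qed

section \<open>Matching two walls\<close>

lemma exp_bound_if_outside:
  fixes f :: "real \<Rightarrow> real"
  assumes f: "continuous_on UNIV f" and R: "\<And>x. \<bar>x\<bar> \<ge> R \<Longrightarrow> \<bar>f x\<bar> \<le> c * exp (- s * \<bar>x\<bar>)"
  shows "\<exists>C. \<forall>x. \<bar>f x\<bar> \<le> C * exp (- s * \<bar>x\<bar>)"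
proof -
  have "continuous_on {-R..R} (\<lambda>x. \<bar>f x\<bar> * exp (s * \<bar>x\<bar>))"
    by (intro continuous_intros continuous_on_subset[OF f]) auto
  then have "bounded ((\<lambda>x. \<bar>f x\<bar> * exp (s * \<bar>x\<bar>)) ` {-R..R})"
    by (intro compact_imp_bounded compact_continuous_image) auto
  then obtain B where B: "\<And>x. x \<in> {-R..R} \<Longrightarrow> \<bar>\<bar>f x\<bar> * exp (s * \<bar>x\<bar>)\<bar> \<le> B"
    unfolding bounded_iff by (metis imageI real_norm_def)
  have "\<bar>f x\<bar> \<le> max B c * exp (- s * \<bar>x\<bar>)" for x
  proof (cases "\<bar>x\<bar> \<ge> R")
    case True
    show ?thesis by (rule order_trans[OF R[OF True]]) (rule mult_right_mono, auto)
  next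
    case False
    then have "x \<in> {-R..R}" by (auto simp: abs_le_iff)
    from B[OF this] have "\<bar>f x\<bar> * exp (s * \<bar>x\<bar>) \<le> B" by simp
    then have "\<bar>f x\<bar> * exp (s * \<bar>x\<bar>) * exp (- s * \<bar>x\<bar>) \<le> max B c * exp (- s * \<bar>x\<bar>)"
      by (intro mult_right_mono) auto
    then show ?thesis by (simp add: mult.assoc exp_add[symmetric])
  qed
  then show ?thesis by blast
qed

lemma integrable_sum_squares_exp:
  fixes u w :: "real \<Rightarrow> real"
  assumes s: "s > 0" and c: "continuous_on UNIV u" "continuous_on UNIV w"
    and b: "\<And>x. \<bar>u x\<bar> \<le> C * exp (- s * \<bar>x\<bar>)" "\<And>x. \<bar>w x\<bar> \<le> C' * exp (- s * \<bar>x\<bar>)"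
  shows "integrable lborel (\<lambda>x. (u x)\<^sup>2 + (w x)\<^sup>2)"
proof (rule integrable_exp_bound[of "2 * s" _ "C\<^sup>2 + C'\<^sup>2"])
  show "continuous_on UNIV (\<lambda>x. (u x)\<^sup>2 + (w x)\<^sup>2)" by (intro continuous_intros c)
  fix x
  have "(u x)\<^sup>2 \<le> (C * exp (- s * \<bar>x\<bar>))\<^sup>2" "(w x)\<^sup>2 \<le> (C' * exp (- s * \<bar>x\<bar>))\<^sup>2"
    using b[of x] by (metis abs_ge_zero power2_abs power_mono)+
  moreover have "(exp (- s * \<bar>x\<bar>))\<^sup>2 = exp (- (2 * s) * \<bar>x\<bar>)"
    by (simp add: exp_double[symmetric] algebra_simps)
  ultimately show "\<bar>(u x)\<^sup>2 + (w x)\<^sup>2\<bar> \<le> (C\<^sup>2 + C'\<^sup>2) * exp (- (2 * s) * \<bar>x\<bar>)"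
    by (simp add: power_mult_distrib algebra_simps)
qed (use s in auto)

lemma surj_uminus_real: "range (uminus :: real \<Rightarrow> real) = UNIV"
  by (rule surjI[of _ uminus]) simp

context domain_wall
begin

lemma dec_sol_continuous: "continuous_on S (dec_u E)" "continuous_on S (dec_w E)"
  using dirac_ode_continuous[OF dec_sol] continuous_on_subset by blast+

text \<open>
  Without the growing mode the solution decays at rate \<open>s\<close> on both sides of the wall.
\<close>

lemma dec_sol_decay:
  assumes E: "\<bar>E\<bar> < k" and Q: "leak_amp E = 0"
  shows "\<exists>C. \<forall>y. \<bar>dec_u E y\<bar> \<le> C * exp (- decay_rate k E * \<bar>y\<bar>)"
    and "\<exists>C. \<forall>y. \<bar>dec_w E y\<bar> \<le> C * exp (- decay_rate k E * \<bar>y\<bar>)"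
proof -
  let ?s = "decay_rate k E" and ?t = "tail_slope k E"
  note g = gap_facts[OF k_pos E]
  let ?c = "(exp (- W 1) + \<bar>bound_amp E\<bar> / (1 - ?t\<^sup>2)) * exp ?s"
  have t2: "1 - ?t\<^sup>2 > 0" using g(8) by simp
  have A: "\<bar>dec_u E y\<bar> \<le> ?c * exp (- ?s * \<bar>y\<bar>) \<and> \<bar>dec_w E y\<bar> \<le> ?c * exp (- ?s * \<bar>y\<bar>)" if y: "\<bar>y\<bar> \<ge> 1" for y
  proof (cases "y \<ge> 1")
    case True
    have "\<bar>dec_u E y\<bar> = exp (- W 1) * exp ?s * exp (- ?s * \<bar>y\<bar>)"
      using dec_sol_tail(1)[OF E True] True by (simp add: exp_add[symmetric] algebra_simps)
    also have "\<dots> \<le> ?c * exp (- ?s * \<bar>y\<bar>)" using t2 by (intro mult_right_mono) auto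
    finally have u: "\<bar>dec_u E y\<bar> \<le> ?c * exp (- ?s * \<bar>y\<bar>)" .
    have "\<bar>dec_w E y\<bar> = \<bar>?t\<bar> * \<bar>dec_u E y\<bar>"
      unfolding dec_sol_tail[OF E True] by (simp add: abs_mult)
    also have "\<dots> \<le> 1 * \<bar>dec_u E y\<bar>" using g(7) by (intro mult_right_mono) auto
    finally show ?thesis using u by simp
  next
    case False
    then have yl: "y \<le> -1" using y by linarith
    have u: "dec_u E y = bound_amp E / (1 - ?t\<^sup>2) * exp ?s * exp (- ?s * \<bar>y\<bar>)"
      using dec_sol_left(1)[OF E yl] yl Q by (simp add: exp_add[symmetric] algebra_simps)
    then have "\<bar>dec_u E y\<bar> = \<bar>bound_amp E\<bar> / (1 - ?t\<^sup>2) * exp ?s * exp (- ?s * \<bar>y\<bar>)"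
      using t2 by (simp add: abs_mult)
    also have "\<dots> \<le> ?c * exp (- ?s * \<bar>y\<bar>)" by (intro mult_right_mono) auto
    finally have u: "\<bar>dec_u E y\<bar> \<le> ?c * exp (- ?s * \<bar>y\<bar>)" .
    have "dec_w E y = ?t * dec_u E y"
      unfolding dec_sol_left[OF E yl] by (simp add: Q)
    then have "\<bar>dec_w E y\<bar> = \<bar>?t\<bar> * \<bar>dec_u E y\<bar>" by (simp add: abs_mult)
    also have "\<dots> \<le> 1 * \<bar>dec_u E y\<bar>" using g(7) by (intro mult_right_mono) auto
    finally show ?thesis using u by simp
  qed
  show "\<exists>C. \<forall>y. \<bar>dec_u E y\<bar> \<le> C * exp (- ?s * \<bar>y\<bar>)" "\<exists>C. \<forall>y. \<bar>dec_w E y\<bar> \<le> C * exp (- ?s * \<bar>y\<bar>)"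
    using A by (intro exp_bound_if_outside[where R = 1] dec_sol_continuous; blast)+
qed

lemma weighted_w_deriv:
  "((\<lambda>y. exp (- W y) * dec_w E y) has_real_derivative E * (exp (- W y) * dec_u E y)) (at y)"
  by (auto intro!: derivative_eq_intros W_deriv dec_sol_deriv simp: algebra_simps)

text \<open>
  The integrand is a multiple of the derivative of \<open>exp (- W) w\<close>, and this function decays at both
  ends. The integral is the inner product with the zero mode, up to a constant.
\<close>

lemma dec_sol_orthogonal:
  assumes E: "\<bar>E\<bar> < k" "E \<noteq> 0" and Q: "leak_amp E = 0"
  shows "(\<integral>y. exp (- W y) * dec_u E y \<partial>lborel) = 0"
proof -
  let ?s = "decay_rate k E"
  note g = gap_facts[OF k_pos E(1)]
  obtain C where C: "\<And>y. \<bar>dec_u E y\<bar> \<le> C * exp (- ?s * \<bar>y\<bar>)" using dec_sol_decay(1)[OF E(1) Q] by blast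
  obtain C' where C': "\<And>y. \<bar>dec_w E y\<bar> \<le> C' * exp (- ?s * \<bar>y\<bar>)" using dec_sol_decay(2)[OF E(1) Q] by blast
  obtain A where A: "A > 0" "\<And>y. exp (- W y) \<le> A * exp (- k * \<bar>y\<bar>)" using exp_W_bound by blast
  have A': "exp (- W y) \<le> A" for y
    by (rule order_trans[OF A(2)]) (use A(1) k_pos in \<open>simp add: mult_le_cancel_left1\<close>)
  have b: "\<bar>exp (- W y) * f\<bar> \<le> (A * D) * exp (- ?s * \<bar>y\<bar>)" if "\<bar>f\<bar> \<le> D * exp (- ?s * \<bar>y\<bar>)" for y f D
  proof -
    have "\<bar>exp (- W y) * f\<bar> \<le> A * (D * exp (- ?s * \<bar>y\<bar>))"
      unfolding abs_mult using A'[of y] A(1) that by (intro mult_mono) auto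
    then show ?thesis by (simp add: mult.assoc)
  qed
  have cont: "continuous_on UNIV (\<lambda>y. exp (- W y) * dec_u E y)"
    by (intro continuous_intros W_continuous dec_sol_continuous)
  have i: "integrable lborel (\<lambda>y. exp (- W y) * dec_u E y)"
    by (rule integrable_exp_bound[OF g(1) cont b[OF C]])
  have "(\<integral>y. E * (exp (- W y) * dec_u E y) \<partial>lborel) = 0"
    by (rule integral_derivative_decaying[OF g(1) weighted_w_deriv _ _ b[OF C']])
       (use i cont in \<open>auto intro!: continuous_intros\<close>)
  then show ?thesis using E(2) by simp
qed

text \<open>
  Otherwise the decaying solution is an eigenfunction of the one wall operator that is orthogonal to
  the zero mode, and the spectral gap would give \<open>k \<le> \<bar>E\<bar>\<close>.
\<close>

lemma leak_amp_nonzero: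
  assumes gap: "spectral_gap \<kappa> k" and E: "\<bar>E\<bar> < k" "E \<noteq> 0"
  shows "leak_amp E \<noteq> 0"
proof
  assume Q: "leak_amp E = 0"
  let ?s = "decay_rate k E" and ?f = "\<lambda>y. spinor (dec_u E y) (dec_w E y)"
  note g = gap_facts[OF k_pos E(1)]
  obtain C where C: "\<And>y. \<bar>dec_u E y\<bar> \<le> C * exp (- ?s * \<bar>y\<bar>)" using dec_sol_decay(1)[OF E(1) Q] by blast
  obtain C' where C': "\<And>y. \<bar>dec_w E y\<bar> \<le> C' * exp (- ?s * \<bar>y\<bar>)" using dec_sol_decay(2)[OF E(1) Q] by blast
  have L2: "integrable lborel (\<lambda>y. (dec_u E y)\<^sup>2 + (dec_w E y)\<^sup>2)"
    by (rule integrable_sum_squares_exp[OF g(1) dec_sol_continuous C C'])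
  have H1: "?f \<in> H1" and eig: "AE y in lborel. dirac \<kappa> ?f y = complex_of_real E *s ?f y"
    by (rule dirac_ode_eigen_eq[OF kappa_continuous kappa_bound dec_sol L2])+
  define I where "I = (\<integral>y. (norm (?f y))\<^sup>2 \<partial>lborel)"
  have fi: "integrable lborel (\<lambda>y. (norm (?f y))\<^sup>2)"
    unfolding norm_spinor_sq by (rule integrable_mult_right[OF L2])
  have "I \<noteq> 0"
  proof
    assume "I = 0"
    then have "AE y in lborel. (norm (?f y))\<^sup>2 = 0"
      unfolding I_def by (subst (asm) integral_nonneg_eq_0_iff_AE[OF fi]) auto
    then have "AE y in lborel. ?f y = 0" by simp
    then have "?f 0 = 0"
      by (rule continuous_AE_zero[rotated]) (intro spinor_continuous_on dec_sol_continuous)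
    then have "(norm (?f 0))\<^sup>2 = 0" by simp
    then show False using dec_sol_nonzero[of E 0] unfolding norm_spinor_sq by simp
  qed
  moreover have "I \<ge> 0" unfolding I_def by simp
  ultimately have I: "I > 0" by simp
  have "inner_H (zero_mode \<kappa>) ?f = 0"
  proof -
    have "(\<Sum>j\<in>UNIV. cnj (zero_mode \<kappa> y $ j) * ?f y $ j)
        = complex_of_real (2 * gamma_const \<kappa> * (exp (- W y) * dec_u E y))" for y
      by (simp add: zero_mode_def sum_2 algebra_simps)
    then have "inner_H (zero_mode \<kappa>) ?f = complex_of_real (\<integral>y. 2 * gamma_const \<kappa> * (exp (- W y) * dec_u E y)
        \<partial>lborel)"
      unfolding inner_H_def by (simp only: integral_complex_of_real)
    then show ?thesis using dec_sol_orthogonal[OF E Q] by simp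
  qed
  then have "k * norm_H ?f \<le> norm_H (dirac \<kappa> ?f)"
    using gap H1 unfolding spectral_gap_def by blast
  moreover have "norm_H (dirac \<kappa> ?f) \<le> \<bar>E\<bar> * norm_H ?f"
  proof -
    have "(\<integral>y. (norm (dirac \<kappa> ?f y))\<^sup>2 \<partial>lborel) \<le> E\<^sup>2 * I"
    proof (cases "integrable lborel (\<lambda>y. (norm (dirac \<kappa> ?f y))\<^sup>2)")
      case True
      have "(\<integral>y. (norm (dirac \<kappa> ?f y))\<^sup>2 \<partial>lborel) = (\<integral>y. E\<^sup>2 * (norm (?f y))\<^sup>2 \<partial>lborel)"
      proof (rule integral_cong_AE)
        show "AE y in lborel. (norm (dirac \<kappa> ?f y))\<^sup>2 = E\<^sup>2 * (norm (?f y))\<^sup>2"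
          using eig by eventually_elim (simp add: vec2_norm_sq norm_mult power_mult_distrib distrib_left)
      qed (use True fi in auto)
      then show ?thesis by (simp add: I_def)
    next
      case False
      then show ?thesis using I by (simp add: not_integrable_integral_eq)
    qed
    then have "norm_H (dirac \<kappa> ?f) \<le> sqrt (E\<^sup>2 * I)"
      unfolding norm_H_eq by (rule real_sqrt_le_mono)
    then show ?thesis by (simp add: real_sqrt_mult norm_H_eq I_def)
  qed
  moreover have "norm_H ?f > 0" using I by (simp add: norm_H_eq I_def)
  ultimately have "k \<le> \<bar>E\<bar>" by (meson mult_le_cancel_right not_less order_trans)
  then show False using E(1) by simp
qed

lemma tail_slope_uminus: "tail_slope k (- E) = - tail_slope k E"
  by (simp add: tail_slope_def decay_rate_def)

lemma dec_sol_uminus: "dec_u (- E) y = dec_u E y" "dec_w (- E) y = - dec_w E y"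
proof -
  have "dirac_ode \<kappa> (- E) UNIV (dec_u E) (\<lambda>y. - dec_w E y)"
    unfolding dirac_ode_def
  proof (intro ballI conjI)
    fix y
    show "(dec_u E has_real_derivative - \<kappa> y * dec_u E y - - E * - dec_w E y) (at y)"
      by (rule DERIV_cong[OF dec_sol_deriv(1)]) simp
    show "((\<lambda>y. - dec_w E y) has_real_derivative \<kappa> y * - dec_w E y + - E * dec_u E y) (at y)"
      by (rule DERIV_cong[OF DERIV_minus[OF dec_sol_deriv(2)]]) simp
  qed
  from dirac_ode_unique[OF _ dec_sol this kappa_bound, of 1 y]
  show "dec_u (- E) y = dec_u E y" "dec_w (- E) y = - dec_w E y"
    by (auto simp: dec_u_1 dec_w_1 tail_slope_uminus)
qed

lemma leak_amp_uminus: "leak_amp (- E) = - leak_amp E"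
  by (simp add: leak_amp_def dec_sol_uminus tail_slope_uminus)

lemma tail_slope_continuous:
  assumes "K < k"
  shows "continuous_on {-K..K} (tail_slope k)" "continuous_on {-K..K} (decay_rate k)"
proof -
  show s: "continuous_on {-K..K} (decay_rate k)"
    unfolding decay_rate_def by (intro continuous_intros)
  have "k + decay_rate k E \<noteq> 0" if "E \<in> {-K..K}" for E
  proof -
    have "\<bar>E\<bar> < k" using that assms by (auto simp: abs_less_iff)
    then show ?thesis using gap_facts(1)[OF k_pos, of E] k_pos by auto
  qed
  then show "continuous_on {-K..K} (tail_slope k)"
    unfolding tail_slope_def[abs_def] by (intro continuous_intros s) auto
qed

lemma dec_sol_continuous_in_energy:
  assumes "K < k" "y \<in> {-1..1}"
  shows "continuous_on {-K..K} (\<lambda>E. dec_u E y)" "continuous_on {-K..K} (\<lambda>E. dec_w E y)"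
proof -
  obtain C where C: "C \<ge> 0" "\<And>E E'. \<bar>E\<bar> < k \<Longrightarrow> \<bar>E'\<bar> < k \<Longrightarrow>
     (dec_u E y - dec_u E' y)\<^sup>2 + (dec_w E y - dec_w E' y)\<^sup>2
       \<le> C * ((tail_slope k E - tail_slope k E')\<^sup>2 + (E - E')\<^sup>2)"
    using dec_sol_parameter assms(2) by blast
  have *: "continuous_on {-K..K} f"
    if f: "\<And>E E'. \<bar>E\<bar> < k \<Longrightarrow> \<bar>E'\<bar> < k \<Longrightarrow>
       (f E - f E')\<^sup>2 \<le> C * ((tail_slope k E - tail_slope k E')\<^sup>2 + (E - E')\<^sup>2)" for f
    unfolding continuous_on_def
  proof
    fix E' assume E': "E' \<in> {-K..K}"
    let ?F = "at E' within {-K..K}"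
    let ?h = "\<lambda>E. C * ((tail_slope k E - tail_slope k E')\<^sup>2 + (E - E')\<^sup>2)"
    have t: "(tail_slope k \<longlongrightarrow> tail_slope k E') ?F"
      using tail_slope_continuous(1)[OF assms(1)] E' by (auto simp: continuous_on_def)
    have "(?h \<longlongrightarrow> C * ((tail_slope k E' - tail_slope k E')\<^sup>2 + (E' - E')\<^sup>2)) ?F"
      by (intro tendsto_intros t)
    then have h: "((\<lambda>E. sqrt (?h E)) \<longlongrightarrow> 0) ?F"
      using tendsto_real_sqrt by fastforce
    have "((\<lambda>E. f E - f E') \<longlongrightarrow> 0) ?F"
    proof (rule Lim_null_comparison[OF _ h])
      have "norm (f E - f E') \<le> sqrt (?h E)" if "E \<in> {-K..K}" for E
        using f[of E E'] that E' assms(1) by (intro real_le_rsqrt) auto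
      then show "\<forall>\<^sub>F E in ?F. norm (f E - f E') \<le> sqrt (?h E)"
        by (auto simp: eventually_at_filter)
    qed
    then show "(f \<longlongrightarrow> f E') ?F" by (simp add: Lim_null[symmetric])
  qed
  show "continuous_on {-K..K} (\<lambda>E. dec_u E y)" "continuous_on {-K..K} (\<lambda>E. dec_w E y)"
    by (rule *; rule order_trans[OF _ C(2)]; simp)+
qed

lemma amp_continuous:
  assumes "K < k"
  shows "continuous_on {-K..K} bound_amp" "continuous_on {-K..K} leak_amp"
  unfolding bound_amp_def[abs_def] leak_amp_def[abs_def]
  by (intro continuous_intros tail_slope_continuous dec_sol_continuous_in_energy assms; simp)+

text \<open>
  The parameter bound with second energy \<open>0\<close>, where the solution is \<open>(exp (- W), 0)\<close>.
\<close>

lemma dec_sol_near_zero_energy: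
  "\<exists>C>0. \<forall>E. \<bar>E\<bar> < k \<longrightarrow> (\<forall>y\<in>{-1..1}.
     \<bar>dec_u E y - exp (- W y)\<bar> \<le> C * \<bar>E\<bar> \<and> \<bar>dec_w E y\<bar> \<le> C * \<bar>E\<bar>)"
proof -
  obtain C where C: "C \<ge> 0" "\<And>E E' y. \<bar>E\<bar> < k \<Longrightarrow> \<bar>E'\<bar> < k \<Longrightarrow> y \<in> {-1..1} \<Longrightarrow>
     (dec_u E y - dec_u E' y)\<^sup>2 + (dec_w E y - dec_w E' y)\<^sup>2
       \<le> C * ((tail_slope k E - tail_slope k E')\<^sup>2 + (E - E')\<^sup>2)"
    using dec_sol_parameter by blast
  define D where "D = sqrt (C * (1 / k\<^sup>2 + 1)) + 1"
  have "\<bar>dec_u E y - exp (- W y)\<bar> \<le> D * \<bar>E\<bar> \<and> \<bar>dec_w E y\<bar> \<le> D * \<bar>E\<bar>" if E: "\<bar>E\<bar> < k"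
      and y: "y \<in> {-1..1}" for E y
  proof -
    have "(tail_slope k E)\<^sup>2 \<le> (\<bar>E\<bar> / k)\<^sup>2"
      using gap_facts(9)[OF k_pos E] by (metis abs_ge_zero power2_abs power_mono)
    then have "(tail_slope k E - tail_slope k 0)\<^sup>2 + (E - 0)\<^sup>2 \<le> (1 / k\<^sup>2 + 1) * E\<^sup>2"
      by (simp add: tail_slope_def[of k 0] power_divide algebra_simps)
    then have "C * ((tail_slope k E - tail_slope k 0)\<^sup>2 + (E - 0)\<^sup>2) \<le> C * ((1 / k\<^sup>2 + 1) * E\<^sup>2)"
      by (rule mult_left_mono[OF _ C(1)])
    moreover have "(dec_u E y - exp (- W y))\<^sup>2 + (dec_w E y)\<^sup>2
        \<le> C * ((tail_slope k E - tail_slope k 0)\<^sup>2 + (E - 0)\<^sup>2)"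
      using C(2)[OF E _ y, of 0] k_pos by (simp add: dec_sol_zero)
    ultimately have *: "(dec_u E y - exp (- W y))\<^sup>2 + (dec_w E y)\<^sup>2 \<le> C * (1 / k\<^sup>2 + 1) * E\<^sup>2" by simp
    have "\<bar>x\<bar> \<le> D * \<bar>E\<bar>" if "x\<^sup>2 \<le> C * (1 / k\<^sup>2 + 1) * E\<^sup>2" for x
    proof -
      have "\<bar>x\<bar> \<le> sqrt (C * (1 / k\<^sup>2 + 1) * E\<^sup>2)" using that by (intro real_le_rsqrt) auto
      also have "\<dots> = sqrt (C * (1 / k\<^sup>2 + 1)) * \<bar>E\<bar>" by (simp add: real_sqrt_mult)
      also have "\<dots> \<le> D * \<bar>E\<bar>" by (intro mult_right_mono) (auto simp: D_def)
      finally show ?thesis .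
    qed
    then show ?thesis using * by (smt (verit) zero_le_power2)
  qed
  moreover have "D > 0" unfolding D_def using C(1) by (smt (verit) real_sqrt_ge_zero mult_nonneg_nonneg
      divide_nonneg_nonneg zero_le_power2)
  ultimately show ?thesis by blast
qed

lemma two_wall_abs: "two_wall \<kappa> \<delta> x = \<kappa> (\<bar>x\<bar> - \<delta>)"
  using kappa_odd[of "x + \<delta>"] by (auto simp: two_wall_def)

lemma two_wall_continuous: "continuous_on S (two_wall \<kappa> \<delta>)"
  unfolding two_wall_abs[abs_def]
  by (intro continuous_on_compose2[OF kappa_continuous[of UNIV]] continuous_intros) auto

lemma two_wall_even: "two_wall \<kappa> \<delta> (- x) = two_wall \<kappa> \<delta> x"
  by (simp add: two_wall_abs)

lemma two_wall_bound: "\<bar>two_wall \<kappa> \<delta> x\<bar> \<le> kmax"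
  by (simp add: two_wall_abs kappa_bound)

lemma dec_sol_shift: "dirac_ode (two_wall \<kappa> \<delta>) E {0..} (\<lambda>x. dec_u E (x - \<delta>)) (\<lambda>x. dec_w E (x - \<delta>))"
proof -
  have "dirac_ode (\<lambda>x. \<kappa> (x - \<delta>)) E {0..} (\<lambda>x. dec_u E (x - \<delta>)) (\<lambda>x. dec_w E (x - \<delta>))"
    by (rule dirac_ode_mono[OF dirac_ode_shift[OF dec_sol, of \<delta>]]) (metis image_eqI UNIV_I diff_add_cancel
        subsetI)
  then show ?thesis by (auto simp: dirac_ode_def two_wall_abs)
qed

text \<open>
  At the midpoint between the walls, which is \<open>- \<delta>\<close> in the coordinate centred at the right wall, the
  solution has parity \<open>\<sigma>\<close> under the exchange of components. Below, \<open>\<sigma>\<close> is always a sign, written as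
  \<open>\<sigma>\<^sup>2 = 1\<close>.
\<close>

definition matching :: "real \<Rightarrow> real \<Rightarrow> real \<Rightarrow> bool" where
  "matching \<sigma> E \<delta> \<longleftrightarrow> dec_w E (- \<delta>) = \<sigma> * dec_u E (- \<delta>)"

text \<open>
  On the right half line this is the decaying solution of the right wall, on the left half line its
  mirror image.
\<close>

definition glued_u :: "real \<Rightarrow> real \<Rightarrow> real \<Rightarrow> real \<Rightarrow> real" where
  "glued_u \<sigma> E \<delta> x = (if 0 \<le> x then dec_u E (x - \<delta>) else \<sigma> * dec_w E (- x - \<delta>))"

definition glued_w :: "real \<Rightarrow> real \<Rightarrow> real \<Rightarrow> real \<Rightarrow> real" where
  "glued_w \<sigma> E \<delta> x = (if 0 \<le> x then dec_w E (x - \<delta>) else \<sigma> * dec_u E (- x - \<delta>))"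

text \<open>
  The solution of the two wall system with the midpoint data of the shifted decaying solution equals
  its own mirror image up to the sign \<open>\<sigma>\<close>, by uniqueness; so no differentiability has to be checked
  at the seam.
\<close>

lemma two_wall_solution:
  assumes \<sigma>: "\<sigma>\<^sup>2 = 1" and c: "matching \<sigma> E \<delta>"
  shows "dirac_ode (two_wall \<kappa> \<delta>) E UNIV (glued_u \<sigma> E \<delta>) (glued_w \<sigma> E \<delta>)"
proof -
  let ?m = "two_wall \<kappa> \<delta>"
  obtain u w where uw: "dirac_ode ?m E UNIV u w" "u 0 = dec_u E (- \<delta>)" "w 0 = dec_w E (- \<delta>)"
    using dirac_ode_exists[OF two_wall_continuous two_wall_bound] by blast
  have right: "u x = dec_u E (x - \<delta>) \<and> w x = dec_w E (x - \<delta>)" if "x \<ge> 0" for x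
    by (rule dirac_ode_unique[OF _ dirac_ode_mono[OF uw(1)] dec_sol_shift two_wall_bound, of 0 x])
       (use that uw in \<open>auto simp: is_interval_ci\<close>)
  have ss: "\<sigma> * (\<sigma> * a) = a" for a using \<sigma> by (simp add: power2_eq_square mult.assoc[symmetric])
  have refl: "dirac_ode ?m E UNIV (\<lambda>x. \<sigma> * w (- x)) (\<lambda>x. \<sigma> * u (- x))"
  proof -
    have "dirac_ode ?m E UNIV (\<lambda>x. w (- x)) (\<lambda>x. u (- x))"
      using dirac_ode_reflect[OF uw(1) two_wall_even] surj_uminus_real by simp
    from dirac_ode_linear[OF this this, of \<sigma> 0] show ?thesis by simp
  qed
  have left: "u x = \<sigma> * w (- x) \<and> w x = \<sigma> * u (- x)" for x
    by (rule dirac_ode_unique[OF _ uw(1) refl two_wall_bound, of 0 x])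
       (use uw c ss in \<open>auto simp: matching_def\<close>)
  have "u x = glued_u \<sigma> E \<delta> x \<and> w x = glued_w \<sigma> E \<delta> x" for x
  proof (cases "0 \<le> x")
    case True
    then show ?thesis using right[OF True] by (simp add: glued_u_def glued_w_def)
  next
    case False
    have "u x = \<sigma> * w (- x)" "w x = \<sigma> * u (- x)" using left[of x] by blast+
    moreover have "w (- x) = dec_w E (- x - \<delta>)" "u (- x) = dec_u E (- x - \<delta>)" using right[of "- x"] False
        by auto
    ultimately show ?thesis using False by (simp add: glued_u_def glued_w_def)
  qed
  then have "u = glued_u \<sigma> E \<delta>" "w = glued_w \<sigma> E \<delta>" by blast+
  then show ?thesis using uw(1) by simp
qed

lemma two_wall_decay:
  assumes \<sigma>: "\<sigma>\<^sup>2 = 1" and E: "\<bar>E\<bar> < k" and bc: "matching \<sigma> E \<delta>"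
  shows "\<exists>C. \<forall>x. \<bar>glued_u \<sigma> E \<delta> x\<bar> \<le> C * exp (- decay_rate k E * \<bar>x\<bar>)"
    and "\<exists>C. \<forall>x. \<bar>glued_w \<sigma> E \<delta> x\<bar> \<le> C * exp (- decay_rate k E * \<bar>x\<bar>)"
proof -
  let ?s = "decay_rate k E" and ?t = "tail_slope k E"
  note g = gap_facts[OF k_pos E]
  define c where "c = exp (- W 1) * exp (?s * (\<delta> + 1))"
  have \<sigma>1: "\<bar>\<sigma>\<bar> = 1" using \<sigma> by (simp add: abs_square_eq_1)
  have h: "\<bar>dec_u E (\<bar>x\<bar> - \<delta>)\<bar> \<le> c * exp (- ?s * \<bar>x\<bar>) \<and> \<bar>dec_w E (\<bar>x\<bar> - \<delta>)\<bar> \<le> c * exp (- ?s * \<bar>x\<bar>)"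
    if "\<bar>x\<bar> \<ge> \<bar>\<delta>\<bar> + 1" for x
  proof -
    have x: "\<bar>x\<bar> - \<delta> \<ge> 1" using that by linarith
    have u: "dec_u E (\<bar>x\<bar> - \<delta>) = c * exp (- ?s * \<bar>x\<bar>)"
      by (simp add: dec_sol_tail(1)[OF E x] c_def exp_add[symmetric] algebra_simps)
    have "\<bar>dec_w E (\<bar>x\<bar> - \<delta>)\<bar> = \<bar>?t\<bar> * \<bar>dec_u E (\<bar>x\<bar> - \<delta>)\<bar>"
      unfolding dec_sol_tail[OF E x] by (simp add: abs_mult)
    also have "\<dots> \<le> 1 * \<bar>dec_u E (\<bar>x\<bar> - \<delta>)\<bar>" using g(7) by (intro mult_right_mono) auto
    finally show ?thesis using u by (simp add: c_def)
  qed
  have "\<bar>glued_u \<sigma> E \<delta> x\<bar> \<le> c * exp (- ?s * \<bar>x\<bar>) \<and> \<bar>glued_w \<sigma> E \<delta> x\<bar> \<le> c * exp (- ?s * \<bar>x\<bar>)"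
    if "\<bar>x\<bar> \<ge> \<bar>\<delta>\<bar> + 1" for x
    using h[OF that] \<sigma>1 by (auto simp: glued_u_def glued_w_def abs_mult)
  then show "\<exists>C. \<forall>x. \<bar>glued_u \<sigma> E \<delta> x\<bar> \<le> C * exp (- ?s * \<bar>x\<bar>)" "\<exists>C. \<forall>x. \<bar>glued_w \<sigma> E \<delta> x\<bar>
      \<le> C * exp (- ?s * \<bar>x\<bar>)"

    using dirac_ode_continuous[OF two_wall_solution[OF \<sigma> bc]]
    by (intro exp_bound_if_outside[where R = "\<bar>\<delta>\<bar> + 1"]; blast)+
qed

lemma two_wall_L2:
  assumes \<sigma>: "\<sigma>\<^sup>2 = 1" and E: "\<bar>E\<bar> < k" and c: "matching \<sigma> E \<delta>"
  shows "integrable lborel (\<lambda>x. (glued_u \<sigma> E \<delta> x)\<^sup>2 + (glued_w \<sigma> E \<delta> x)\<^sup>2)"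
proof -
  note d = two_wall_decay[OF \<sigma> E c]
  obtain C where C: "\<And>x. \<bar>glued_u \<sigma> E \<delta> x\<bar> \<le> C * exp (- decay_rate k E * \<bar>x\<bar>)" using d(1) by blast
  obtain C' where C': "\<And>x. \<bar>glued_w \<sigma> E \<delta> x\<bar> \<le> C' * exp (- decay_rate k E * \<bar>x\<bar>)" using d(2) by blast
  show ?thesis
    by (rule integrable_sum_squares_exp[OF gap_facts(1)[OF k_pos E]
          dirac_ode_continuous[OF two_wall_solution[OF \<sigma> c]] C C'])
qed

lemma two_wall_eigenfunction:
  assumes \<sigma>: "\<sigma>\<^sup>2 = 1" and E: "\<bar>E\<bar> < k" and c: "matching \<sigma> E \<delta>"
  shows "eigenfunction (two_wall \<kappa> \<delta>) E (\<lambda>x. spinor (glued_u \<sigma> E \<delta> x) (glued_w \<sigma> E \<delta> x))"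
  by (rule dirac_ode_eigenfunction[OF two_wall_continuous two_wall_bound two_wall_solution[OF \<sigma> c]
      two_wall_L2[OF assms], of 0])
     (use dec_sol_nonzero[of E "- \<delta>"] in \<open>simp add: glued_u_def glued_w_def\<close>)

text \<open>
  Square integrability at \<open>+\<infinity>\<close> determines the data at \<open>\<delta> + 1\<close> up to a factor.
\<close>

lemma two_wall_right_multiple:
  assumes E: "\<bar>E\<bar> < k" and \<delta>: "\<delta> > 0" and ode: "dirac_ode (two_wall \<kappa> \<delta>) E UNIV u w"
    and L2: "integrable lborel (\<lambda>x. (u x)\<^sup>2 + (w x)\<^sup>2)"
  shows "\<exists>c. \<forall>x\<ge>0. u x = c * dec_u E (x - \<delta>) \<and> w x = c * dec_w E (x - \<delta>)"
proof -
  define a where "a = \<delta> + 1"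
  have wa: "w a = - tail_slope k E * u a"
    by (rule dirac_ode_L2_tail[OF k_pos E _ dirac_ode_mono[OF ode] L2])
       (use \<delta> in \<open>auto simp: two_wall_abs kappa_right a_def\<close>)
  define c where "c = u a / exp (- W 1)"
  have s: "dirac_ode (two_wall \<kappa> \<delta>) E {0..} (\<lambda>x. c * dec_u E (x - \<delta>)) (\<lambda>x. c * dec_w E (x - \<delta>))"
    using dirac_ode_linear[OF dec_sol_shift dec_sol_shift, of \<delta> E c 0] by simp
  have "u x = c * dec_u E (x - \<delta>) \<and> w x = c * dec_w E (x - \<delta>)" if "x \<ge> 0" for x
    by (rule dirac_ode_unique[OF _ dirac_ode_mono[OF ode] s two_wall_bound, of a x])
       (use that \<delta> wa in \<open>auto simp: is_interval_ci a_def dec_u_1 dec_w_1 c_def\<close>)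
  then show ?thesis by blast
qed

text \<open>
  A square integrable solution and its mirror image are multiples \<open>c\<close> and \<open>c'\<close> of the same decaying
  solution on the right half line. With \<open>(p, q)\<close> its midpoint data, \<open>c p = c' q\<close> and \<open>c q = c' p\<close>,
  which forces \<open>p = q\<close> or \<open>p = - q\<close> unless both factors vanish.
\<close>

lemma two_wall_classification:
  assumes E: "\<bar>E\<bar> < k" and \<delta>: "\<delta> > 0" and ode: "dirac_ode (two_wall \<kappa> \<delta>) E UNIV u w"
    and L2: "integrable lborel (\<lambda>x. (u x)\<^sup>2 + (w x)\<^sup>2)"
  shows "(\<forall>x. u x = 0 \<and> w x = 0) \<or> matching 1 E \<delta> \<or> matching (-1) E \<delta>"
    and "\<sigma>\<^sup>2 = 1 \<Longrightarrow> matching \<sigma> E \<delta> \<Longrightarrow> \<exists>c. \<forall>x. u x = c * glued_u \<sigma> E \<delta> x \<and> w x = c * glued_w \<sigma> E \<delta> x"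
proof -
  let ?m = "two_wall \<kappa> \<delta>"
  obtain c where c: "\<And>x. x \<ge> 0 \<Longrightarrow> u x = c * dec_u E (x - \<delta>) \<and> w x = c * dec_w E (x - \<delta>)"
    using two_wall_right_multiple[OF E \<delta> ode L2] by blast
  have ode': "dirac_ode ?m E UNIV (\<lambda>x. w (- x)) (\<lambda>x. u (- x))"
    using dirac_ode_reflect[OF ode two_wall_even] surj_uminus_real by simp
  have L2': "integrable lborel (\<lambda>x. (w (- x))\<^sup>2 + (u (- x))\<^sup>2)"
    using lborel_integrable_real_affine[OF L2, of "-1" 0] by (simp add: add.commute)
  obtain c' where c': "\<And>x. x \<ge> 0 \<Longrightarrow> w (- x) = c' * dec_u E (x - \<delta>) \<and> u (- x) = c' * dec_w E (x - \<delta>)"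
    using two_wall_right_multiple[OF E \<delta> ode' L2'] by blast
  define p q where "p = dec_u E (- \<delta>)" "q = dec_w E (- \<delta>)"
  note pq = this
  have nz: "p\<^sup>2 + q\<^sup>2 > 0" unfolding pq by (rule dec_sol_nonzero)
  have e: "c * p = c' * q" "c * q = c' * p"
    using c[of 0] c'[of 0] by (simp_all add: pq)
  show "(\<forall>x. u x = 0 \<and> w x = 0) \<or> matching 1 E \<delta> \<or> matching (-1) E \<delta>"
  proof (cases "c = 0 \<and> c' = 0")
    case True
    then have "u x = 0 \<and> w x = 0" for x
      using c[of x] c'[of "- x"] by (cases "x \<ge> 0") auto
    then show ?thesis by blast
  next
    case False
    have "(c - c') * (p + q) = 0" "(c + c') * (p - q) = 0"
      using e by (simp_all add: algebra_simps)
    then have "p + q = 0 \<or> p - q = 0" using False by auto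
    then show ?thesis by (auto simp: matching_def pq)
  qed
  show "\<exists>c. \<forall>x. u x = c * glued_u \<sigma> E \<delta> x \<and> w x = c * glued_w \<sigma> E \<delta> x" if \<sigma>: "\<sigma>\<^sup>2 = 1" and b: "matching \<sigma> E \<delta>"
  proof -
    have q: "q = \<sigma> * p" using b by (simp add: matching_def pq)
    then have p: "p \<noteq> 0" using nz by auto
    have ss: "\<sigma> * \<sigma> = 1" using \<sigma> by (simp add: power2_eq_square)
    have "c * \<sigma> * p = c' * p" using e(2) q by simp
    then have cc: "c' = c * \<sigma>" using p by simp
    have "u x = c * glued_u \<sigma> E \<delta> x \<and> w x = c * glued_w \<sigma> E \<delta> x" for x
      using c[of x] c'[of "- x"] by (cases "x \<ge> 0") (auto simp: glued_u_def glued_w_def cc)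
    then show ?thesis by blast
  qed
qed

lemma two_wall_eigenvalue_iff:
  assumes E: "\<bar>E\<bar> < k" and \<delta>: "\<delta> > 0"
  shows "eigenvalue (two_wall \<kappa> \<delta>) E \<longleftrightarrow> matching 1 E \<delta> \<or> matching (-1) E \<delta>"
proof
  assume "eigenvalue (two_wall \<kappa> \<delta>) E"
  then obtain f where f: "eigenfunction (two_wall \<kappa> \<delta>) E f" by (auto simp: eigenvalue_def)
  obtain u w u' w' where *: "dirac_ode (two_wall \<kappa> \<delta>) E UNIV u w" "dirac_ode (two_wall \<kappa> \<delta>) E UNIV u' w'"
      "integrable lborel (\<lambda>x. (u x)\<^sup>2 + (w x)\<^sup>2)" "integrable lborel (\<lambda>x. (u' x)\<^sup>2 + (w' x)\<^sup>2)"
      "AE x in lborel. f x = spinor (u x) (w x) + \<i> *s spinor (u' x) (w' x)"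
    using eigenfunction_ode[OF two_wall_continuous f] by blast
  show "matching 1 E \<delta> \<or> matching (-1) E \<delta>"
  proof (rule ccontr)
    assume n: "\<not> ?thesis"
    have "u x = 0" "w x = 0" "u' x = 0" "w' x = 0" for x
      using two_wall_classification(1)[OF E \<delta> *(1,3)] two_wall_classification(1)[OF E \<delta> *(2,4)] n by auto
    then have "AE x in lborel. f x = 0" using *(5) by (simp add: spinor_def)
    then show False using f by (simp add: eigenfunction_def)
  qed
next
  assume "matching 1 E \<delta> \<or> matching (-1) E \<delta>"
  then show "eigenvalue (two_wall \<kappa> \<delta>) E"
    using two_wall_eigenfunction[OF _ E, of 1 \<delta>] two_wall_eigenfunction[OF _ E, of "-1" \<delta>]
    unfolding eigenvalue_def by fastforce
qed

lemma two_wall_simple: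
  assumes \<sigma>: "\<sigma>\<^sup>2 = 1" and E: "\<bar>E\<bar> < k" and c: "matching \<sigma> E \<delta>" and \<delta>: "\<delta> > 0"
  shows "simple_eigenvalue (two_wall \<kappa> \<delta>) E"
  unfolding simple_eigenvalue_def
proof (rule exI, intro conjI allI impI)
  let ?f = "\<lambda>x. spinor (glued_u \<sigma> E \<delta> x) (glued_w \<sigma> E \<delta> x)"
  show "eigenfunction (two_wall \<kappa> \<delta>) E ?f" by (rule two_wall_eigenfunction[OF \<sigma> E c])
  fix f assume f: "eigenfunction (two_wall \<kappa> \<delta>) E f"
  obtain u w u' w' where *: "dirac_ode (two_wall \<kappa> \<delta>) E UNIV u w" "dirac_ode (two_wall \<kappa> \<delta>) E UNIV u' w'"
      "integrable lborel (\<lambda>x. (u x)\<^sup>2 + (w x)\<^sup>2)" "integrable lborel (\<lambda>x. (u' x)\<^sup>2 + (w' x)\<^sup>2)"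
      "AE x in lborel. f x = spinor (u x) (w x) + \<i> *s spinor (u' x) (w' x)"
    using eigenfunction_ode[OF two_wall_continuous f] by blast
  obtain a where a: "\<And>x. u x = a * glued_u \<sigma> E \<delta> x \<and> w x = a * glued_w \<sigma> E \<delta> x"
    using two_wall_classification(2)[OF E \<delta> *(1,3) \<sigma> c] by blast
  obtain b where b: "\<And>x. u' x = b * glued_u \<sigma> E \<delta> x \<and> w' x = b * glued_w \<sigma> E \<delta> x"
    using two_wall_classification(2)[OF E \<delta> *(2,4) \<sigma> c] by blast
  have "AE x in lborel. f x = Complex a b *s ?f x"
    using *(5)
  proof eventually_elim
    case (elim x)
    show ?case unfolding elim vec2_eq_iff using a[of x] b[of x]
      by (simp add: complex_eq_iff algebra_simps)
  qed
  then show "\<exists>c. AE x in lborel. f x = c *s ?f x" by blast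
qed

text \<open>
  For a sign \<open>\<sigma>\<close> the combination \<open>w - \<sigma> u\<close> of the two modes factors, with \<open>1 - \<sigma> t \<noteq> 0\<close> as a common
  factor. The length \<open>\<delta> - 1\<close> is the distance from the midpoint to the wall region.
\<close>

lemma matching_iff:
  assumes \<sigma>: "\<sigma>\<^sup>2 = 1" and E: "\<bar>E\<bar> < k" and \<delta>: "\<delta> > 1"
  shows "matching \<sigma> E \<delta> \<longleftrightarrow> leak_amp E = \<sigma> * bound_amp E * exp (- 2 * decay_rate k E * (\<delta> - 1))"
proof -
  let ?s = "decay_rate k E" and ?t = "tail_slope k E"
  note g = gap_facts[OF k_pos E]
  have t2: "1 - ?t\<^sup>2 \<noteq> 0" using g(8) by simp
  have \<sigma>1: "\<bar>\<sigma>\<bar> = 1" using \<sigma> by (simp add: abs_square_eq_1)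
  have "\<bar>\<sigma> * ?t\<bar> < 1" using g(7) \<sigma>1 by (simp add: abs_mult)
  then have st: "1 - \<sigma> * ?t \<noteq> 0" by auto
  have ss: "\<sigma> * \<sigma> = 1" using \<sigma> by (simp add: power2_eq_square)
  define p where "p = bound_amp E * exp (?s * (- \<delta> + 1))"
  define q where "q = leak_amp E * exp (- ?s * (- \<delta> + 1))"
  have "dec_w E (- \<delta>) - \<sigma> * dec_u E (- \<delta>) = ((?t * p + q) - \<sigma> * (p + ?t * q)) / (1 - ?t\<^sup>2)"
    using dec_sol_left[OF E, of "- \<delta>"] \<delta> by (simp add: p_def q_def diff_divide_distrib)
  also have "(?t * p + q) - \<sigma> * (p + ?t * q) = (1 - \<sigma> * ?t) * (q - \<sigma> * p)"
  proof -
    have "(1 - \<sigma> * ?t) * (q - \<sigma> * p) = q - \<sigma> * p - \<sigma> * ?t * q + (\<sigma> * \<sigma>) * (?t * p)"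
      by (simp add: algebra_simps)
    then show ?thesis by (simp add: ss algebra_simps)
  qed
  finally have "matching \<sigma> E \<delta> \<longleftrightarrow> q = \<sigma> * p"
    using t2 st by (auto simp: matching_def)
  also have "\<dots> \<longleftrightarrow> q * exp (- ?s * (\<delta> - 1)) = \<sigma> * p * exp (- ?s * (\<delta> - 1))" by simp
  also have "q * exp (- ?s * (\<delta> - 1)) = leak_amp E"
    by (simp add: q_def mult.assoc exp_add[symmetric] algebra_simps)
  also have "\<sigma> * p * exp (- ?s * (\<delta> - 1)) = \<sigma> * bound_amp E * exp (- 2 * ?s * (\<delta> - 1))"
    by (simp add: p_def mult.assoc exp_add[symmetric] algebra_simps)
  finally show ?thesis .
qed

end

section \<open>Existence and size of the bound state energies\<close>

lemma exp_eventually_small: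
  assumes "\<epsilon> > 0" "\<mu> > (0::real)"
  shows "\<exists>D\<ge>1. \<forall>\<delta>>D. exp (- \<mu> * (\<delta> - 1)) < \<epsilon>"
proof (intro exI[of _ "1 + \<bar>ln \<epsilon>\<bar> / \<mu>"] conjI allI impI)
  fix \<delta> assume "\<delta> > 1 + \<bar>ln \<epsilon>\<bar> / \<mu>"
  then have "\<bar>ln \<epsilon>\<bar> < \<mu> * (\<delta> - 1)" using assms(2) by (simp add: field_simps)
  then have "- \<mu> * (\<delta> - 1) < ln \<epsilon>" by linarith
  then have "exp (- \<mu> * (\<delta> - 1)) < exp (ln \<epsilon>)" by (simp only: exp_less_cancel_iff)
  then show "exp (- \<mu> * (\<delta> - 1)) < \<epsilon>" using assms(1) by simp
qed (use assms in auto)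

lemma linear_times_exp_bound:
  assumes "\<mu> > (0::real)"
  shows "x * exp (- \<mu> * x) \<le> 1 / \<mu>"
proof -
  have "\<mu> * x \<le> exp (\<mu> * x)" using exp_ge_add_one_self[of "\<mu> * x"] by linarith
  then have "\<mu> * x * exp (- \<mu> * x) \<le> exp (\<mu> * x) * exp (- \<mu> * x)" by (rule mult_right_mono) simp
  then have "\<mu> * (x * exp (- \<mu> * x)) \<le> 1" by (simp add: exp_add[symmetric] mult.assoc)
  then show ?thesis using assms by (simp add: field_simps)
qed

text \<open>
  A change of the rate of an exponential costs the change times the length, and half of the decay
  absorbs the length.
\<close>

lemma exp_rate_diff:
  assumes "0 < s" "s \<le> k" "0 \<le> (a::real)"
  shows "\<bar>exp (- s * a) - exp (- k * a)\<bar> \<le> (k - s) * (2 / s) * exp (- s / 2 * a)"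
proof -
  have le: "exp (- k * a) \<le> exp (- s * a)" using assms by (simp add: mult_right_mono)
  have "exp (- s * a) - exp (- k * a) = exp (- s * a) * (1 - exp (- ((k - s) * a)))"
    by (simp add: algebra_simps exp_add[symmetric])
  also have "\<dots> \<le> exp (- s * a) * ((k - s) * a)"
    using exp_ge_add_one_self[of "- ((k - s) * a)"] by (intro mult_left_mono) auto
  also have "\<dots> = (k - s) * (a * exp (- (s / 2) * a)) * exp (- s / 2 * a)"
  proof -
    have "exp (- s * a) = exp (- (s / 2) * a) * exp (- s / 2 * a)"
      by (simp add: exp_add[symmetric] algebra_simps)
    then show ?thesis by simp
  qed
  also have "\<dots> \<le> (k - s) * (1 / (s / 2)) * exp (- s / 2 * a)"
    using assms by (intro mult_right_mono mult_left_mono linear_times_exp_bound) auto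
  finally show ?thesis using le by simp
qed

text \<open>
  The setting of the theorem: a wall with spectral gap and a compact interval \<open>[-K, K]\<close> inside the
  gap.
\<close>

locale gapped_domain_wall = domain_wall +
  fixes K :: real
  assumes gap: "spectral_gap \<kappa> k" and K_pos: "K > 0" and K_less: "K < k"
begin

lemma in_gap: "\<bar>E\<bar> \<le> K \<Longrightarrow> \<bar>E\<bar> < k"
  using K_less by simp

lemma exp_W_lower: "\<exists>m>0. \<forall>y\<in>{-1..1}. m \<le> exp (- W y)"
proof -
  have "\<exists>x\<in>{-1..1}. \<forall>y\<in>{-1..1}. exp (- W x) \<le> exp (- W y)"
    by (intro continuous_attains_inf continuous_intros W_continuous) auto
  then show ?thesis by (metis exp_gt_zero)
qed

text \<open>
  For small positive \<open>E\<close> the component \<open>u\<close> is positive on the wall. So \<open>exp (- W) w\<close> increases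
  there, up to a nonpositive value at \<open>1\<close>, and \<open>w\<close> is nonpositive at \<open>- 1\<close>; the term \<open>- t u\<close> then
  makes the amplitude at most a negative multiple of \<open>E\<close>.
\<close>

lemma leak_amp_negative_near_zero:
  "\<exists>\<eta>>0. \<exists>c>0. \<forall>E. 0 \<le> E \<longrightarrow> E \<le> \<eta> \<longrightarrow> leak_amp E \<le> - c * E"
proof -
  obtain C where C: "C > 0" "\<And>E y. \<bar>E\<bar> < k \<Longrightarrow> y \<in> {-1..1} \<Longrightarrow>
     \<bar>dec_u E y - exp (- W y)\<bar> \<le> C * \<bar>E\<bar> \<and> \<bar>dec_w E y\<bar> \<le> C * \<bar>E\<bar>"
    using dec_sol_near_zero_energy by blast
  obtain m where m: "m > 0" "\<And>y. y \<in> {-1..1} \<Longrightarrow> m \<le> exp (- W y)" using exp_W_lower by blast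
  define \<eta> where "\<eta> = min K (m / (2 * C))"
  have \<eta>: "\<eta> > 0" using K_pos m(1) C(1) by (simp add: \<eta>_def)
  have "leak_amp E \<le> - (m / (4 * k)) * E" if E: "0 \<le> E" "E \<le> \<eta>" for E
  proof -
    let ?t = "tail_slope k E"
    have Ek: "\<bar>E\<bar> < k" using E K_less by (simp add: \<eta>_def)
    note g = gap_facts[OF k_pos Ek]
    have "C * E \<le> m / 2" using E C(1) by (simp add: \<eta>_def field_simps)
    then have u: "dec_u E y \<ge> m / 2" if "y \<in> {-1..1}" for y
      using C(2)[OF Ek that] m(2)[OF that] E(1) by (simp add: abs_le_iff)
    have t0: "?t \<ge> 0" using E(1) g(1) k_pos by (simp add: tail_slope_def)
    then have tE: "E / (2 * k) \<le> ?t" using g(10) k_pos E(1) by (simp add: field_simps)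
    have "exp (- W (-1)) * dec_w E (-1) \<le> exp (- W 1) * dec_w E 1"
      by (rule DERIV_nondecreasing[OF _ weighted_w_deriv])
         (use E(1) u m(1) in \<open>auto intro!: mult_nonneg_nonneg intro: order_trans[of 0 "m/2"]\<close>)
    also have "\<dots> \<le> 0" using t0 by (simp add: dec_w_1 mult_nonneg_nonneg)
    finally have "dec_w E (-1) \<le> 0" by (simp add: mult_le_0_iff)
    then have "leak_amp E \<le> - (?t * dec_u E (-1))" by (simp add: leak_amp_def)
    also have "\<dots> \<le> - (E / (2 * k) * (m / 2))"
      using mult_mono[OF tE u[of "-1"]] t0 m(1) by simp
    finally show ?thesis by (simp add: mult.commute)
  qed
  moreover have "m / (4 * k) > 0" using m(1) k_pos by simp
  ultimately show ?thesis using \<eta> by blast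
qed

text \<open>
  The sign near \<open>0\<close> persists on the whole of \<open>(0, K]\<close>, as the amplitude is continuous and has no
  zero there by the spectral gap; compactness then gives the linear bound. Negative energies follow
  by oddness.
\<close>

lemma leak_amp_sign:
  "\<exists>c>0. \<forall>E. 0 \<le> E \<longrightarrow> E \<le> K \<longrightarrow> leak_amp E \<le> - c * E"
proof -
  obtain \<eta> c where \<eta>: "\<eta> > 0" and c: "c > 0" "\<And>E. 0 \<le> E \<Longrightarrow> E \<le> \<eta> \<Longrightarrow> leak_amp E \<le> - c * E"
    using leak_amp_negative_near_zero by blast
  define a where "a = min \<eta> K"
  have a: "a > 0" "a \<le> K" "a \<le> \<eta>" using \<eta> K_pos by (auto simp: a_def)
  have cont: "continuous_on {a..K} leak_amp"
    using a by (intro continuous_on_subset[OF amp_continuous(2)[OF K_less]]) auto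
  have na: "leak_amp a < 0"
  proof -
    have "leak_amp a \<le> - c * a" using c(2)[of a] a by simp
    also have "\<dots> < 0" using c(1) a(1) by simp
    finally show ?thesis .
  qed
  have neg: "leak_amp E < 0" if E: "a \<le> E" "E \<le> K" for E
  proof (rule ccontr)
    assume "\<not> leak_amp E < 0"
    then have "\<exists>x. a \<le> x \<and> x \<le> E \<and> leak_amp x = 0"
      using na E by (intro IVT') (auto intro: continuous_on_subset[OF cont])
    then obtain x where x: "a \<le> x" "x \<le> E" "leak_amp x = 0" by blast
    then show False using leak_amp_nonzero[OF gap, of x] E a(1) K_less by simp
  qed
  obtain x where x: "x \<in> {a..K}" "\<And>y. y \<in> {a..K} \<Longrightarrow> leak_amp y \<le> leak_amp x"
    using continuous_attains_sup[OF _ _ cont] a(2) by auto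
  define c' where "c' = min c (- leak_amp x / K)"
  have x0: "leak_amp x < 0" using neg x(1) by auto
  have "c' > 0" using c(1) x0 K_pos by (simp add: c'_def divide_neg_pos)
  moreover have "leak_amp E \<le> - c' * E" if E: "0 \<le> E" "E \<le> K" for E
  proof (cases "E \<le> a")
    case True
    have "leak_amp E \<le> - c * E" using c(2) True a(3) E(1) by simp
    also have "\<dots> \<le> - c' * E" using E(1) by (simp add: c'_def mult_right_mono)
    finally show ?thesis .
  next
    case False
    have "c' * E \<le> (- leak_amp x / K) * E" using E(1) by (intro mult_right_mono) (auto simp: c'_def)
    also have "\<dots> \<le> (- leak_amp x / K) * K"
      using E(2) x0 K_pos by (intro mult_left_mono) (auto simp: divide_nonpos_pos)
    also have "\<dots> = - leak_amp x" using K_pos by simp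
    finally show ?thesis using x(2)[of E] False E(2) by simp
  qed
  ultimately show ?thesis by blast
qed

lemma bound_amp_bound: "\<exists>B>0. \<forall>E. \<bar>E\<bar> \<le> K \<longrightarrow> \<bar>bound_amp E\<bar> \<le> B"
proof -
  have "bounded (bound_amp ` {-K..K})"
    by (intro compact_imp_bounded compact_continuous_image amp_continuous K_less) auto
  then obtain B where B: "\<And>y. y \<in> {-K..K} \<Longrightarrow> \<bar>bound_amp y\<bar> \<le> B"
    unfolding bounded_iff by (metis imageI real_norm_def)
  have "\<bar>bound_amp E\<bar> \<le> \<bar>B\<bar> + 1" if "\<bar>E\<bar> \<le> K" for E
    using B[of E] that by (auto simp: abs_le_iff)
  then show ?thesis by (intro exI[of _ "\<bar>B\<bar> + 1"]) auto
qed

lemma decay_rate_mono: "\<bar>E\<bar> \<le> K \<Longrightarrow> decay_rate k K \<le> decay_rate k E"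
  unfolding decay_rate_def using abs_le_square_iff[of E K] K_pos by simp

text \<open>
  At \<open>E = K\<close> and \<open>E = - K\<close> the amplitude \<open>leak_amp\<close> has opposite signs and dominates the
  exponentially small right-hand side of the matching condition.
\<close>

lemma bound_states_exist:
  "\<exists>D\<ge>1. \<forall>\<delta>>D. \<forall>\<sigma>. \<sigma>\<^sup>2 = 1 \<longrightarrow> (\<exists>E. \<bar>E\<bar> \<le> K \<and> matching \<sigma> E \<delta>)"
proof -
  obtain c where c: "c > 0" "\<And>E. 0 \<le> E \<Longrightarrow> E \<le> K \<Longrightarrow> leak_amp E \<le> - c * E" using leak_amp_sign by blast
  obtain B where B: "B > 0" "\<And>E. \<bar>E\<bar> \<le> K \<Longrightarrow> \<bar>bound_amp E\<bar> \<le> B" using bound_amp_bound by blast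
  let ?sK = "decay_rate k K"
  have sK: "?sK > 0" using gap_facts(1)[OF k_pos in_gap[of K]] K_pos by simp
  obtain D where D: "D \<ge> 1" "\<And>\<delta>. \<delta> > D \<Longrightarrow> exp (- (2 * ?sK) * (\<delta> - 1)) < c * K / B"
    using exp_eventually_small[of "c * K / B" "2 * ?sK"] c(1) K_pos B(1) sK by auto
  have "\<exists>E. \<bar>E\<bar> \<le> K \<and> matching \<sigma> E \<delta>" if \<delta>: "\<delta> > D" and \<sigma>: "\<sigma>\<^sup>2 = 1" for \<delta> \<sigma>
  proof -
    have \<sigma>1: "\<bar>\<sigma>\<bar> = 1" using \<sigma> by (simp add: abs_square_eq_1)
    let ?r = "\<lambda>E. \<sigma> * bound_amp E * exp (- 2 * decay_rate k E * (\<delta> - 1))"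
    let ?h = "\<lambda>E. leak_amp E - ?r E"
    have cont: "continuous_on {-K..K} ?h"
      by (intro continuous_intros amp_continuous K_less tail_slope_continuous)
    have r: "\<bar>?r E\<bar> < c * K" if "\<bar>E\<bar> = K" for E
    proof -
      have s: "decay_rate k E = ?sK" using that by (simp add: decay_rate_def flip: power2_abs[of E])
      have "\<bar>?r E\<bar> = \<bar>bound_amp E\<bar> * exp (- (2 * ?sK) * (\<delta> - 1))" by (simp add: abs_mult \<sigma>1 s)
      also have "\<dots> \<le> B * exp (- (2 * ?sK) * (\<delta> - 1))" using B(2) that by (intro mult_right_mono) auto
      also have "\<dots> < B * (c * K / B)" using D(2)[OF \<delta>] B(1) by (intro mult_strict_left_mono) auto
      finally show ?thesis using B(1) by simp
    qed
    have "?h K \<le> 0" using c(2)[of K] r[of K] K_pos by (simp add: abs_less_iff)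
    moreover have "?h (-K) \<ge> 0" using c(2)[of K] r[of "-K"] K_pos by (simp add: abs_less_iff leak_amp_uminus)
    ultimately have "\<exists>x\<ge>-K. x \<le> K \<and> ?h x = 0"
      using IVT2'[of ?h K 0 "-K"] cont K_pos by auto
    then obtain E where E: "-K \<le> E" "E \<le> K" "?h E = 0" by blast
    then have Ek: "\<bar>E\<bar> \<le> K" by simp
    then have "matching \<sigma> E \<delta>"
      using matching_iff[OF \<sigma> in_gap[OF Ek], of \<delta>] E(3) \<delta> D(1) by simp
    then show ?thesis using Ek by blast
  qed
  then show ?thesis using D(1) by blast
qed

text \<open>
  The matching condition first gives \<open>E = O(exp (- 2 s(K) \<delta>))\<close> with the rate at the end of the
  interval. As \<open>k - s\<close> is quadratic in \<open>E\<close>, the product \<open>(k - s) \<delta>\<close> is then bounded, which improves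
  the rate to \<open>k\<close>.
\<close>

lemma bound_state_energy_small:
  "\<exists>C>0. \<forall>\<delta>>1. \<forall>\<sigma> E. \<sigma>\<^sup>2 = 1 \<longrightarrow> \<bar>E\<bar> \<le> K \<longrightarrow> matching \<sigma> E \<delta> \<longrightarrow> \<bar>E\<bar> \<le> C * exp (- 2 * k * \<delta>)"
proof -
  obtain c where c: "c > 0" "\<And>E. 0 \<le> E \<Longrightarrow> E \<le> K \<Longrightarrow> leak_amp E \<le> - c * E" using leak_amp_sign by blast
  obtain B where B: "B > 0" "\<And>E. \<bar>E\<bar> \<le> K \<Longrightarrow> \<bar>bound_amp E\<bar> \<le> B" using bound_amp_bound by blast
  let ?sK = "decay_rate k K"
  have sK: "?sK > 0" using gap_facts(1)[OF k_pos in_gap[of K]] K_pos by simp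
  define a where "a = 2 / k * ((B / c)\<^sup>2 * (1 / (4 * ?sK)))"
  have "\<bar>E\<bar> \<le> (B / c * exp a * exp (2 * k)) * exp (- 2 * k * \<delta>)"
    if \<delta>: "\<delta> > 1" and \<sigma>: "\<sigma>\<^sup>2 = 1" and E: "\<bar>E\<bar> \<le> K" and b: "matching \<sigma> E \<delta>" for \<delta> \<sigma> E
  proof -
    let ?s = "decay_rate k E"
    note g = gap_facts[OF k_pos in_gap[OF E]]
    have \<sigma>1: "\<bar>\<sigma>\<bar> = 1" using \<sigma> by (simp add: abs_square_eq_1)
    have "c * \<bar>E\<bar> \<le> \<bar>leak_amp E\<bar>"
      using c(2)[of E] c(2)[of "- E"] E by (cases "E \<ge> 0") (auto simp: leak_amp_uminus)
    also have "leak_amp E = \<sigma> * bound_amp E * exp (- 2 * ?s * (\<delta> - 1))"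
      using matching_iff[OF \<sigma> in_gap[OF E] \<delta>] b by simp
    also have "\<bar>\<sigma> * bound_amp E * exp (- 2 * ?s * (\<delta> - 1))\<bar> = \<bar>bound_amp E\<bar> * exp (- 2 * ?s * (\<delta> - 1))"
      by (simp add: abs_mult \<sigma>1)
    also have "\<dots> \<le> B * exp (- 2 * ?s * (\<delta> - 1))" by (intro mult_right_mono B E) auto
    finally have E1: "\<bar>E\<bar> \<le> B / c * exp (- 2 * ?s * (\<delta> - 1))"
      using c(1) by (simp add: field_simps)
    also have "\<dots> \<le> B / c * exp (- 2 * ?sK * (\<delta> - 1))"
      using B(1) c(1) decay_rate_mono[OF E] \<delta> by (intro mult_left_mono) (auto simp: mult_right_mono)
    finally have "\<bar>E\<bar>\<^sup>2 \<le> (B / c * exp (- 2 * ?sK * (\<delta> - 1)))\<^sup>2" by (intro power_mono) auto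
    also have "(B / c * exp (- 2 * ?sK * (\<delta> - 1)))\<^sup>2 = (B / c)\<^sup>2 * exp (2 * (- 2 * ?sK * (\<delta> - 1)))"
      by (simp only: power_mult_distrib exp_double)
    also have "2 * (- 2 * ?sK * (\<delta> - 1)) = - (4 * ?sK) * (\<delta> - 1)" by simp
    finally have E2: "E\<^sup>2 \<le> (B / c)\<^sup>2 * exp (- (4 * ?sK) * (\<delta> - 1))" by simp
    have "2 * (k - ?s) * (\<delta> - 1) \<le> 2 * (E\<^sup>2 / k) * (\<delta> - 1)"
      using g(11) \<delta> by (intro mult_right_mono) auto
    also have "\<dots> = 2 / k * (E\<^sup>2 * (\<delta> - 1))" by simp
    also have "\<dots> \<le> 2 / k * ((B / c)\<^sup>2 * exp (- (4 * ?sK) * (\<delta> - 1)) * (\<delta> - 1))"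
      using E2 \<delta> k_pos by (intro mult_left_mono mult_right_mono) auto
    also have "\<dots> = 2 / k * ((B / c)\<^sup>2 * ((\<delta> - 1) * exp (- (4 * ?sK) * (\<delta> - 1))))" by simp
    also have "\<dots> \<le> a" unfolding a_def
      using k_pos sK by (intro mult_left_mono linear_times_exp_bound) auto
    finally have "- 2 * ?s * (\<delta> - 1) \<le> a + 2 * k - 2 * k * \<delta>" by (simp add: algebra_simps)
    then have "B / c * exp (- 2 * ?s * (\<delta> - 1)) \<le> B / c * exp (a + 2 * k - 2 * k * \<delta>)"
      using B(1) c(1) by (intro mult_left_mono) auto
    also have "\<dots> = (B / c * exp a * exp (2 * k)) * exp (- 2 * k * \<delta>)"
      by (simp add: mult.assoc exp_add[symmetric])
    finally show ?thesis using E1 by linarith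
  qed
  moreover have "B / c * exp a * exp (2 * k) > 0" using B(1) c(1) by simp
  ultimately show ?thesis by blast
qed

end

section \<open>Uniqueness and comparison with the zero modes\<close>

lemma energy_of_tail_slope:
  assumes "k > 0" "\<bar>E\<bar> < k"
  shows "E = 2 * k * (tail_slope k E / (1 + (tail_slope k E)\<^sup>2))"
proof -
  let ?t = "tail_slope k E" and ?s = "decay_rate k E"
  note g = gap_facts[OF assms]
  have "E * (1 + ?t\<^sup>2) = E + ?t * (E * ?t)" by (simp add: power2_eq_square algebra_simps)
  also have "\<dots> = ?t * (k + ?s) + ?t * (k - ?s)" using g(4,5) by simp
  also have "\<dots> = 2 * k * ?t" by (simp add: algebra_simps)
  finally have "E * (1 + ?t\<^sup>2) = 2 * k * ?t" .
  moreover have "1 + ?t\<^sup>2 > 0" by (simp add: add_pos_nonneg)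
  ultimately have "E = 2 * k * ?t / (1 + ?t\<^sup>2)" by (simp add: nonzero_eq_divide_eq)
  then show ?thesis by simp
qed

text \<open>
  The inverse function \<open>t \<mapsto> 2 k t / (1 + t\<^sup>2)\<close> is increasing on \<open>(- 1, 1)\<close>.
\<close>

lemma tail_slope_strict_mono:
  assumes "k > 0" and E: "\<bar>E\<bar> < k" "\<bar>E'\<bar> < k" "E < E'"
  shows "tail_slope k E < tail_slope k E'"
proof (rule ccontr)
  let ?t = "tail_slope k E" and ?t' = "tail_slope k E'"
  assume "\<not> ?thesis"
  then have tt: "?t' \<le> ?t" by simp
  have "\<bar>?t' * ?t\<bar> \<le> 1 * 1"
    unfolding abs_mult using gap_facts(7)[OF assms(1) E(1)] gap_facts(7)[OF assms(1) E(2)]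
    by (intro mult_mono) auto
  then have "0 \<le> (?t - ?t') * (1 - ?t' * ?t)" using tt by (intro mult_nonneg_nonneg) (auto simp: abs_le_iff)
  then have "?t' * (1 + ?t\<^sup>2) \<le> ?t * (1 + ?t'\<^sup>2)" by (simp add: algebra_simps power2_eq_square)
  then have "?t' / (1 + ?t'\<^sup>2) \<le> ?t / (1 + ?t\<^sup>2)"
    by (subst frac_le_eq) (auto simp: add_pos_nonneg add_nonneg_eq_0_iff divide_le_0_iff algebra_simps)
  then have "2 * k * (?t' / (1 + ?t'\<^sup>2)) \<le> 2 * k * (?t / (1 + ?t\<^sup>2))"
    using assms(1) by (intro mult_left_mono) auto
  then have "E' \<le> E"
    using energy_of_tail_slope[OF assms(1) E(1)] energy_of_tail_slope[OF assms(1) E(2)] by simp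
  then show False using E(3) by simp
qed

context gapped_domain_wall
begin

text \<open>
  The smallness of all parameters of a bound state, with a common constant. It is kept in one
  statement because the later estimates use most of the parts for the same \<open>C\<close> and \<open>\<delta>\<close>.
\<close>

lemma bound_state_facts:
  "\<exists>C>0. \<exists>D\<ge>1. \<forall>\<delta>>D. \<forall>\<sigma> E. \<sigma>\<^sup>2 = 1 \<longrightarrow> \<bar>E\<bar> \<le> K \<longrightarrow> matching \<sigma> E \<delta> \<longrightarrow>
     \<bar>E\<bar> \<le> C * exp (- 2 * k * \<delta>) \<and> \<bar>tail_slope k E\<bar> \<le> C * exp (- 2 * k * \<delta>) \<and>
     k - decay_rate k E \<le> C * exp (- 2 * k * \<delta>) \<and>
     (k - decay_rate k E) * (\<delta> - 1) \<le> C * exp (- 2 * k * \<delta>) \<and>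
     C * exp (- 2 * k * \<delta>) \<le> 1 \<and> \<bar>tail_slope k E\<bar> \<le> 1 / 2 \<and>
     k / 2 \<le> decay_rate k E \<and> \<bar>bound_amp E - exp (- W 1)\<bar> \<le> C * exp (- 2 * k * \<delta>) \<and>
     0 < bound_amp E \<and> bound_amp E \<le> C \<and>
     (\<forall>y\<in>{-1..1}. \<bar>dec_u E y - exp (- W y)\<bar> \<le> C * exp (- 2 * k * \<delta>) \<and>
        \<bar>dec_w E y\<bar> \<le> C * exp (- 2 * k * \<delta>) \<and> \<bar>dec_w E y\<bar> \<le> dec_u E y)"
proof -
  obtain C1 where C1: "C1 > 0" "\<And>\<delta> \<sigma> E. \<delta> > 1 \<Longrightarrow> \<sigma>\<^sup>2 = 1 \<Longrightarrow> \<bar>E\<bar> \<le> K \<Longrightarrow> matching \<sigma> E \<delta> \<Longrightarrow> \<bar>E\<bar>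
      \<le> C1 * exp (- 2 * k * \<delta>)"
    using bound_state_energy_small by blast
  obtain C2 where C2: "C2 > 0" "\<And>E y. \<bar>E\<bar> < k \<Longrightarrow> y \<in> {-1..1} \<Longrightarrow>
     \<bar>dec_u E y - exp (- W y)\<bar> \<le> C2 * \<bar>E\<bar> \<and> \<bar>dec_w E y\<bar> \<le> C2 * \<bar>E\<bar>"
    using dec_sol_near_zero_energy by blast
  obtain B where B: "B > 0" "\<And>E. \<bar>E\<bar> \<le> K \<Longrightarrow> \<bar>bound_amp E\<bar> \<le> B" using bound_amp_bound by blast
  obtain m where m: "m > 0" "\<And>y. y \<in> {-1..1} \<Longrightarrow> m \<le> exp (- W y)" using exp_W_lower by blast
  (* Any constant above each of the summands will do. *)
  define C where "C = C1 + C1 / k + C1\<^sup>2 / k + C1\<^sup>2 / (2 * k\<^sup>2) + 2 * C2 * C1 + B"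
  have Cge: "C1 \<le> C" "C1 / k \<le> C" "C1\<^sup>2 / k \<le> C" "C1\<^sup>2 / (2 * k\<^sup>2) \<le> C" "2 * C2 * C1 \<le> C" "B \<le> C" "C2 * C1
      \<le> C"
    using C1(1) C2(1) B(1) k_pos by (simp_all add: C_def)
  have C: "C > 0" using Cge(1) C1(1) by linarith
  (* Small enough that C * eps is below 1, 1/2, k/2 and half of the minimum m of exp (- W) on the wall. *)
  define \<epsilon>0 where "\<epsilon>0 = min (min (1 / C) (1 / (2 * C))) (min (k / (2 * C)) (m / (2 * C)))"
  have \<epsilon>0: "\<epsilon>0 > 0" using C k_pos m(1) by (simp add: \<epsilon>0_def)
  obtain D where D: "D \<ge> 1" "\<And>\<delta>. \<delta> > D \<Longrightarrow> exp (- (2 * k) * (\<delta> - 1)) < \<epsilon>0"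
    using exp_eventually_small[OF \<epsilon>0, of "2 * k"] k_pos by auto
  have main: "\<bar>E\<bar> \<le> C * exp (- 2 * k * \<delta>) \<and> \<bar>tail_slope k E\<bar> \<le> C * exp (- 2 * k * \<delta>) \<and>
     k - decay_rate k E \<le> C * exp (- 2 * k * \<delta>) \<and>
     (k - decay_rate k E) * (\<delta> - 1) \<le> C * exp (- 2 * k * \<delta>) \<and>
     C * exp (- 2 * k * \<delta>) \<le> 1 \<and> \<bar>tail_slope k E\<bar> \<le> 1 / 2 \<and>
     k / 2 \<le> decay_rate k E \<and> \<bar>bound_amp E - exp (- W 1)\<bar> \<le> C * exp (- 2 * k * \<delta>) \<and>
     0 < bound_amp E \<and> bound_amp E \<le> C \<and>
     (\<forall>y\<in>{-1..1}. \<bar>dec_u E y - exp (- W y)\<bar> \<le> C * exp (- 2 * k * \<delta>) \<and>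
        \<bar>dec_w E y\<bar> \<le> C * exp (- 2 * k * \<delta>) \<and> \<bar>dec_w E y\<bar> \<le> dec_u E y)"
    if \<delta>: "\<delta> > D" and \<sigma>: "\<sigma>\<^sup>2 = 1" and E: "\<bar>E\<bar> \<le> K" and b: "matching \<sigma> E \<delta>" for \<delta> \<sigma> E
  proof -
    let ?s = "decay_rate k E" and ?t = "tail_slope k E"
    note Ek = in_gap[OF E]
    note g = gap_facts[OF k_pos Ek]
    define \<epsilon> where "\<epsilon> = exp (- 2 * k * \<delta>)"
    have \<epsilon>: "\<epsilon> > 0" by (simp add: \<epsilon>_def)
    have \<delta>1: "\<delta> > 1" using \<delta> D(1) by simp
    have "\<epsilon> \<le> exp (- (2 * k) * (\<delta> - 1))" unfolding \<epsilon>_def using k_pos by (simp add: algebra_simps)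
    also have "\<dots> < \<epsilon>0" by (rule D(2)[OF \<delta>])
    finally have small: "\<epsilon> \<le> 1 / C" "\<epsilon> \<le> 1 / (2 * C)" "\<epsilon> \<le> k / (2 * C)" "\<epsilon> \<le> m / (2 * C)"
      by (simp_all add: \<epsilon>0_def)
    have E1: "\<bar>E\<bar> \<le> C1 * \<epsilon>" using C1(2)[OF \<delta>1 \<sigma> E b] by (simp add: \<epsilon>_def)
    have up: "x * \<epsilon> \<le> C * \<epsilon>" if "x \<le> C" for x using that \<epsilon> by simp
    have Ce: "C * \<epsilon> \<le> 1" "C * \<epsilon> \<le> 1 / 2" "C * \<epsilon> \<le> k / 2" "C * \<epsilon> \<le> m / 2"
      using small C by (simp_all add: field_simps)
    have \<epsilon>1: "\<epsilon> \<le> 1" using k_pos \<delta>1 by (simp add: \<epsilon>_def mult_le_0_iff)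
    have 1: "\<bar>E\<bar> \<le> C * \<epsilon>" using E1 up[OF Cge(1)] by linarith
    have "\<bar>?t\<bar> \<le> C1 * \<epsilon> / k" using g(9) E1 k_pos by (meson divide_right_mono less_imp_le order_trans)
    then have 2: "\<bar>?t\<bar> \<le> C * \<epsilon>" using up[OF Cge(2)] by simp
    have "\<bar>E\<bar>\<^sup>2 \<le> (C1 * \<epsilon>)\<^sup>2" using E1 by (intro power_mono) auto
    then have E2: "E\<^sup>2 \<le> C1\<^sup>2 * \<epsilon> * \<epsilon>" by (simp add: power_mult_distrib power2_eq_square mult_ac)
    have ks: "k - ?s \<le> C1\<^sup>2 / k * \<epsilon> * \<epsilon>"
    proof -
      have "k - ?s \<le> E\<^sup>2 / k" by (rule g(11))
      also have "\<dots> \<le> C1\<^sup>2 * \<epsilon> * \<epsilon> / k" using E2 k_pos by (simp add: divide_right_mono)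
      finally show ?thesis by simp
    qed
    have "C1\<^sup>2 / k * \<epsilon> * \<epsilon> \<le> C1\<^sup>2 / k * \<epsilon> * 1"
      using \<epsilon> \<epsilon>1 k_pos by (intro mult_left_mono) auto
    then have 3: "k - ?s \<le> C * \<epsilon>" using ks up[OF Cge(3)] by linarith
    have "(k - ?s) * (\<delta> - 1) \<le> C1\<^sup>2 / k * \<epsilon> * \<epsilon> * (\<delta> - 1)"
      using ks \<delta>1 by (intro mult_right_mono) auto
    also have "\<dots> = C1\<^sup>2 / k * \<epsilon> * ((\<delta> - 1) * \<epsilon>)" by simp
    also have "\<dots> \<le> C1\<^sup>2 / k * \<epsilon> * (1 / (2 * k))"
    proof (rule mult_left_mono)
      have "(\<delta> - 1) * \<epsilon> \<le> \<delta> * \<epsilon>" using \<epsilon> by simp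
      also have "\<dots> \<le> 1 / (2 * k)"
        using linear_times_exp_bound[of "2 * k" \<delta>] k_pos by (simp add: \<epsilon>_def)
      finally show "(\<delta> - 1) * \<epsilon> \<le> 1 / (2 * k)" .
    qed (use \<epsilon> k_pos in auto)
    also have "\<dots> = C1\<^sup>2 / (2 * k\<^sup>2) * \<epsilon>" by (simp add: power2_eq_square)
    finally have 4: "(k - ?s) * (\<delta> - 1) \<le> C * \<epsilon>" using up[OF Cge(4)] by linarith
    have 5: "\<bar>?t\<bar> \<le> 1 / 2" using 2 Ce(2) by linarith
    have 6: "k / 2 \<le> ?s" using 3 Ce(3) by linarith
    have C2E: "C2 * \<bar>E\<bar> \<le> C2 * C1 * \<epsilon>" using E1 C2(1) by simp
    have h: "\<bar>dec_u E y - exp (- W y)\<bar> \<le> C2 * C1 * \<epsilon> \<and> \<bar>dec_w E y\<bar> \<le> C2 * C1 * \<epsilon>" if "y \<in> {-1..1}" for y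
      using C2(2)[OF Ek that] C2E by auto
    have h': "\<bar>dec_w E y\<bar> \<le> dec_u E y \<and> dec_u E y > 0" if y: "y \<in> {-1..1}" for y
    proof -
      have "2 * (C2 * C1 * \<epsilon>) \<le> C * \<epsilon>" using up[OF Cge(5)] by simp
      then show ?thesis using h[OF y] m(2)[OF y] Ce(4) m(1) by linarith
    qed
    have "\<bar>?t * dec_w E (-1)\<bar> \<le> 1 * (C2 * C1 * \<epsilon>)"
      unfolding abs_mult using g(7) h[of "-1"] by (intro mult_mono) auto
    moreover have "\<bar>dec_u E (-1) - exp (- W (-1))\<bar> \<le> C2 * C1 * \<epsilon>" using h[of "-1"] by simp
    ultimately have "\<bar>bound_amp E - exp (- W 1)\<bar> \<le> 2 * C2 * C1 * \<epsilon>"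
      unfolding bound_amp_def W_even[of 1] by linarith
    then have 7: "\<bar>bound_amp E - exp (- W 1)\<bar> \<le> C * \<epsilon>" using up[OF Cge(5)] by linarith
    have 8: "bound_amp E > 0"
    proof -
      have "\<bar>?t * dec_w E (-1)\<bar> \<le> (1 / 2) * dec_u E (-1)"
        unfolding abs_mult using 5 h'[of "-1"] by (intro mult_mono) auto
      moreover have "dec_u E (-1) > 0" using h'[of "-1"] by simp
      ultimately show ?thesis unfolding bound_amp_def by linarith
    qed
    have 9: "bound_amp E \<le> C" using B(2)[OF E] Cge(6) by (simp add: abs_le_iff)
    have 10: "\<forall>y\<in>{-1..1}. \<bar>dec_u E y - exp (- W y)\<bar> \<le> C * \<epsilon> \<and> \<bar>dec_w E y\<bar> \<le> C * \<epsilon> \<and> \<bar>dec_w E y\<bar> \<le> dec_u E y"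
    proof
      fix y :: real assume y: "y \<in> {-1..1}"
      show "\<bar>dec_u E y - exp (- W y)\<bar> \<le> C * \<epsilon> \<and> \<bar>dec_w E y\<bar> \<le> C * \<epsilon> \<and> \<bar>dec_w E y\<bar> \<le> dec_u E y"
        using h[OF y] h'[OF y] up[OF Cge(7)] by linarith
    qed
    show ?thesis
      using 1 2 3 4 Ce(1) 5 6 7 8 9 10 unfolding \<epsilon>_def by blast
  qed
  show ?thesis
    using main C D(1) by (intro exI[of _ C] conjI exI[of _ D]) blast+
qed

text \<open>
  Between the midpoint and the wall both \<open>u - w\<close> and \<open>u + w\<close> are positive multiples of \<open>p - q\<close> and
  \<open>p + q\<close>, for \<open>p\<close> and \<open>q\<close> the decaying and growing modes; and \<open>\<bar>q\<bar> \<le> p\<close> holds with equality at the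
  midpoint.
\<close>

lemma bound_state_left_dominance:
  assumes \<sigma>: "\<sigma>\<^sup>2 = 1" and E: "\<bar>E\<bar> < k" and \<delta>: "\<delta> > 1" and b: "matching \<sigma> E \<delta>"
    and P: "bound_amp E > 0" and y: "-\<delta> \<le> y" "y \<le> -1"
  shows "\<bar>dec_w E y\<bar> \<le> dec_u E y"
proof -
  let ?s = "decay_rate k E" and ?t = "tail_slope k E"
  note g = gap_facts[OF k_pos E]
  have \<sigma>1: "\<bar>\<sigma>\<bar> = 1" using \<sigma> by (simp add: abs_square_eq_1)
  define p q where "p = bound_amp E * exp (?s * (y + 1))" "q = leak_amp E * exp (- ?s * (y + 1))"
  note pq = this
  have t2: "1 - ?t\<^sup>2 > 0" using g(8) by simp
  have "\<bar>q\<bar> = bound_amp E * exp (- 2 * ?s * (\<delta> - 1) - ?s * (y + 1))"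
    using matching_iff[OF \<sigma> E \<delta>] b P by (simp add: pq abs_mult \<sigma>1 mult.assoc exp_add[symmetric])
  also have "\<dots> \<le> p"
  proof -
    have "0 \<le> ?s * (2 * (\<delta> - 1) + 2 * (y + 1))" using g(1) y(1) by (intro mult_nonneg_nonneg) auto
    then have "- 2 * ?s * (\<delta> - 1) - ?s * (y + 1) \<le> ?s * (y + 1)" by (simp add: algebra_simps)
    then have "exp (- 2 * ?s * (\<delta> - 1) - ?s * (y + 1)) \<le> exp (?s * (y + 1))"
      by (simp only: exp_le_cancel_iff)
    from mult_left_mono[OF this less_imp_le[OF P]] show ?thesis unfolding pq .
  qed
  finally have qp: "\<bar>q\<bar> \<le> p" .
  have e: "dec_u E y - dec_w E y = (1 - ?t) * (p - q) / (1 - ?t\<^sup>2)" "dec_u E y + dec_w E y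
      = (1 + ?t) * (p + q) / (1 - ?t\<^sup>2)"
    unfolding dec_sol_left[OF E y(2)] pq by (simp_all add: algebra_simps flip: diff_divide_distrib
        add_divide_distrib)
  have "dec_u E y - dec_w E y \<ge> 0" "dec_u E y + dec_w E y \<ge> 0"
    unfolding e using g(7) qp t2 by (auto intro!: divide_nonneg_pos mult_nonneg_nonneg simp: abs_le_iff
        abs_less_iff)
  then show ?thesis by (simp add: abs_le_iff)
qed

text \<open>
  For \<open>E < E'\<close> the Wronskian of the two decaying solutions vanishes at the midpoint and equals
  \<open>(t - t') exp (- 2 W 1) < 0\<close> at \<open>1\<close>. But it is nondecreasing, as \<open>\<bar>w\<bar> \<le> u\<close> holds for either
  solution in between.
\<close>

lemma bound_states_unique:
  "\<exists>D\<ge>1. \<forall>\<delta>>D. \<forall>\<sigma> E E'. \<sigma>\<^sup>2 = 1 \<longrightarrow> \<bar>E\<bar> \<le> K \<longrightarrow> \<bar>E'\<bar> \<le> K \<longrightarrow>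
     matching \<sigma> E \<delta> \<longrightarrow> matching \<sigma> E' \<delta> \<longrightarrow> E = E'"
proof -
  obtain C D where D: "D \<ge> 1" and F: "\<And>\<delta> \<sigma> E. \<delta> > D \<Longrightarrow> \<sigma>\<^sup>2 = 1 \<Longrightarrow> \<bar>E\<bar> \<le> K \<Longrightarrow> matching \<sigma> E \<delta> \<Longrightarrow>
      0 < bound_amp E \<and> (\<forall>y\<in>{-1..1}. \<bar>dec_w E y\<bar> \<le> dec_u E y)"
    using bound_state_facts by metis
  have less: "\<not> E < E'"
    if \<delta>: "\<delta> > D" and \<sigma>: "\<sigma>\<^sup>2 = 1" and E: "\<bar>E\<bar> \<le> K" "\<bar>E'\<bar> \<le> K" and b: "matching \<sigma> E \<delta>" "matching \<sigma> E' \<delta>"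
    for \<delta> \<sigma> E E'
  proof
    assume lt: "E < E'"
    have \<delta>1: "\<delta> > 1" using \<delta> D by simp
    have dom: "\<bar>dec_w e y\<bar> \<le> dec_u e y" if "-\<delta> \<le> y" "y \<le> 1" "\<bar>e\<bar> \<le> K" "matching \<sigma> e \<delta>" for e y
    proof (cases "y \<le> -1")
      case True
      then show ?thesis
        using bound_state_left_dominance[OF \<sigma> in_gap[OF that(3)] \<delta>1 that(4) _ that(1)] F[OF \<delta> \<sigma> that(3,4)]
            by blast
    next
      case False
      then show ?thesis using F[OF \<delta> \<sigma> that(3,4)] that(2) by auto
    qed
    define Z where "Z = (\<lambda>y. dec_u E y * dec_w E' y - dec_w E y * dec_u E' y)"
    have "Z (-\<delta>) \<le> Z 1"
    proof (rule DERIV_nondecreasing[of "-\<delta>" 1 Z])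
      fix y assume y: "-\<delta> \<le> y" "y \<le> 1"
      show "(Z has_real_derivative (E' - E) * (dec_u E y * dec_u E' y + dec_w E y * dec_w E' y)) (at y)"
        unfolding Z_def by (rule dirac_ode_wronskian[OF dec_sol dec_sol]) simp
      have "\<bar>dec_w E y * dec_w E' y\<bar> \<le> dec_u E y * dec_u E' y"
        unfolding abs_mult using dom[OF y E(1) b(1)] dom[OF y E(2) b(2)] by (intro mult_mono) auto
      then show "0 \<le> (E' - E) * (dec_u E y * dec_u E' y + dec_w E y * dec_w E' y)"
        using lt by (intro mult_nonneg_nonneg) (auto simp: abs_le_iff)
    qed (use \<delta>1 in auto)
    moreover have "Z (-\<delta>) = 0" using b by (simp add: Z_def matching_def)
    moreover have "Z 1 = - (tail_slope k E' - tail_slope k E) * (exp (- W 1))\<^sup>2"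
      by (simp add: Z_def dec_u_1 dec_w_1 algebra_simps power2_eq_square)
    ultimately have "tail_slope k E' \<le> tail_slope k E" by (simp add: mult_le_0_iff zero_le_mult_iff)
    moreover have "tail_slope k E < tail_slope k E'"
      by (rule tail_slope_strict_mono[OF k_pos in_gap[OF E(1)] in_gap[OF E(2)] lt])
    ultimately show False by simp
  qed
  have "E = E'"
    if "\<delta> > D" "\<sigma>\<^sup>2 = 1" "\<bar>E\<bar> \<le> K" "\<bar>E'\<bar> \<le> K" "matching \<sigma> E \<delta>" "matching \<sigma> E' \<delta>"
    for \<delta> \<sigma> E E'
    using less[OF that] less[OF that(1,2,4,3,6,5)] by simp
  then show ?thesis using D by blast
qed

text \<open>
  The error has two sources with different profiles: the one along the wall mode is localized at the
  wall, the other, from the growing mode, at the midpoint \<open>x = 0\<close>. The three cases are the regions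
  to the right of, at and to the left of the wall; only the last one contains the growing mode,
  which produces the leading part \<open>\<sigma> exp (- W (x + \<delta>))\<close> of \<open>w\<close>. The rate \<open>k / 4\<close> is half of the
  guaranteed decay rate \<open>k / 2\<close>.
\<close>

lemma dec_sol_comparison:
  "\<exists>C>0. \<exists>D\<ge>1. \<forall>\<delta>>D. \<forall>\<sigma> E. \<sigma>\<^sup>2 = 1 \<longrightarrow> \<bar>E\<bar> \<le> K \<longrightarrow> matching \<sigma> E \<delta> \<longrightarrow> (\<forall>x\<ge>0.
     \<bar>dec_u E (x - \<delta>) - exp (- W (x - \<delta>))\<bar>
       \<le> C * exp (- 2 * k * \<delta>) * (exp (- (k / 4) * \<bar>x - \<delta>\<bar>) + exp (- (k / 4) * \<bar>x\<bar>)) \<and>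
     \<bar>dec_w E (x - \<delta>) - \<sigma> * exp (- W (x + \<delta>))\<bar>
       \<le> C * exp (- 2 * k * \<delta>) * (exp (- (k / 4) * \<bar>x - \<delta>\<bar>) + exp (- (k / 4) * \<bar>x\<bar>)))"
proof -
  obtain C D where C: "C > 0" and D: "D \<ge> 1" and F: "\<And>\<delta> \<sigma> E. \<delta> > D \<Longrightarrow> \<sigma>\<^sup>2 = 1 \<Longrightarrow> \<bar>E\<bar> \<le> K \<Longrightarrow> matching \<sigma> E \<delta> \<Longrightarrow>
     \<bar>E\<bar> \<le> C * exp (- 2 * k * \<delta>) \<and> \<bar>tail_slope k E\<bar> \<le> C * exp (- 2 * k * \<delta>) \<and>
     k - decay_rate k E \<le> C * exp (- 2 * k * \<delta>) \<and>
     (k - decay_rate k E) * (\<delta> - 1) \<le> C * exp (- 2 * k * \<delta>) \<and>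
     C * exp (- 2 * k * \<delta>) \<le> 1 \<and> \<bar>tail_slope k E\<bar> \<le> 1 / 2 \<and>
     k / 2 \<le> decay_rate k E \<and> \<bar>bound_amp E - exp (- W 1)\<bar> \<le> C * exp (- 2 * k * \<delta>) \<and>
     0 < bound_amp E \<and> bound_amp E \<le> C \<and>
     (\<forall>y\<in>{-1..1}. \<bar>dec_u E y - exp (- W y)\<bar> \<le> C * exp (- 2 * k * \<delta>) \<and>
        \<bar>dec_w E y\<bar> \<le> C * exp (- 2 * k * \<delta>) \<and> \<bar>dec_w E y\<bar> \<le> dec_u E y)"
    using bound_state_facts by metis
  define c0 where "c0 = exp (- W 1)"
  have c0: "c0 > 0" by (simp add: c0_def)
  (* The sum collects the constants of the three regions; the factor exp k is more than enough to replace the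
     distance to the edge of the wall by the distance to its centre in the exponential weights. *)
  define A where "A = (C + c0 * C * (4 / k) + 4 * C * C + c0 * C + c0 * exp (2 * k)) * exp k"
  have A: "A \<ge> C + c0 * C * (4 / k) + 4 * C * C + c0 * C + c0 * exp (2 * k)"
  proof -
    have "0 < C + c0 * C * (4 / k) + 4 * C * C + c0 * C + c0 * exp (2 * k)"
      using C c0 k_pos by (intro add_pos_pos mult_pos_pos divide_pos_pos) auto
    from mult_left_mono[of 1 "exp k", OF _ less_imp_le[OF this]] show ?thesis
      unfolding A_def using k_pos by simp
  qed
  have "\<bar>dec_u E (x - \<delta>) - exp (- W (x - \<delta>))\<bar> \<le> A * exp (- 2 * k * \<delta>) * (exp (- (k / 4) * \<bar>x - \<delta>\<bar>) + exp (- (k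
      / 4) * \<bar>x\<bar>)) \<and>
     \<bar>dec_w E (x - \<delta>) - \<sigma> * exp (- W (x + \<delta>))\<bar> \<le> A * exp (- 2 * k * \<delta>) * (exp (- (k / 4) * \<bar>x - \<delta>\<bar>) + exp (-
         (k / 4) * \<bar>x\<bar>))"
    if \<delta>: "\<delta> > D" and \<sigma>: "\<sigma>\<^sup>2 = 1" and E: "\<bar>E\<bar> \<le> K" and b: "matching \<sigma> E \<delta>" and x: "x \<ge> 0" for \<delta> \<sigma> E x
  proof -
    let ?s = "decay_rate k E" and ?t = "tail_slope k E" and ?y = "x - \<delta>"
    define \<epsilon> where "\<epsilon> = exp (- 2 * k * \<delta>)"
    have \<epsilon>: "\<epsilon> > 0" by (simp add: \<epsilon>_def)
    have \<delta>1: "\<delta> > 1" using \<delta> D by simp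
    note Ek = in_gap[OF E]
    note g = gap_facts[OF k_pos Ek]
    have F: "\<bar>E\<bar> \<le> C * \<epsilon>" "\<bar>?t\<bar> \<le> C * \<epsilon>" "k - ?s \<le> C * \<epsilon>" "C * \<epsilon> \<le> 1" "\<bar>?t\<bar> \<le> 1 / 2" "k / 2 \<le> ?s"
      "\<bar>bound_amp E - c0\<bar> \<le> C * \<epsilon>" "0 < bound_amp E" "bound_amp E \<le> C"
      "\<And>y. y \<in> {-1..1} \<Longrightarrow> \<bar>dec_u E y - exp (- W y)\<bar> \<le> C * \<epsilon> \<and> \<bar>dec_w E y\<bar> \<le> C * \<epsilon>"
      using F[OF \<delta> \<sigma> E b] unfolding \<epsilon>_def c0_def by blast+
    have \<sigma>1: "\<bar>\<sigma>\<bar> = 1" using \<sigma> by (simp add: abs_square_eq_1)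
    have W2: "exp (- W (x + \<delta>)) = c0 * exp (- k * (x + \<delta> - 1))"
      using W_right[of "x + \<delta>"] x \<delta>1 by (simp add: c0_def exp_add[symmetric] algebra_simps)
    have rate: "\<bar>exp (- ?s * a) - exp (- k * a)\<bar> \<le> C * \<epsilon> * (4 / k) * exp (- (k / 4) * a)" if a: "a \<ge> 0" for a
    proof -
      have "\<bar>exp (- ?s * a) - exp (- k * a)\<bar> \<le> (k - ?s) * (2 / ?s) * exp (- ?s / 2 * a)"
        by (rule exp_rate_diff[OF g(1,2) a])
      also have "\<dots> \<le> (C * \<epsilon>) * (4 / k) * exp (- (k / 4) * a)"
      proof (intro mult_mono)
        show "2 / ?s \<le> 4 / k" using F(6) g(1) k_pos by (simp add: field_simps)
        show "exp (- ?s / 2 * a) \<le> exp (- (k / 4) * a)"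
          using mult_right_mono[of "k / 4" "?s / 2" a] F(6) a by simp
      qed (use F(3) g k_pos C \<epsilon> in auto)
      finally show ?thesis .
    qed
    have decay: "exp (- ?s * a) \<le> exp (- (k / 4) * a)" "exp (- k * a)
        \<le> exp (- (k / 4) * a)" if a: "a \<ge> 0" for a
      using mult_right_mono[of "k / 4" ?s a] mult_right_mono[of "k / 4" k a] F(6) a k_pos by simp_all
    let ?A0 = "C + c0 * C * (4 / k) + 4 * C * C + c0 * C + c0 * exp (2 * k)"
    have up: "a * \<epsilon> * e \<le> A * \<epsilon> * e" if "a \<le> ?A0" "e \<ge> 0" for a e
      using that A \<epsilon> by (intro mult_right_mono) auto
    consider (left) "?y \<le> -1" | (mid) "?y \<in> {-1..1}" | (right) "?y \<ge> 1" by fastforce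
    then have "\<bar>dec_u E ?y - exp (- W ?y)\<bar> \<le> A * \<epsilon> * (exp (- (k / 4) * \<bar>?y\<bar>) + exp (- (k / 4) * \<bar>x\<bar>)) \<and>
      \<bar>dec_w E ?y - \<sigma> * exp (- W (x + \<delta>))\<bar> \<le> A * \<epsilon> * (exp (- (k / 4) * \<bar>?y\<bar>) + exp (- (k / 4) * \<bar>x\<bar>))"
    proof cases
      case right
      define z where "z = ?y - 1"
      have z: "z \<ge> 0" using right by (simp add: z_def)
      let ?e = "exp (- (k / 4) * z)"
      have ez: "?e \<le> exp k * exp (- (k / 4) * \<bar>?y\<bar>)"
      proof -
        have "\<bar>?y\<bar> = z + 1" using right by (simp add: z_def)
        then have "- (k / 4) * z \<le> k + - (k / 4) * \<bar>?y\<bar>" using k_pos by (simp add: distrib_left)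
        then show ?thesis by (simp add: exp_add[symmetric])
      qed
      have fin: "?A0 * \<epsilon> * ?e \<le> A * \<epsilon> * (exp (- (k / 4) * \<bar>?y\<bar>) + exp (- (k / 4) * \<bar>x\<bar>))"
      proof -
        have "?A0 * \<epsilon> * ?e \<le> ?A0 * \<epsilon> * (exp k * exp (- (k / 4) * \<bar>?y\<bar>))"
          using ez C c0 k_pos \<epsilon> by (intro mult_left_mono) (auto intro!: add_nonneg_nonneg)
        also have "\<dots> = A * \<epsilon> * exp (- (k / 4) * \<bar>?y\<bar>)" by (simp add: A_def mult_ac)
        also have "\<dots> \<le> A * \<epsilon> * (exp (- (k / 4) * \<bar>?y\<bar>) + exp (- (k / 4) * \<bar>x\<bar>))"
          using \<epsilon> A C c0 k_pos by (intro mult_left_mono) (auto simp: A_def intro!: add_nonneg_nonneg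
              mult_nonneg_nonneg)
        finally show ?thesis .
      qed
      have "exp (- W ?y) = c0 * exp (- k * z)"
        using W_right[OF right] by (simp add: c0_def z_def exp_add[symmetric] algebra_simps)
      moreover have u: "dec_u E ?y = c0 * exp (- ?s * z)"
        using dec_sol_tail(1)[OF Ek right] by (simp add: c0_def z_def)
      ultimately have "\<bar>dec_u E ?y - exp (- W ?y)\<bar> = c0 * \<bar>exp (- ?s * z) - exp (- k * z)\<bar>"
        using c0 by (simp add: abs_mult flip: right_diff_distrib)
      also have "\<dots> \<le> c0 * (C * \<epsilon> * (4 / k) * ?e)" by (intro mult_left_mono rate z) (use c0 in auto)
      also have "\<dots> = (c0 * C * (4 / k)) * \<epsilon> * ?e" by (simp add: mult_ac)
      also have "\<dots> \<le> ?A0 * \<epsilon> * ?e"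
        using C c0 \<epsilon> k_pos by (intro mult_right_mono) auto
      finally have U: "\<bar>dec_u E ?y - exp (- W ?y)\<bar> \<le> ?A0 * \<epsilon> * ?e" .
      have "dec_w E ?y = - ?t * (c0 * exp (- ?s * z))"
        using dec_sol_tail(2)[OF Ek right] by (simp add: c0_def z_def)
      then have "\<bar>dec_w E ?y\<bar> = \<bar>?t\<bar> * (c0 * exp (- ?s * z))" using c0 by (simp add: abs_mult)
      also have "\<dots> \<le> (C * \<epsilon>) * (c0 * ?e)"
        using F(2) decay(1)[OF z] c0 C \<epsilon> by (intro mult_mono) auto
      finally have w1: "\<bar>dec_w E ?y\<bar> \<le> c0 * C * \<epsilon> * ?e" by (simp add: mult_ac)
      have "exp (- k * (x + \<delta> - 1)) = exp (- 2 * k * \<delta>) * exp (- k * z)"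
        by (simp add: z_def exp_add[symmetric] algebra_simps)
      then have "\<bar>\<sigma> * exp (- W (x + \<delta>))\<bar> = c0 * \<epsilon> * exp (- k * z)"
        unfolding W2 using c0 by (simp add: abs_mult \<sigma>1 \<epsilon>_def)
      also have "\<dots> \<le> c0 * exp (2 * k) * \<epsilon> * ?e"
        using decay(2)[OF z] c0 \<epsilon> k_pos by (intro mult_mono) (auto simp: mult_le_cancel_left1)
      finally have w2: "\<bar>\<sigma> * exp (- W (x + \<delta>))\<bar> \<le> c0 * exp (2 * k) * \<epsilon> * ?e" .
      have "\<bar>dec_w E ?y - \<sigma> * exp (- W (x + \<delta>))\<bar> \<le> (c0 * C + c0 * exp (2 * k)) * \<epsilon> * ?e"
        using w1 w2 by (simp add: algebra_simps abs_le_iff)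
      also have "\<dots> \<le> ?A0 * \<epsilon> * ?e"
        using C c0 \<epsilon> k_pos by (intro mult_right_mono) auto
      finally show ?thesis using U fin by linarith
    next
      case mid
      have one: "1 \<le> exp k * exp (- (k / 4) * \<bar>?y\<bar>)"
      proof -
        have "(k / 4) * \<bar>?y\<bar> \<le> (k / 4) * 1" using mid k_pos by (intro mult_left_mono) auto
        then have "0 \<le> k + - (k / 4) * \<bar>?y\<bar>" using k_pos by linarith
        then show ?thesis by (simp add: exp_add[symmetric])
      qed
      have fin: "?A0 * \<epsilon> \<le> A * \<epsilon> * (exp (- (k / 4) * \<bar>?y\<bar>) + exp (- (k / 4) * \<bar>x\<bar>))"
      proof -
        have "?A0 * \<epsilon> * 1 \<le> ?A0 * \<epsilon> * (exp k * exp (- (k / 4) * \<bar>?y\<bar>))"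
          using one C c0 k_pos \<epsilon> by (intro mult_left_mono) (auto intro!: add_nonneg_nonneg)
        also have "\<dots> = A * \<epsilon> * exp (- (k / 4) * \<bar>?y\<bar>)" by (simp add: A_def mult_ac)
        also have "\<dots> \<le> A * \<epsilon> * (exp (- (k / 4) * \<bar>?y\<bar>) + exp (- (k / 4) * \<bar>x\<bar>))"
          using \<epsilon> A C c0 k_pos by (intro mult_left_mono) (auto simp: A_def intro!: add_nonneg_nonneg
              mult_nonneg_nonneg)
        finally show ?thesis by simp
      qed
      have "C * \<epsilon> \<le> ?A0 * \<epsilon>" using C c0 \<epsilon> k_pos by (intro mult_right_mono) auto
      then have U: "\<bar>dec_u E ?y - exp (- W ?y)\<bar> \<le> ?A0 * \<epsilon>" using F(10)[OF mid] by linarith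
      have "- k * (x + \<delta> - 1) \<le> 2 * k + - 2 * k * \<delta>"
        using mid mult_left_mono[of "\<delta> - 1" x k] k_pos by (simp add: algebra_simps)
      then have "exp (- k * (x + \<delta> - 1)) \<le> exp (2 * k) * \<epsilon>"
        unfolding \<epsilon>_def exp_add[symmetric] by simp
      then have "\<bar>\<sigma> * exp (- W (x + \<delta>))\<bar> \<le> c0 * (exp (2 * k) * \<epsilon>)"
        unfolding W2 using c0 by (simp add: abs_mult \<sigma>1)
      then have "\<bar>dec_w E ?y - \<sigma> * exp (- W (x + \<delta>))\<bar> \<le> (C + c0 * exp (2 * k)) * \<epsilon>"
        using F(10)[OF mid] by (simp add: algebra_simps abs_le_iff)
      also have "\<dots> \<le> ?A0 * \<epsilon>" using C c0 \<epsilon> k_pos by (intro mult_right_mono) auto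
      finally show ?thesis using U fin by linarith
    next
      case left
      define z where "z = - (?y + 1)"
      define p where "p = bound_amp E * exp (- ?s * z)"
      define q where "q = \<sigma> * bound_amp E * exp (- ?s * (x + \<delta> - 1))"
      have z: "z \<ge> 0" using left by (simp add: z_def)
      have xd: "x + \<delta> - 1 \<ge> 0" using x \<delta>1 by simp
      let ?e = "exp (- (k / 4) * z)" and ?f = "exp (- (k / 4) * \<bar>x\<bar>)"
      have ez: "?e \<le> exp k * exp (- (k / 4) * \<bar>?y\<bar>)"
      proof -
        have "\<bar>?y\<bar> = z + 1" using left by (simp add: z_def)
        then have "- (k / 4) * z \<le> k + - (k / 4) * \<bar>?y\<bar>" using k_pos by (simp add: distrib_left)
        then show ?thesis by (simp add: exp_add[symmetric])
      qed
      have fin: "?A0 * \<epsilon> * (?e + ?f) \<le> A * \<epsilon> * (exp (- (k / 4) * \<bar>?y\<bar>) + ?f)"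
      proof -
        have "?e + ?f \<le> exp k * exp (- (k / 4) * \<bar>?y\<bar>) + exp k * ?f"
          using ez k_pos by (intro add_mono) (auto simp: mult_le_cancel_right1)
        then have "?A0 * \<epsilon> * (?e + ?f) \<le> ?A0 * \<epsilon> * (exp k * (exp (- (k / 4) * \<bar>?y\<bar>) + ?f))"
          using C c0 k_pos \<epsilon> by (intro mult_left_mono) (auto intro!: add_nonneg_nonneg simp: distrib_left)
        also have "\<dots> = A * \<epsilon> * (exp (- (k / 4) * \<bar>?y\<bar>) + ?f)" by (simp add: A_def mult_ac)
        finally show ?thesis .
      qed
      have t2: "?t\<^sup>2 \<le> 1 / 4" using F(5) power_mono[of "\<bar>?t\<bar>" "1/2" 2] by (simp add: power2_eq_square)
      have qe: "leak_amp E * exp (?s * z) = q"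
        using matching_iff[OF \<sigma> Ek \<delta>1] b by (simp add: q_def z_def mult.assoc exp_add[symmetric]
            algebra_simps)
      have h: "dec_u E ?y = (p + ?t * q) / (1 - ?t\<^sup>2)" "dec_w E ?y = (?t * p + q) / (1 - ?t\<^sup>2)"
        using dec_sol_left[OF Ek left] qe by (simp_all add: p_def z_def algebra_simps)
      have ae: "bound_amp E * exp (- ?s * z) \<le> C * ?e"
        using F(8,9) decay(1)[OF z] C by (intro mult_mono) auto
      have pb: "\<bar>p\<bar> \<le> C * ?e" using ae F(8) by (simp add: p_def)
      have "\<bar>q\<bar> = bound_amp E * exp (- ?s * (x + \<delta> - 1))" using F(8) by (simp add: q_def abs_mult \<sigma>1)
      also have "\<dots> \<le> C * exp (- (k / 4) * (x + \<delta> - 1))"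
        using F(8,9) decay(1)[OF xd] C by (intro mult_mono) auto
      also have "\<dots> \<le> C * ?f" using C k_pos x \<delta>1 by (intro mult_left_mono) (auto simp: mult_left_mono)
      finally have qb: "\<bar>q\<bar> \<le> C * ?f" .
      have rest: "\<bar>(a + ?t * b) / (1 - ?t\<^sup>2) - a\<bar> \<le> 4 * C * C * \<epsilon> * (?e + ?f) / 2"
        if ab: "\<bar>a\<bar> + \<bar>b\<bar> \<le> C * (?e + ?f)" for a b
      proof -
        have d: "1 - ?t\<^sup>2 \<ge> 1 / 2" using t2 by simp
        have "(a + ?t * b) / (1 - ?t\<^sup>2) - a = ?t * (?t * a + b) / (1 - ?t\<^sup>2)"
          using d by (simp add: field_simps power2_eq_square)
        moreover have "\<bar>?t * (?t * a + b)\<bar> \<le> (C * \<epsilon>) * (C * (?e + ?f))"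
        proof -
          have "\<bar>?t * a\<bar> \<le> 1 * \<bar>a\<bar>" unfolding abs_mult using g(7) by (intro mult_right_mono) auto
          then have "\<bar>?t * a + b\<bar> \<le> C * (?e + ?f)" using ab by linarith
          then show ?thesis unfolding abs_mult using F(2) C \<epsilon> by (intro mult_mono) auto
        qed
        then have "\<bar>?t * (?t * a + b)\<bar> / \<bar>1 - ?t\<^sup>2\<bar> \<le> (C * \<epsilon>) * (C * (?e + ?f)) / (1 / 2)"
          using d C \<epsilon> by (intro frac_le) auto
        ultimately have "\<bar>(a + ?t * b) / (1 - ?t\<^sup>2) - a\<bar> \<le> (C * \<epsilon>) * (C * (?e + ?f)) / (1 / 2)"
          by (simp only: abs_divide)
        also have "\<dots> = 4 * C * C * \<epsilon> * (?e + ?f) / 2" by (simp add: algebra_simps)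
        finally show ?thesis .
      qed
      have "exp (- W ?y) = c0 * exp (- k * z)"
        using W_abs[of ?y] left by (simp add: c0_def z_def exp_add[symmetric] algebra_simps)
      then have "\<bar>p - exp (- W ?y)\<bar> \<le> \<bar>bound_amp E - c0\<bar> * exp (- ?s * z) + c0 * \<bar>exp (- ?s * z) - exp (- k *
          z)\<bar>"
      proof -
        have "p - c0 * exp (- k * z) = (bound_amp E - c0) * exp (- ?s * z) + c0 * (exp (- ?s * z) - exp (- k *
            z))"
          by (simp add: p_def algebra_simps)
        then show ?thesis using \<open>exp (- W ?y) = _\<close> c0 abs_triangle_ineq[of "(bound_amp E - c0) * exp (- ?s *
            z)" "c0 * (exp (- ?s * z) - exp (- k * z))"]
          by (simp add: abs_mult)
      qed
      also have "\<dots> \<le> (C * \<epsilon>) * ?e + c0 * (C * \<epsilon> * (4 / k) * ?e)"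
        using F(7) decay(1)[OF z] rate[OF z] c0 C \<epsilon> by (intro add_mono mult_mono) auto
      finally have pd: "\<bar>p - exp (- W ?y)\<bar> \<le> (C + c0 * C * (4 / k)) * \<epsilon> * ?e" by (simp add: algebra_simps)
      have "\<bar>q - \<sigma> * exp (- W (x + \<delta>))\<bar> \<le> \<bar>bound_amp E - c0\<bar> * exp (- ?s * (x + \<delta> - 1))
          + c0 * \<bar>exp (- ?s * (x + \<delta> - 1)) - exp (- k * (x + \<delta> - 1))\<bar>"
      proof -
        have "q - \<sigma> * exp (- W (x + \<delta>)) = \<sigma> * ((bound_amp E - c0) * exp (- ?s * (x + \<delta> - 1))
          + c0 * (exp (- ?s * (x + \<delta> - 1)) - exp (- k * (x + \<delta> - 1))))"
          unfolding W2 q_def by (simp add: right_diff_distrib distrib_left left_diff_distrib mult.assoc)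
        then have "\<bar>q - \<sigma> * exp (- W (x + \<delta>))\<bar> = \<bar>(bound_amp E - c0) * exp (- ?s * (x + \<delta> - 1))
          + c0 * (exp (- ?s * (x + \<delta> - 1)) - exp (- k * (x + \<delta> - 1)))\<bar>"
          by (simp only: abs_mult \<sigma>1 mult_1)
        then show ?thesis
          using c0 abs_triangle_ineq[of "(bound_amp E - c0) * exp (- ?s * (x + \<delta> - 1))" "c0 * (exp (- ?s * (x
              + \<delta> - 1)) - exp (- k * (x + \<delta> - 1)))"]
          by (simp add: abs_mult)
      qed
      also have "\<dots> \<le> (C * \<epsilon>) * exp (- (k / 4) * (x + \<delta> - 1)) + c0 * (C * \<epsilon> * (4 / k) * exp (- (k / 4) * (x + \<delta>
          - 1)))"
        using F(7) decay(1)[OF xd] rate[OF xd] c0 C \<epsilon> by (intro add_mono mult_mono) auto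
      also have "\<dots> = (C + c0 * C * (4 / k)) * \<epsilon> * exp (- (k / 4) * (x + \<delta> - 1))" by (simp add: algebra_simps)
      also have "\<dots> \<le> (C + c0 * C * (4 / k)) * \<epsilon> * ?f"
        using C c0 k_pos \<epsilon> x \<delta>1 by (intro mult_left_mono) (auto simp: mult_left_mono)
      finally have qd: "\<bar>q - \<sigma> * exp (- W (x + \<delta>))\<bar> \<le> (C + c0 * C * (4 / k)) * \<epsilon> * ?f" .
      let ?B = "C + c0 * C * (4 / k)"
      have B0: "?B * \<epsilon> * ?e \<ge> 0" "?B * \<epsilon> * ?f \<ge> 0" "4 * C * C * \<epsilon> * (?e + ?f) \<ge> 0"
        using C c0 k_pos \<epsilon> by (auto intro!: mult_nonneg_nonneg add_nonneg_nonneg)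
      have tot: "?B * \<epsilon> * ?e + ?B * \<epsilon> * ?f + 4 * C * C * \<epsilon> * (?e + ?f) \<le> ?A0 * \<epsilon> * (?e + ?f)"
      proof -
        have "?B * \<epsilon> * ?e + ?B * \<epsilon> * ?f + 4 * C * C * \<epsilon> * (?e + ?f) = (?B + 4 * C * C) * \<epsilon> * (?e + ?f)"
          by (simp add: distrib_left distrib_right)
        also have "\<dots> \<le> ?A0 * \<epsilon> * (?e + ?f)" using C c0 \<epsilon> k_pos by (intro mult_right_mono) auto
        finally show ?thesis .
      qed
      have "\<bar>p\<bar> + \<bar>q\<bar> \<le> C * (?e + ?f)" using pb qb by (simp add: distrib_left)
      then have r: "\<bar>dec_u E ?y - p\<bar> \<le> 4 * C * C * \<epsilon> * (?e + ?f) / 2" "\<bar>dec_w E ?y - q\<bar>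
          \<le> 4 * C * C * \<epsilon> * (?e + ?f) / 2"
        unfolding h using rest[of p q] rest[of q p] by (simp_all add: add.commute)
      have chain: "\<bar>a - c\<bar> \<le> X"
        if "\<bar>a - b\<bar> \<le> R / 2" "\<bar>b - c\<bar> \<le> B1" "0 \<le> B2" "0 \<le> R" "B1 + B2 + R \<le> T" "T \<le> X"
        for a b c R B1 B2 T X :: real
        using that by linarith
      have tot': "?B * \<epsilon> * ?f + ?B * \<epsilon> * ?e + 4 * C * C * \<epsilon> * (?e + ?f) \<le> ?A0 * \<epsilon> * (?e + ?f)"
        using tot by (simp only: add.commute[of "?B * \<epsilon> * ?f"])
      show ?thesis
        using chain[OF r(1) pd B0(2,3) tot fin] chain[OF r(2) qd B0(1,3) tot' fin] by blast
    qed
    then show ?thesis unfolding \<epsilon>_def .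
  qed
  moreover have "A > 0" unfolding A_def
    using C c0 k_pos by (intro mult_pos_pos add_pos_pos divide_pos_pos) auto
  ultimately show ?thesis using D by (intro exI[of _ A] conjI exI[of _ D]) blast+
qed

end

section \<open>Auxiliary estimates for the expansions\<close>

text \<open>
  Unlike in the two-sided version, the boundary term at \<open>a\<close> survives.
\<close>

lemma integral_derivative_half_line:
  fixes f F :: "real \<Rightarrow> real"
  assumes "\<mu> > 0" and d: "\<And>x. (F has_real_derivative f x) (at x)" and c: "continuous_on UNIV f"
    and f: "integrable lborel (\<lambda>x. indicator {a..} x * f x)"
    and F: "\<And>x. x \<ge> a \<Longrightarrow> \<bar>F x\<bar> \<le> C * exp (- \<mu> * \<bar>x\<bar>)"
  shows "(\<integral>x. indicator {a..} x * f x \<partial>lborel) = - F a"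
proof -
  have e: "(\<lambda>n. exp (- \<mu> * real n)) \<longlonglongrightarrow> 0"
    using assms(1) by (intro filterlim_compose[OF exp_at_bot] filterlim_tendsto_neg_mult_at_bot[OF
        tendsto_const] filterlim_real_sequentially) auto
  have "(\<lambda>n. \<integral>x. indicator {a..real n} x * f x \<partial>lborel) \<longlonglongrightarrow> (\<integral>x. indicator {a..} x * f x \<partial>lborel)"
  proof (rule integral_dominated_convergence[where w = "\<lambda>x. norm (indicator {a..} x * f x)"])
    show "AE x in lborel. (\<lambda>n. indicator {a..real n} x * f x) \<longlonglongrightarrow> indicator {a..} x * f x"
    proof (intro AE_I2 tendsto_eventually)
      fix x :: real
      obtain N where "x < real N" using reals_Archimedean2 by blast
      then show "\<forall>\<^sub>F n in sequentially. indicator {a..real n} x * f x = indicator {a..} x * f x"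
        by (intro eventually_sequentiallyI[of N]) (auto simp: indicator_def)
    qed
    have [measurable]: "f \<in> borel_measurable borel" by (rule borel_measurable_continuous_onI[OF c])
    show "(\<lambda>x. indicator {a..real n} x * f x) \<in> borel_measurable lborel" for n by measurable
    show "(\<lambda>x. indicator {a..} x * f x) \<in> borel_measurable lborel" by measurable
    show "integrable lborel (\<lambda>x. norm (indicator {a..} x * f x))" using f by (rule integrable_norm)
    show "AE x in lborel. norm (indicator {a..real n} x * f x) \<le> norm (indicator {a..} x * f x)" for n
      by (intro AE_I2) (auto simp: indicator_def)
  qed
  moreover have "\<forall>\<^sub>F n in sequentially. (\<integral>x. indicator {a..real n} x * f x \<partial>lborel) = F (real n) - F a"
  proof -
    obtain N where N: "a < real N" using reals_Archimedean2 by blast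
    have "(\<integral>x. indicator {a..real n} x *\<^sub>R f x \<partial>lborel) = F (real n) - F a" if "n \<ge> N" for n
    proof (rule integral_FTC_Icc)
      show "a \<le> real n" using N that by simp
      show "(F has_vector_derivative f x) (at x within {a..real n})" for x
        using d by (meson has_field_derivative_at_within has_real_derivative_iff_has_vector_derivative)
    qed (rule continuous_on_subset[OF c], simp)
    then show ?thesis by (intro eventually_sequentiallyI[of N]) simp
  qed
  ultimately have "(\<lambda>n. F (real n) - F a) \<longlonglongrightarrow> (\<integral>x. indicator {a..} x * f x \<partial>lborel)"
    by (rule Lim_transform_eventually)
  moreover have "(\<lambda>n. F (real n)) \<longlonglongrightarrow> 0"
  proof (rule Lim_null_comparison)
    obtain N where N: "a < real N" using reals_Archimedean2 by blast
    show "\<forall>\<^sub>F n in sequentially. norm (F (real n)) \<le> C * exp (- \<mu> * real n)"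
      using N F[of "real _"] by (intro eventually_sequentiallyI[of N]) (auto dest!: order_trans)
    show "(\<lambda>n. C * exp (- \<mu> * real n)) \<longlonglongrightarrow> 0"
      using tendsto_mult_left[OF e, of C] by simp
  qed
  then have "(\<lambda>n. F (real n) - F a) \<longlonglongrightarrow> 0 - F a" by (intro tendsto_intros)
  ultimately show ?thesis using LIMSEQ_unique by fastforce
qed

lemma norm_H_nonneg: "norm_H f \<ge> 0"
  by (simp add: norm_H_eq)

lemma norm_H_sq: "(norm_H f)\<^sup>2 = (\<integral>x. (norm (f x))\<^sup>2 \<partial>lborel)"
  by (simp add: norm_H_eq)

text \<open>
  Young's inequality with the weight \<open>\<parallel>g\<parallel> / \<parallel>f\<parallel>\<close>; both norms are enlarged by \<open>e / 2\<close> to avoid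
  division by zero.
\<close>

lemma norm_H_triangle:
  assumes "f \<in> L2" "g \<in> L2"
  shows "norm_H (\<lambda>x. f x + g x) \<le> norm_H f + norm_H g"
proof -
  define a b where "a = norm_H f" "b = norm_H g"
  note ab = this
  have [measurable]: "f \<in> borel_measurable borel" "g \<in> borel_measurable borel" 
    and i: "integrable lborel (\<lambda>x. (norm (f x))\<^sup>2)" "integrable lborel (\<lambda>x. (norm (g x))\<^sup>2)"
    using assms by (auto simp: L2_def)
  have ptw: "(norm (f x + g x))\<^sup>2 \<le> (1 + \<eta>) * (norm (f x))\<^sup>2 + (1 + 1 / \<eta>) * (norm (g x))\<^sup>2" if "\<eta> > 0" for \<eta>
      x
  proof -
    have "(norm (f x + g x))\<^sup>2 \<le> (norm (f x) + norm (g x))\<^sup>2"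
      by (intro power_mono norm_triangle_ineq) simp
    also have "\<dots> = (norm (f x))\<^sup>2 + (norm (g x))\<^sup>2 + 2 * (norm (f x) * norm (g x))"
      by (simp add: power2_sum)
    also have "2 * (norm (f x) * norm (g x)) \<le> \<eta> * (norm (f x))\<^sup>2 + 1 / \<eta> * (norm (g x))\<^sup>2"
    proof -
      have "2 * (sqrt \<eta> * norm (f x)) * (norm (g x) / sqrt \<eta>)
          \<le> (sqrt \<eta> * norm (f x))\<^sup>2 + (norm (g x) / sqrt \<eta>)\<^sup>2"
        by (rule sum_squares_bound)
      then show ?thesis using that by (simp add: power_mult_distrib power_divide)
    qed
    finally show ?thesis by (simp add: algebra_simps)
  qed
  have "integrable lborel (\<lambda>x. (norm (f x + g x))\<^sup>2)"
  proof (rule Bochner_Integration.integrable_bound)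
    show "integrable lborel (\<lambda>x. (1 + 1) * (norm (f x))\<^sup>2 + (1 + 1 / 1) * (norm (g x))\<^sup>2)"
      by (intro Bochner_Integration.integrable_add integrable_mult_right i)
    show "AE x in lborel. norm ((norm (f x + g x))\<^sup>2)
        \<le> norm ((1 + 1) * (norm (f x))\<^sup>2 + (1 + 1 / 1) * (norm (g x))\<^sup>2)"
      using ptw[of 1] by (intro AE_I2) auto
  qed measurable
  then have bd: "(norm_H (\<lambda>x. f x + g x))\<^sup>2 \<le> (1 + \<eta>) * a\<^sup>2 + (1 + 1 / \<eta>) * b\<^sup>2" if "\<eta> > 0" for \<eta>
  proof -
    have "(norm_H (\<lambda>x. f x + g x))\<^sup>2 \<le> (\<integral>x. (1 + \<eta>) * (norm (f x))\<^sup>2 + (1 + 1 / \<eta>) * (norm (g x))\<^sup>2 \<partial>lborel)"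
      unfolding norm_H_sq using ptw[OF that] i \<open>integrable lborel (\<lambda>x. (norm (f x + g x))\<^sup>2)\<close>
      by (intro integral_mono Bochner_Integration.integrable_add integrable_mult_right) auto
    then show ?thesis using i by (simp add: ab norm_H_sq)
  qed
  have ab0: "a \<ge> 0" "b \<ge> 0" by (simp_all add: ab norm_H_nonneg)
  have "norm_H (\<lambda>x. f x + g x) \<le> a + b + e" if e: "e > 0" for e
  proof -
    define a' b' where "a' = a + e / 2" "b' = b + e / 2"
    note ab' = this
    have p: "a' > 0" "b' > 0" "a \<le> a'" "b \<le> b'" using e ab0 by (simp_all add: ab')
    have "(norm_H (\<lambda>x. f x + g x))\<^sup>2 \<le> (1 + b' / a') * a\<^sup>2 + (1 + 1 / (b' / a')) * b\<^sup>2"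
      by (rule bd) (use p in simp)
    also have "\<dots> \<le> (1 + b' / a') * a'\<^sup>2 + (1 + 1 / (b' / a')) * b'\<^sup>2"
      using p ab0 by (intro add_mono mult_left_mono power_mono) auto
    also have "\<dots> = (a' + b')\<^sup>2" using p by (simp add: field_simps power2_eq_square)
    finally have "norm_H (\<lambda>x. f x + g x) \<le> a' + b'"
      by (rule power2_le_imp_le) (use p in simp)
    then show ?thesis by (simp add: ab')
  qed
  then show ?thesis unfolding ab[symmetric] by (rule field_le_epsilon)
qed

context gapped_domain_wall
begin

text \<open>
  The size of the tunnelling between the walls, and the order of all error terms.
\<close>

abbreviation eps :: "real \<Rightarrow> real" where "eps \<delta> \<equiv> exp (- 2 * k * \<delta>)"

lemma W_weight_integrable: "integrable lborel (\<lambda>y. exp (- W y))" "integrable lborel (\<lambda>y. (exp (- W y))\<^sup>2)"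
proof -
  obtain A where A: "A > 0" "\<And>y. exp (- W y) \<le> A * exp (- k * \<bar>y\<bar>)" using exp_W_bound by blast
  have A2: "(exp (- W y))\<^sup>2 \<le> A\<^sup>2 * exp (- (2 * k) * \<bar>y\<bar>)" for y
  proof -
    have "(exp (- W y))\<^sup>2 \<le> (A * exp (- k * \<bar>y\<bar>))\<^sup>2" by (intro power_mono A) simp
    also have "\<dots> = A\<^sup>2 * exp (2 * (- k * \<bar>y\<bar>))" by (simp only: power_mult_distrib exp_double)
    finally show ?thesis by (simp add: mult.assoc)
  qed
  show "integrable lborel (\<lambda>y. exp (- W y))"
    using A by (intro integrable_exp_bound[OF k_pos]) (auto intro!: continuous_intros W_continuous)
  show "integrable lborel (\<lambda>y. (exp (- W y))\<^sup>2)"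
    using A2 k_pos by (intro integrable_exp_bound[of "2 * k"]) (auto intro!: continuous_intros W_continuous)
qed

text \<open>
  The normalization integral of the zero mode; its relation to the constant \<open>\<gamma>\<close> of the theorem is
  \<open>2 \<gamma>\<^sup>2 = 1 / weight_mass\<close>.
\<close>

definition weight_mass :: real where "weight_mass = (\<integral>y. (exp (- W y))\<^sup>2 \<partial>lborel)"

lemma weight_mass_pos: "weight_mass > 0"
proof -
  have "weight_mass \<noteq> 0"
  proof
    assume "weight_mass = 0"
    then have "AE y in lborel. (exp (- W y))\<^sup>2 = 0"
      unfolding weight_mass_def by (subst (asm) integral_nonneg_eq_0_iff_AE[OF W_weight_integrable(2)]) auto
    then have "(exp (- W 0))\<^sup>2 = 0"
      by (rule continuous_AE_zero[rotated]) (intro continuous_intros W_continuous)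
    then show False by simp
  qed
  moreover have "weight_mass \<ge> 0" unfolding weight_mass_def by simp
  ultimately show ?thesis by simp
qed

lemma gamma_const_eq: "gamma_const \<kappa> = 1 / (sqrt 2 * sqrt weight_mass)"
  by (simp add: gamma_const_def weight_mass_def)

lemma gamma_sq: "2 * (gamma_const \<kappa>)\<^sup>2 = 1 / weight_mass"
  using weight_mass_pos by (simp add: gamma_const_eq power_divide power_mult_distrib)

text \<open>
  The error at the midpoint relative to \<open>exp (- W \<delta>)\<close>, which is itself of order \<open>exp (- k \<delta>)\<close>. The
  comparison on the half line would only give an absolute error, which is not enough for the
  energies. On the matching condition the midpoint value is exactly
  \<open>P exp (- s (\<delta> - 1)) / (1 - \<sigma> t)\<close>.
\<close>

lemma dec_sol_at_minus_delta:
  "\<exists>C>0. \<exists>D\<ge>1. \<forall>\<delta>>D. \<forall>\<sigma> E. \<sigma>\<^sup>2 = 1 \<longrightarrow> \<bar>E\<bar> \<le> K \<longrightarrow> matching \<sigma> E \<delta> \<longrightarrow>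
     exp (- W \<delta>) * \<bar>dec_u E (- \<delta>) - exp (- W \<delta>)\<bar> \<le> C * (eps \<delta>)\<^sup>2"
proof -
  obtain C D where C: "C > 0" and D: "D \<ge> 1" and F: "\<And>\<delta> \<sigma> E. \<delta> > D \<Longrightarrow> \<sigma>\<^sup>2 = 1 \<Longrightarrow> \<bar>E\<bar> \<le> K \<Longrightarrow> matching \<sigma> E \<delta> \<Longrightarrow>
     \<bar>tail_slope k E\<bar> \<le> C * eps \<delta> \<and> (k - decay_rate k E) * (\<delta> - 1) \<le> C * eps \<delta> \<and>
     C * eps \<delta> \<le> 1 \<and> \<bar>tail_slope k E\<bar> \<le> 1 / 2 \<and>
     \<bar>bound_amp E - exp (- W 1)\<bar> \<le> C * eps \<delta> \<and> 0 < bound_amp E \<and> bound_amp E \<le> C"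
    using bound_state_facts by metis
  define c0 where "c0 = exp (- W 1)"
  have c0: "c0 > 0" by (simp add: c0_def)
  define B where "B = 2 * c0 * (2 * C * C + C + c0 * C) * exp (2 * k)"
  have "exp (- W \<delta>) * \<bar>dec_u E (- \<delta>) - exp (- W \<delta>)\<bar> \<le> B * (eps \<delta>)\<^sup>2"
    if \<delta>: "\<delta> > D" and \<sigma>: "\<sigma>\<^sup>2 = 1" and E: "\<bar>E\<bar> \<le> K" and b: "matching \<sigma> E \<delta>" for \<delta> \<sigma> E
  proof -
    let ?s = "decay_rate k E" and ?t = "tail_slope k E" and ?P = "bound_amp E"
    define \<epsilon> where "\<epsilon> = eps \<delta>"
    have \<epsilon>: "\<epsilon> > 0" by (simp add: \<epsilon>_def)
    have \<delta>1: "\<delta> > 1" using \<delta> D by simp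
    note Ek = in_gap[OF E]
    note g = gap_facts[OF k_pos Ek]
    have F: "\<bar>?t\<bar> \<le> C * \<epsilon>" "(k - ?s) * (\<delta> - 1) \<le> C * \<epsilon>" "C * \<epsilon> \<le> 1" "\<bar>?t\<bar> \<le> 1 / 2"
      "\<bar>?P - c0\<bar> \<le> C * \<epsilon>" "0 < ?P" "?P \<le> C"
      using F[OF \<delta> \<sigma> E b] unfolding \<epsilon>_def c0_def by blast+
    have \<sigma>1: "\<bar>\<sigma>\<bar> = 1" using \<sigma> by (simp add: abs_square_eq_1)
    define e1 where "e1 = exp (- k * (\<delta> - 1))"
    define r where "r = exp ((k - ?s) * (\<delta> - 1))"
    have e1: "e1 > 0" by (simp add: e1_def)
    have esL: "exp (- ?s * (\<delta> - 1)) = e1 * r"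
      by (simp add: e1_def r_def exp_add[symmetric] algebra_simps)
    have st: "\<bar>\<sigma> * ?t\<bar> \<le> 1 / 2" using F(4) by (simp add: abs_mult \<sigma>1)
    then have st0: "1 - \<sigma> * ?t \<ge> 1 / 2" by (simp add: abs_le_iff)
    have W\<delta>: "exp (- W \<delta>) = c0 * e1"
      using W_right[of \<delta>] \<delta>1 by (simp add: c0_def e1_def exp_add[symmetric] algebra_simps)
    have dec_u: "dec_u E (- \<delta>) * (1 - \<sigma> * ?t) = ?P * (e1 * r)"
    proof -
      have Q: "leak_amp E * exp (- ?s * (- \<delta> + 1)) = \<sigma> * (?P * exp (- ?s * (\<delta> - 1)))"
        using matching_iff[OF \<sigma> Ek \<delta>1] b by (simp add: mult.assoc exp_add[symmetric] algebra_simps)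
      have P: "?P * exp (?s * (- \<delta> + 1)) = ?P * exp (- ?s * (\<delta> - 1))" by (simp add: algebra_simps)
      have t2: "1 - ?t\<^sup>2 = (1 - \<sigma> * ?t) * (1 + \<sigma> * ?t)" using \<sigma> by (simp add: power2_eq_square algebra_simps)
      have st1: "1 + \<sigma> * ?t \<ge> 1 / 2" using st by (simp add: abs_le_iff)
      have "dec_u E (- \<delta>) = (1 + \<sigma> * ?t) * (?P * exp (- ?s * (\<delta> - 1))) / (1 - ?t\<^sup>2)"
        using dec_sol_left(1)[OF Ek, of "- \<delta>"] \<delta>1 unfolding Q P by (simp add: algebra_simps)
      then have "dec_u E (- \<delta>) = (1 + \<sigma> * ?t) * (?P * (e1 * r)) / ((1 - \<sigma> * ?t) * (1 + \<sigma> * ?t))"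
        unfolding t2 esL .
      moreover have "b * X / (a * b) * a = X" if "a \<ge> 1 / 2" "b \<ge> 1 / 2" for a b X :: real
        using that by simp
      ultimately show ?thesis using st0 st1 by metis
    qed
    have r: "1 \<le> r" "r \<le> 1 + 2 * (C * \<epsilon>)"
    proof -
      have z: "0 \<le> (k - ?s) * (\<delta> - 1)" using g(2) \<delta>1 by simp
      then show "1 \<le> r" by (simp add: r_def)
      have "r \<le> 1 + (k - ?s) * (\<delta> - 1) + ((k - ?s) * (\<delta> - 1))\<^sup>2"
        unfolding r_def by (rule exp_bound[OF z]) (use F(2,3) in linarith)
      also have "((k - ?s) * (\<delta> - 1))\<^sup>2 \<le> ((k - ?s) * (\<delta> - 1)) * 1"
        unfolding power2_eq_square using z F(2,3) by (intro mult_left_mono) auto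
      finally show "r \<le> 1 + 2 * (C * \<epsilon>)" using F(2) by linarith
    qed
    have "(dec_u E (- \<delta>) - c0 * e1) * (1 - \<sigma> * ?t) = e1 * (?P * (r - 1) + (?P - c0) + c0 * (\<sigma> * ?t))"
      using dec_u by (simp add: algebra_simps)
    then have "\<bar>dec_u E (- \<delta>) - c0 * e1\<bar> * (1 - \<sigma> * ?t) = e1 * \<bar>?P * (r - 1) + (?P - c0) + c0 * (\<sigma> * ?t)\<bar>"
      using st0 e1 by (metis abs_mult abs_of_nonneg abs_of_pos half_gt_zero_iff less_le_trans
          order_less_imp_le zero_less_one)
    also have "\<bar>?P * (r - 1) + (?P - c0) + c0 * (\<sigma> * ?t)\<bar> \<le> C * (2 * (C * \<epsilon>)) + C * \<epsilon> + c0 * (C * \<epsilon>)"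
    proof -
      have "\<bar>?P * (r - 1)\<bar> \<le> C * (2 * (C * \<epsilon>))"
        unfolding abs_mult using F(6,7) r C \<epsilon> by (intro mult_mono) auto
      moreover have "\<bar>c0 * (\<sigma> * ?t)\<bar> \<le> c0 * (C * \<epsilon>)"
        using c0 F(1) by (simp add: abs_mult \<sigma>1)
      ultimately show ?thesis using F(5) by linarith
    qed
    finally have "\<bar>dec_u E (- \<delta>) - c0 * e1\<bar> * (1 - \<sigma> * ?t) \<le> e1 * ((2 * C * C + C + c0 * C) * \<epsilon>)"
      using e1 by (simp add: algebra_simps)
    moreover have "\<bar>dec_u E (- \<delta>) - c0 * e1\<bar> * (1 / 2) \<le> \<bar>dec_u E (- \<delta>) - c0 * e1\<bar> * (1 - \<sigma> * ?t)"
      using st0 by (intro mult_left_mono) auto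
    moreover have "a \<le> 2 * X" if "a * y \<le> X" "a * (1 / 2) \<le> a * y" for a y X :: real
      using that by linarith
    ultimately have *: "\<bar>dec_u E (- \<delta>) - c0 * e1\<bar> \<le> 2 * (e1 * ((2 * C * C + C + c0 * C) * \<epsilon>))" by blast
    have e12: "e1 * e1 = exp (2 * k) * \<epsilon>" by (simp add: e1_def \<epsilon>_def exp_add[symmetric] algebra_simps)
    have "exp (- W \<delta>) * \<bar>dec_u E (- \<delta>) - exp (- W \<delta>)\<bar> \<le> c0 * e1 * (2 * (e1 * ((2 * C * C + C + c0 * C) * \<epsilon>)))"
      unfolding W\<delta> using * c0 e1 by (intro mult_left_mono) auto
    also have "\<dots> = 2 * c0 * (2 * C * C + C + c0 * C) * (e1 * e1) * \<epsilon>" by (simp add: mult_ac)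
    also have "\<dots> = (2 * c0 * (2 * C * C + C + c0 * C) * exp (2 * k)) * \<epsilon>\<^sup>2"
      unfolding e12 by (simp add: power2_eq_square mult_ac)
    finally show ?thesis by (simp only: B_def \<epsilon>_def)
  qed
  moreover have "B > 0" unfolding B_def
    using C c0 by (intro mult_pos_pos add_pos_pos) auto
  ultimately show ?thesis using D by (intro exI[of _ B] conjI exI[of _ D]) blast+
qed

end

section \<open>Expansions of energies and eigenfunctions\<close>

lemma norm_H_scaleR: "norm_H (\<lambda>x. c *\<^sub>R f x) = \<bar>c\<bar> * norm_H f"
  by (simp add: norm_H_eq power_mult_distrib real_sqrt_mult)

lemma L2_scaleR: "f \<in> L2 \<Longrightarrow> (\<lambda>x. c *\<^sub>R f x) \<in> L2"
  by (auto simp: L2_def power_mult_distrib)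

lemma norm_H_diff_commute: "norm_H (\<lambda>x. f x - g x) = norm_H (\<lambda>x. g x - f x)"
  by (simp add: norm_H_eq norm_minus_commute)

text \<open>
  Normalizing two nearby functions costs at most a factor \<open>4\<close> in the relative error.
\<close>

lemma normalized_comparison:
  assumes L: "f \<in> L2" "g \<in> L2" "(\<lambda>x. f x - g x) \<in> L2" and g: "norm_H g > 0"
    and d: "norm_H (\<lambda>x. f x - g x) \<le> d" "d \<le> norm_H g / 2"
  shows "norm_H f > 0"
    and "norm_H (\<lambda>x. (1 / norm_H f) *\<^sub>R f x - (1 / norm_H g) *\<^sub>R g x) \<le> 4 * d / norm_H g"
proof -
  let ?N = "norm_H f" and ?M = "norm_H g"
  have L': "(\<lambda>x. g x - f x) \<in> L2" using L2_scaleR[OF L(3), of "- 1"] by simp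
  have eq: "(\<lambda>x. f x + (g x - f x)) = g" "(\<lambda>x. g x + (f x - g x)) = f" by auto
  have "?M \<le> ?N + norm_H (\<lambda>x. g x - f x)"
    by (rule norm_H_triangle[OF L(1) L', unfolded eq(1)])
  moreover have "?N \<le> ?M + norm_H (\<lambda>x. f x - g x)"
    by (rule norm_H_triangle[OF L(2,3), unfolded eq(2)])
  ultimately have dN: "\<bar>?M - ?N\<bar> \<le> d" using d(1) norm_H_diff_commute[of f g] by linarith
  then have N: "?N \<ge> ?M / 2" using d(2) by linarith
  then show Npos: "?N > 0" using g by linarith
  have d0: "d \<ge> 0" using dN by linarith
  have "norm_H (\<lambda>x. (1 / ?N) *\<^sub>R (f x - g x) + (1 / ?N - 1 / ?M) *\<^sub>R g x)
      \<le> \<bar>1 / ?N\<bar> * norm_H (\<lambda>x. f x - g x) + \<bar>1 / ?N - 1 / ?M\<bar> * ?M"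
    using norm_H_triangle[OF L2_scaleR[OF L(3), of "1 / ?N"] L2_scaleR[OF L(2), of "1 / ?N - 1 / ?M"]]
    unfolding norm_H_scaleR .
  also have "(\<lambda>x. (1 / ?N) *\<^sub>R (f x - g x) + (1 / ?N - 1 / ?M) *\<^sub>R g x)
      = (\<lambda>x. (1 / ?N) *\<^sub>R f x - (1 / ?M) *\<^sub>R g x)"
    by (simp add: scaleR_diff_left scaleR_diff_right)
  also have "\<bar>1 / ?N - 1 / ?M\<bar> * ?M = \<bar>?M - ?N\<bar> / ?N"
  proof -
    have "1 / ?N - 1 / ?M = (?M - ?N) / (?N * ?M)" using Npos g by (simp add: field_simps)
    then show ?thesis using Npos g by (simp add: abs_mult abs_divide)
  qed
  also have "\<bar>1 / ?N\<bar> * norm_H (\<lambda>x. f x - g x) + \<bar>?M - ?N\<bar> / ?N \<le> d / ?N + d / ?N"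
    using Npos d(1) dN by (intro add_mono) (auto simp: divide_right_mono)
  also have "\<dots> = 2 * d / ?N" by simp
  also have "\<dots> \<le> 2 * d / (?M / 2)" using N g d0 by (intro divide_left_mono) auto
  finally show "norm_H (\<lambda>x. (1 / ?N) *\<^sub>R f x - (1 / ?M) *\<^sub>R g x) \<le> 4 * d / ?M" by simp
qed

lemma spinor_diff: "spinor a b - spinor c d = spinor (a - c) (b - d)"
  by (simp add: spinor_def scaleR_diff_left)

lemma spinor_scaleR: "c *\<^sub>R spinor a b = spinor (c * a) (c * b)"
  by (simp add: spinor_def scaleR_add_right)

lemma integral_translate:
  fixes f :: "real \<Rightarrow> real"
  shows "(\<integral>x. f (x + c) \<partial>lborel) = (\<integral>x. f x \<partial>lborel)"
  using lborel_integral_real_affine[of 1 f c] by (simp add: add.commute)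

lemma integrable_translate:
  fixes f :: "real \<Rightarrow> real"
  shows "integrable lborel f \<Longrightarrow> integrable lborel (\<lambda>x. f (x + c))"
  using lborel_integrable_real_affine[of f 1 c] by (simp add: add.commute)

context gapped_domain_wall
begin

text \<open>
  Integrating \<open>(exp (- W) w)' = E exp (- W) u\<close> over the half line to the right of the midpoint gives
  \<open>E J = - \<sigma> exp (- W \<delta>) u (- \<delta>)\<close>, where \<open>J\<close> is the integral of \<open>exp (- W) u\<close>. Replacing \<open>J\<close> by
  \<open>weight_mass\<close> and \<open>u (- \<delta>)\<close> by \<open>exp (- W \<delta>)\<close> are both errors of second order: \<open>E\<close> is small in the
  first case, and \<open>exp (- W \<delta>)\<close> in the second.
\<close>

lemma bound_state_energy_expansion:
  "\<exists>C>0. \<exists>D\<ge>1. \<forall>\<delta>>D. \<forall>\<sigma> E. \<sigma>\<^sup>2 = 1 \<longrightarrow> \<bar>E\<bar> \<le> K \<longrightarrow> matching \<sigma> E \<delta> \<longrightarrow>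
     \<bar>E + \<sigma> * (1 / weight_mass * exp (- 2 * W \<delta>))\<bar> \<le> C * (eps \<delta>)\<^sup>2"
proof -
  obtain C1 where C1: "C1 > 0" "\<And>\<delta> \<sigma> E. \<delta> > 1 \<Longrightarrow> \<sigma>\<^sup>2 = 1 \<Longrightarrow> \<bar>E\<bar> \<le> K \<Longrightarrow> matching \<sigma> E \<delta> \<Longrightarrow> \<bar>E\<bar> \<le> C1 * eps \<delta>"
    using bound_state_energy_small by blast
  obtain C2 D2 where C2: "C2 > 0" "D2 \<ge> 1" "\<And>\<delta> \<sigma> E x. \<delta> > D2 \<Longrightarrow> \<sigma>\<^sup>2 = 1 \<Longrightarrow> \<bar>E\<bar> \<le> K \<Longrightarrow> matching \<sigma> E \<delta> \<Longrightarrow> x \<ge> 0 \<Longrightarrow>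
     \<bar>dec_u E (x - \<delta>) - exp (- W (x - \<delta>))\<bar>
       \<le> C2 * eps \<delta> * (exp (- (k / 4) * \<bar>x - \<delta>\<bar>) + exp (- (k / 4) * \<bar>x\<bar>)) \<and>
     \<bar>dec_w E (x - \<delta>) - \<sigma> * exp (- W (x + \<delta>))\<bar>
       \<le> C2 * eps \<delta> * (exp (- (k / 4) * \<bar>x - \<delta>\<bar>) + exp (- (k / 4) * \<bar>x\<bar>))"
    using dec_sol_comparison by metis
  obtain C3 D3 where C3: "C3 > 0" "D3 \<ge> 1" "\<And>\<delta> \<sigma> E. \<delta> > D3 \<Longrightarrow> \<sigma>\<^sup>2 = 1 \<Longrightarrow> \<bar>E\<bar> \<le> K \<Longrightarrow> matching \<sigma> E \<delta> \<Longrightarrow>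
     exp (- W \<delta>) * \<bar>dec_u E (- \<delta>) - exp (- W \<delta>)\<bar> \<le> C3 * (eps \<delta>)\<^sup>2"
    using dec_sol_at_minus_delta by metis
  obtain A where A: "A > 0" "\<And>y. exp (- W y) \<le> A * exp (- k * \<bar>y\<bar>)" using exp_W_bound by blast
  have A': "exp (- W y) \<le> A" for y
    by (rule order_trans[OF A(2)]) (use A(1) k_pos in \<open>simp add: mult_le_cancel_left1\<close>)
  define M1 where "M1 = (\<integral>y. exp (- W y) \<partial>lborel)"
  define M2 where "M2 = (\<integral>y. exp (- (2 * k) * \<bar>y\<bar>) \<partial>lborel)"
  have M0: "M1 \<ge> 0" "M2 \<ge> 0" by (simp_all add: M1_def M2_def)
  define B where "B = (C1 * (2 * C2 * M1 + A\<^sup>2 * M2) + C3) / weight_mass"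
  have main: "\<bar>E + \<sigma> * (1 / weight_mass * exp (- 2 * W \<delta>))\<bar> \<le> B * (eps \<delta>)\<^sup>2"
    if \<delta>: "\<delta> > max D2 D3" and \<sigma>: "\<sigma>\<^sup>2 = 1" and E: "\<bar>E\<bar> \<le> K" and b: "matching \<sigma> E \<delta>" for \<delta> \<sigma> E
  proof -
    define \<epsilon> where "\<epsilon> = eps \<delta>"
    have \<delta>D: "\<delta> > D2" "\<delta> > D3" "\<delta> > 1" using \<delta> C2(2) by auto
    have \<epsilon>: "\<epsilon> > 0" "\<epsilon> \<le> 1" using \<delta>D(3) k_pos by (simp_all add: \<epsilon>_def mult_le_0_iff)
    have \<sigma>1: "\<bar>\<sigma>\<bar> = 1" using \<sigma> by (simp add: abs_square_eq_1)
    have e2: "exp (- (k / 4) * \<bar>x - \<delta>\<bar>) + exp (- (k / 4) * \<bar>x\<bar>) \<le> 2" for x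
    proof -
      have "exp (- (k / 4) * \<bar>z\<bar>) \<le> 1" for z using k_pos by (simp add: mult_nonneg_nonneg)
      from this[of "x - \<delta>"] this[of x] show ?thesis by linarith
    qed
    have cmp: "\<bar>dec_u E y - exp (- W y)\<bar> \<le> 2 * C2 * \<epsilon>" "\<bar>dec_w E y\<bar> \<le> 2 * C2 * \<epsilon> + A" if y: "y \<ge> - \<delta>" for y
    proof -
      have x: "y + \<delta> \<ge> 0" using y by simp
      note c = C2(3)[OF \<delta>D(1) \<sigma> E b x, folded \<epsilon>_def]
      have le: "C2 * \<epsilon> * (exp (- (k / 4) * \<bar>y + \<delta> - \<delta>\<bar>) + exp (- (k / 4) * \<bar>y + \<delta>\<bar>)) \<le> C2 * \<epsilon> * 2"
        using C2(1) \<epsilon>(1) by (intro mult_left_mono e2) auto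
      show "\<bar>dec_u E y - exp (- W y)\<bar> \<le> 2 * C2 * \<epsilon>" using c le by simp
      have "\<bar>\<sigma> * exp (- W (y + \<delta> + \<delta>))\<bar> \<le> A" using A'[of "y + \<delta> + \<delta>"] by (simp add: abs_mult \<sigma>1)
      moreover have "\<bar>dec_w E y - \<sigma> * exp (- W (y + \<delta> + \<delta>))\<bar> \<le> 2 * C2 * \<epsilon>" using c le by simp
      ultimately show "\<bar>dec_w E y\<bar> \<le> 2 * C2 * \<epsilon> + A" by linarith
    qed
    let ?f = "\<lambda>y. exp (- W y) * dec_u E y"
    have fc: "continuous_on UNIV ?f" by (intro continuous_intros W_continuous dec_sol_continuous)
    have [measurable]: "?f \<in> borel_measurable borel" "W \<in> borel_measurable borel"
      using fc W_continuous by (auto intro: borel_measurable_continuous_onI)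
    have fi: "integrable lborel (\<lambda>y. indicator {-\<delta>..} y * ?f y)"
    proof (rule Bochner_Integration.integrable_bound)
      show "integrable lborel (\<lambda>y. (A + 2 * C2 * \<epsilon>) * exp (- W y))"
        by (intro integrable_mult_right W_weight_integrable)
      have "\<bar>?f y\<bar> \<le> exp (- W y) * (A + 2 * C2 * \<epsilon>)" if "y \<ge> - \<delta>" for y
      proof -
        have "\<bar>dec_u E y\<bar> \<le> A + 2 * C2 * \<epsilon>"
          using cmp(1)[OF that] A'[of y] exp_gt_zero[of "- W y"] by linarith
        then show ?thesis unfolding abs_mult by (intro mult_mono) auto
      qed
      then show "AE y in lborel. norm (indicator {-\<delta>..} y * ?f y) \<le> norm ((A + 2 * C2 * \<epsilon>) * exp (- W y))"
        using A(1) C2(1) \<epsilon>(1) by (intro AE_I2) (auto simp: indicator_def mult.commute)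
    qed measurable
    define J where "J = (\<integral>y. indicator {-\<delta>..} y * ?f y \<partial>lborel)"
    have J: "E * J = - (exp (- W \<delta>) * dec_w E (- \<delta>))"
    proof -
      have "(\<integral>y. indicator {-\<delta>..} y * (E * ?f y) \<partial>lborel) = - (exp (- W (- \<delta>)) * dec_w E (- \<delta>))"
      proof (rule integral_derivative_half_line[OF k_pos weighted_w_deriv])
        show "continuous_on UNIV (\<lambda>y. E * ?f y)" by (intro continuous_intros fc)
        show "integrable lborel (\<lambda>y. indicator {- \<delta>..} y * (E * ?f y))"
          using integrable_mult_right[OF fi, of E] by (simp add: mult.left_commute)
        show "\<bar>exp (- W y) * dec_w E y\<bar> \<le> (A * (2 * C2 * \<epsilon> + A)) * exp (- k * \<bar>y\<bar>)" if "y \<ge> - \<delta>" for y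
        proof -
          have "\<bar>exp (- W y) * dec_w E y\<bar> \<le> (A * exp (- k * \<bar>y\<bar>)) * (2 * C2 * \<epsilon> + A)"
            unfolding abs_mult using A(2)[of y] cmp(2)[OF that] A(1) by (intro mult_mono) auto
          then show ?thesis by (simp add: mult_ac)
        qed
      qed
      moreover have "(\<integral>y. indicator {-\<delta>..} y * (E * ?f y) \<partial>lborel) = E * J"
        unfolding J_def by (simp add: mult.left_commute[of _ E])
      ultimately show ?thesis by (simp add: W_even)
    qed
    have diff: "\<bar>weight_mass - J\<bar> \<le> (2 * C2 * M1 + A\<^sup>2 * M2) * \<epsilon>"
    proof -
      let ?d = "\<lambda>y. (exp (- W y))\<^sup>2 - indicator {-\<delta>..} y * ?f y"
      let ?b = "\<lambda>y. 2 * C2 * \<epsilon> * exp (- W y) + A\<^sup>2 * \<epsilon> * exp (- (2 * k) * \<bar>y + \<delta>\<bar>)"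
      have di: "integrable lborel ?d" by (intro Bochner_Integration.integrable_diff W_weight_integrable fi)
      have ti: "integrable lborel (\<lambda>y. exp (- (2 * k) * \<bar>y + \<delta>\<bar>))"
        using integrable_translate[OF integrable_exp_minus_abs[of "2 * k"], of \<delta>] k_pos by simp
      have bi: "integrable lborel ?b"
        by (intro Bochner_Integration.integrable_add integrable_mult_right W_weight_integrable ti)
      have le: "\<bar>?d y\<bar> \<le> ?b y" for y
      proof (cases "y \<ge> - \<delta>")
        case True
        then have "?d y = exp (- W y) * (exp (- W y) - dec_u E y)"
          by (simp add: power2_eq_square right_diff_distrib)
        then have "\<bar>?d y\<bar> = exp (- W y) * \<bar>dec_u E y - exp (- W y)\<bar>" by (simp add: abs_mult abs_minus_commute)
        also have "\<dots> \<le> exp (- W y) * (2 * C2 * \<epsilon>)" using cmp(1)[OF True] by (intro mult_left_mono) auto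
        also have "\<dots> \<le> ?b y" using \<epsilon>(1) by simp
        finally show ?thesis .
      next
        case False
        have "2 * (- k * \<bar>y\<bar>) = - 2 * k * \<delta> + - (2 * k) * \<bar>y + \<delta>\<bar>"
          using False \<delta>D(3) by (simp add: algebra_simps)
        then have e: "exp (2 * (- k * \<bar>y\<bar>)) = \<epsilon> * exp (- (2 * k) * \<bar>y + \<delta>\<bar>)"
          by (simp only: exp_add \<epsilon>_def)
        have "(exp (- W y))\<^sup>2 \<le> (A * exp (- k * \<bar>y\<bar>))\<^sup>2" by (intro power_mono A) simp
        also have "\<dots> = A\<^sup>2 * exp (2 * (- k * \<bar>y\<bar>))" by (simp only: power_mult_distrib exp_double)
        also have "\<dots> = A\<^sup>2 * \<epsilon> * exp (- (2 * k) * \<bar>y + \<delta>\<bar>)" by (simp only: e mult.assoc)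
        also have "\<dots> \<le> ?b y" using C2(1) \<epsilon>(1) by simp
        finally show ?thesis using False by simp
      qed
      have mJ: "weight_mass - J = (\<integral>y. ?d y \<partial>lborel)"
        unfolding weight_mass_def J_def by (simp add: W_weight_integrable fi)
      have "\<bar>weight_mass - J\<bar> \<le> (\<integral>y. \<bar>?d y\<bar> \<partial>lborel)" unfolding mJ by (rule integral_abs_bound)
      also have "\<dots> \<le> (\<integral>y. ?b y \<partial>lborel)" using le by (intro integral_mono bi) (use di in auto)
      also have "\<dots> = 2 * C2 * \<epsilon> * M1 + A\<^sup>2 * \<epsilon> * M2"
        using integral_translate[of "\<lambda>y. exp (- (2 * k) * \<bar>y\<bar>)" \<delta>] W_weight_integrable(1) ti
        by (simp add: M1_def M2_def)
      finally show ?thesis by (simp add: algebra_simps)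
    qed
    have mE: "weight_mass * E + \<sigma> * (exp (- W \<delta>))\<^sup>2
        = E * (weight_mass - J) - \<sigma> * (exp (- W \<delta>) * (dec_u E (- \<delta>) - exp (- W \<delta>)))"
    proof -
      have "dec_w E (- \<delta>) = \<sigma> * dec_u E (- \<delta>)" using b by (simp add: matching_def)
      then have "E * J = - \<sigma> * (exp (- W \<delta>) * dec_u E (- \<delta>))" using J by simp
      then show ?thesis by (simp add: algebra_simps power2_eq_square)
    qed
    have "\<bar>weight_mass * E + \<sigma> * (exp (- W \<delta>))\<^sup>2\<bar> \<le> (C1 * \<epsilon>) * ((2 * C2 * M1 + A\<^sup>2 * M2) * \<epsilon>) + C3 * \<epsilon>\<^sup>2"
      unfolding mE
    proof (rule order_trans[OF abs_triangle_ineq4 add_mono])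
      show "\<bar>E * (weight_mass - J)\<bar> \<le> (C1 * \<epsilon>) * ((2 * C2 * M1 + A\<^sup>2 * M2) * \<epsilon>)"
        unfolding abs_mult using C1(2)[OF \<delta>D(3) \<sigma> E b] diff C1(1) \<epsilon>(1) by (intro mult_mono) (auto simp: \<epsilon>_def)
      show "\<bar>\<sigma> * (exp (- W \<delta>) * (dec_u E (- \<delta>) - exp (- W \<delta>)))\<bar> \<le> C3 * \<epsilon>\<^sup>2"
        using C3(3)[OF \<delta>D(2) \<sigma> E b] by (simp add: abs_mult \<sigma>1 \<epsilon>_def)
    qed
    also have "\<dots> = weight_mass * (B * \<epsilon>\<^sup>2)"
    proof -
      have "weight_mass * B = C1 * (2 * C2 * M1 + A\<^sup>2 * M2) + C3" using weight_mass_pos by (simp add: B_def)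
      then have "weight_mass * (B * \<epsilon>\<^sup>2) = (C1 * (2 * C2 * M1 + A\<^sup>2 * M2) + C3) * \<epsilon>\<^sup>2"
        by (simp only: mult.assoc[symmetric])
      then show ?thesis by (simp add: power2_eq_square algebra_simps)
    qed
    finally have *: "\<bar>weight_mass * E + \<sigma> * (exp (- W \<delta>))\<^sup>2\<bar> \<le> weight_mass * (B * \<epsilon>\<^sup>2)" .
    have "weight_mass * (E + \<sigma> * (1 / weight_mass * exp (- 2 * W \<delta>))) = weight_mass * E + \<sigma> * (exp (- W \<delta>))\<^sup>2"
      using weight_mass_pos by (simp add: distrib_left exp_double[symmetric])
    then have "weight_mass * \<bar>E + \<sigma> * (1 / weight_mass * exp (- 2 * W \<delta>))\<bar> \<le> weight_mass * (B * \<epsilon>\<^sup>2)"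
      using * weight_mass_pos by (metis abs_mult abs_of_pos)
    then show ?thesis using weight_mass_pos by (simp add: \<epsilon>_def)
  qed
  have "B > 0" unfolding B_def
    using C1(1) C2(1) C3(1) M0 weight_mass_pos by (intro divide_pos_pos add_nonneg_pos mult_nonneg_nonneg
        add_nonneg_nonneg) auto
  then show ?thesis using main C2(2)
    by (intro exI[of _ B] conjI exI[of _ "max D2 D3"]) (auto simp: le_max_iff_disj)
qed

text \<open>
  The pointwise comparison is extended to the left half line by the mirror symmetry that the glued
  solution and its approximation share.
\<close>

lemma bound_state_comparison:
  "\<exists>C>0. \<exists>D\<ge>1. \<forall>\<delta>>D. \<forall>\<sigma> E. \<sigma>\<^sup>2 = 1 \<longrightarrow> \<bar>E\<bar> \<le> K \<longrightarrow> matching \<sigma> E \<delta> \<longrightarrow>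
     norm_H (\<lambda>x. spinor (glued_u \<sigma> E \<delta> x) (glued_w \<sigma> E \<delta> x)
       - spinor (exp (- W (x - \<delta>))) (\<sigma> * exp (- W (x + \<delta>)))) \<le> C * eps \<delta>"
proof -
  obtain C D where C: "C > 0" "D \<ge> 1" "\<And>\<delta> \<sigma> E x. \<delta> > D \<Longrightarrow> \<sigma>\<^sup>2 = 1 \<Longrightarrow> \<bar>E\<bar> \<le> K \<Longrightarrow> matching \<sigma> E \<delta> \<Longrightarrow> x \<ge> 0 \<Longrightarrow>
     \<bar>dec_u E (x - \<delta>) - exp (- W (x - \<delta>))\<bar>
       \<le> C * eps \<delta> * (exp (- (k / 4) * \<bar>x - \<delta>\<bar>) + exp (- (k / 4) * \<bar>x\<bar>)) \<and>
     \<bar>dec_w E (x - \<delta>) - \<sigma> * exp (- W (x + \<delta>))\<bar>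
       \<le> C * eps \<delta> * (exp (- (k / 4) * \<bar>x - \<delta>\<bar>) + exp (- (k / 4) * \<bar>x\<bar>))"
    using dec_sol_comparison by metis
  define I where "I = (\<integral>x. (exp (- (k / 2) * \<bar>x\<bar>)) \<partial>lborel)"
  have I0: "I \<ge> 0" by (simp add: I_def)
  have ei: "integrable lborel (\<lambda>x. exp (- (k / 2) * \<bar>x + c\<bar>))" for c
    using integrable_translate[OF integrable_exp_minus_abs[of "k / 2"], of c] k_pos by simp
  have eI: "(\<integral>x. exp (- (k / 2) * \<bar>x + c\<bar>) \<partial>lborel) = I" for c
    using integral_translate[of "\<lambda>y. exp (- (k / 2) * \<bar>y\<bar>)" c] by (simp add: I_def)
  have main: "norm_H (\<lambda>x. spinor (glued_u \<sigma> E \<delta> x) (glued_w \<sigma> E \<delta> x)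
       - spinor (exp (- W (x - \<delta>))) (\<sigma> * exp (- W (x + \<delta>)))) \<le> (6 * C * sqrt I + 1) * eps \<delta>"
    if \<delta>: "\<delta> > D" and \<sigma>: "\<sigma>\<^sup>2 = 1" and E: "\<bar>E\<bar> \<le> K" and b: "matching \<sigma> E \<delta>" for \<delta> \<sigma> E
  proof -
    define \<epsilon> where "\<epsilon> = eps \<delta>"
    have \<epsilon>: "\<epsilon> > 0" by (simp add: \<epsilon>_def)
    have \<sigma>1: "\<bar>\<sigma>\<bar> = 1" using \<sigma> by (simp add: abs_square_eq_1)
    have ss: "\<sigma> * (\<sigma> * a) = a" for a using \<sigma> by (simp add: power2_eq_square mult.assoc[symmetric])
    let ?e = "\<lambda>x. exp (- (k / 4) * \<bar>x\<bar>)"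
    let ?E = "\<lambda>x. ?e (x + - \<delta>) + ?e (x + \<delta>) + ?e (x + 0)"
    let ?a = "\<lambda>x. glued_u \<sigma> E \<delta> x - exp (- W (x - \<delta>))" and ?b = "\<lambda>x. glued_w \<sigma> E \<delta> x - \<sigma> * exp (- W (x + \<delta>))"
    have p: "\<bar>?a x\<bar> \<le> C * \<epsilon> * ?E x \<and> \<bar>?b x\<bar> \<le> C * \<epsilon> * ?E x" for x
    proof (cases "x \<ge> 0")
      case True
      have "C * \<epsilon> * (?e (x - \<delta>) + ?e x) \<le> C * \<epsilon> * ?E x"
        using C(1) \<epsilon> by (intro mult_left_mono) auto
      then show ?thesis
        using C(3)[OF \<delta> \<sigma> E b True, folded \<epsilon>_def] True by (simp add: glued_u_def glued_w_def)
    next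
      case False
      then have x: "- x \<ge> 0" by simp
      note c = C(3)[OF \<delta> \<sigma> E b x, folded \<epsilon>_def]
      have le: "C * \<epsilon> * (?e (- x - \<delta>) + ?e (- x)) \<le> C * \<epsilon> * ?E x"
      proof -
        have "\<bar>- x - \<delta>\<bar> = \<bar>x + \<delta>\<bar>" by linarith
        then show ?thesis using C(1) \<epsilon> by (intro mult_left_mono) auto
      qed
      have "?a x = \<sigma> * (dec_w E (- x - \<delta>) - \<sigma> * exp (- W (- x + \<delta>)))"
        using False W_even[of "x - \<delta>"] by (simp add: glued_u_def right_diff_distrib ss)
      then have 1: "\<bar>?a x\<bar> = \<bar>dec_w E (- x - \<delta>) - \<sigma> * exp (- W (- x + \<delta>))\<bar>" by (simp only: abs_mult \<sigma>1 mult_1)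
      have "?b x = \<sigma> * (dec_u E (- x - \<delta>) - exp (- W (- x - \<delta>)))"
        using False W_even[of "x + \<delta>"] by (simp add: glued_w_def right_diff_distrib)
      then have 2: "\<bar>?b x\<bar> = \<bar>dec_u E (- x - \<delta>) - exp (- W (- x - \<delta>))\<bar>" by (simp only: abs_mult \<sigma>1 mult_1)
      show ?thesis unfolding 1 2 using c le by linarith
    qed
    let ?g = "\<lambda>x. 12 * (C * \<epsilon>)\<^sup>2 * (exp (- (k / 2) * \<bar>x + - \<delta>\<bar>) + exp (- (k / 2) * \<bar>x + \<delta>\<bar>) + exp (- (k / 2) *
        \<bar>x + 0\<bar>))"
    have gi: "integrable lborel ?g"
      by (intro integrable_mult_right Bochner_Integration.integrable_add ei)
    have sq: "(norm (spinor (glued_u \<sigma> E \<delta> x) (glued_w \<sigma> E \<delta> x) - spinor (exp (- W (x - \<delta>))) (\<sigma> * exp (- W (x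
        + \<delta>)))))\<^sup>2 \<le> ?g x" for x
    proof -
      have "\<bar>?a x\<bar>\<^sup>2 \<le> (C * \<epsilon> * ?E x)\<^sup>2" "\<bar>?b x\<bar>\<^sup>2 \<le> (C * \<epsilon> * ?E x)\<^sup>2"
        using power_mono[OF conjunct1[OF p[of x]] abs_ge_zero] power_mono[OF conjunct2[OF p[of x]]
            abs_ge_zero] .
      then have "2 * ((?a x)\<^sup>2 + (?b x)\<^sup>2) \<le> 4 * (C * \<epsilon>)\<^sup>2 * (?E x)\<^sup>2"
        by (simp add: power_mult_distrib)
      also have "\<dots> \<le> 4 * (C * \<epsilon>)\<^sup>2 * (3 * (exp (- (k / 2) * \<bar>x + - \<delta>\<bar>) + exp (- (k / 2) * \<bar>x + \<delta>\<bar>) + exp (- (k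
          / 2) * \<bar>x + 0\<bar>)))"
      proof (rule mult_left_mono)
        have e: "(?e z)\<^sup>2 = exp (- (k / 2) * \<bar>z\<bar>)" for z
        proof -
          have "(?e z)\<^sup>2 = exp (2 * (- (k / 4) * \<bar>z\<bar>))" by (simp only: exp_double)
          then show ?thesis by simp
        qed
        have "(a + b + c)\<^sup>2 \<le> 3 * (a\<^sup>2 + b\<^sup>2 + c\<^sup>2)" for a b c :: real
          using sum_squares_bound[of a b] sum_squares_bound[of b c] sum_squares_bound[of a c]
          by (simp add: power2_eq_square algebra_simps)
        from this[of "?e (x + - \<delta>)" "?e (x + \<delta>)" "?e (x + 0)"]
        show "(?E x)\<^sup>2 \<le> 3 * (exp (- (k / 2) * \<bar>x + - \<delta>\<bar>) + exp (- (k / 2) * \<bar>x + \<delta>\<bar>) + exp (- (k / 2) * \<bar>x +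
            0\<bar>))"
          unfolding e .
      qed simp
      also have "\<dots> = ?g x" by simp
      finally show ?thesis unfolding spinor_diff norm_spinor_sq .
    qed
    have "(\<integral>x. (norm (spinor (glued_u \<sigma> E \<delta> x) (glued_w \<sigma> E \<delta> x) - spinor (exp (- W (x - \<delta>))) (\<sigma> * exp (- W (x
        + \<delta>)))))\<^sup>2 \<partial>lborel)
        \<le> (\<integral>x. ?g x \<partial>lborel)"
      using sq by (intro integral_mono' gi) (auto intro: order_trans[OF zero_le_power2 sq])
    also have "\<dots> = 36 * (C * \<epsilon>)\<^sup>2 * I"
    proof -
      have "(\<integral>x. ?g x \<partial>lborel) = 12 * (C * \<epsilon>)\<^sup>2 * (\<integral>x. exp (- (k / 2) * \<bar>x + - \<delta>\<bar>) + exp (- (k / 2) * \<bar>x + \<delta>\<bar>)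
          + exp (- (k / 2) * \<bar>x + 0\<bar>) \<partial>lborel)"
        by (rule integral_mult_right_zero)
      also have "(\<integral>x. exp (- (k / 2) * \<bar>x + - \<delta>\<bar>) + exp (- (k / 2) * \<bar>x + \<delta>\<bar>) + exp (- (k / 2) * \<bar>x + 0\<bar>)
          \<partial>lborel) = I + I + I"
        by (subst Bochner_Integration.integral_add, intro Bochner_Integration.integrable_add ei, rule ei,
            subst Bochner_Integration.integral_add, rule ei, rule ei) (simp only: eI)
      finally show ?thesis by simp
    qed
    also have "\<dots> = (6 * C * \<epsilon> * sqrt I)\<^sup>2" using I0 by (simp add: power_mult_distrib)
    finally have "norm_H (\<lambda>x. spinor (glued_u \<sigma> E \<delta> x) (glued_w \<sigma> E \<delta> x) - spinor (exp (- W (x - \<delta>))) (\<sigma> * exp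
        (- W (x + \<delta>)))) \<le> 6 * C * \<epsilon> * sqrt I"
      unfolding norm_H_eq by (rule real_le_lsqrt[rotated]) (use C(1) \<epsilon> I0 in auto)
    also have "\<dots> \<le> (6 * C * sqrt I + 1) * \<epsilon>" using \<epsilon> by (simp add: algebra_simps)
    finally show ?thesis unfolding \<epsilon>_def .
  qed
  have "6 * C * sqrt I + 1 > 0" using C(1) I0 by (simp add: add_nonneg_pos)
  then show ?thesis using main C(2) by (intro exI[of _ "6 * C * sqrt I + 1"] conjI exI[of _ D]) blast+
qed

lemma approximate_state:
  assumes \<sigma>: "\<sigma>\<^sup>2 = 1"
  defines "T \<equiv> \<lambda>\<delta> x. spinor (exp (- W (x - \<delta>))) (\<sigma> * exp (- W (x + \<delta>)))"
  shows "T \<delta> \<in> L2" "norm_H (T \<delta>) = 2 * sqrt weight_mass"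
proof -
  have i: "integrable lborel (\<lambda>x. (exp (- W (x + c)))\<^sup>2)" for c
    using integrable_translate[OF W_weight_integrable(2)] .
  have m: "(\<integral>x. (exp (- W (x + c)))\<^sup>2 \<partial>lborel) = weight_mass" for c
    using integral_translate[of "\<lambda>x. (exp (- W x))\<^sup>2" c] by (simp add: weight_mass_def)
  have W: "continuous_on UNIV (\<lambda>x. W (x + c))" for c
    by (intro continuous_on_compose2[OF W_continuous[of UNIV]] continuous_intros) auto
  show "T \<delta> \<in> L2"
    unfolding T_def
  proof (rule spinor_L2)
    show "continuous_on UNIV (\<lambda>x. exp (- W (x - \<delta>)))" "continuous_on UNIV (\<lambda>x. \<sigma> * exp (- W (x + \<delta>)))"
      using W[of "- \<delta>"] W[of \<delta>] by (auto intro!: continuous_intros)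
    show "integrable lborel (\<lambda>x. (exp (- W (x - \<delta>)))\<^sup>2 + (\<sigma> * exp (- W (x + \<delta>)))\<^sup>2)"
      using i[of "- \<delta>"] i[of \<delta>] \<sigma> by (simp add: power_mult_distrib)
  qed
  have "(\<integral>x. (norm (T \<delta> x))\<^sup>2 \<partial>lborel) = 2 * (weight_mass + weight_mass)"
    unfolding T_def norm_spinor_sq using i[of "- \<delta>"] i[of \<delta>] m[of "- \<delta>"] m[of \<delta>] \<sigma>
    by (simp add: power_mult_distrib)
  then show "norm_H (T \<delta>) = 2 * sqrt weight_mass"
    unfolding norm_H_eq by (simp add: real_sqrt_mult)
qed

text \<open>
  The approximation has norm \<open>2 sqrt weight_mass\<close>, so it only remains to normalize.
\<close>

lemma bound_state_eigenfunction:
  "\<exists>C>0. \<exists>D\<ge>1. \<forall>\<delta>>D. \<forall>\<sigma> E. \<sigma>\<^sup>2 = 1 \<longrightarrow> \<bar>E\<bar> \<le> K \<longrightarrow> matching \<sigma> E \<delta> \<longrightarrow>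
     (\<exists>\<alpha>. eigenfunction (two_wall \<kappa> \<delta>) E \<alpha> \<and> norm_H \<alpha> = 1 \<and>
       norm_H (\<lambda>x. \<alpha> x - (1 / (2 * sqrt weight_mass)) *\<^sub>R spinor (exp (- W (x - \<delta>))) (\<sigma> * exp (- W (x + \<delta>))))
         \<le> C * eps \<delta>)"
proof -
  obtain C D where CD: "C > 0" "D \<ge> 1" and cmp: "\<forall>\<delta>>D. \<forall>\<sigma> E. \<sigma>\<^sup>2 = 1 \<longrightarrow> \<bar>E\<bar> \<le> K \<longrightarrow> matching \<sigma> E \<delta> \<longrightarrow>
     norm_H (\<lambda>x. spinor (glued_u \<sigma> E \<delta> x) (glued_w \<sigma> E \<delta> x)
       - spinor (exp (- W (x - \<delta>))) (\<sigma> * exp (- W (x + \<delta>)))) \<le> C * eps \<delta>"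
    using bound_state_comparison by blast
  note C = CD cmp[rule_format]
  let ?N0 = "2 * sqrt weight_mass"
  have N0: "?N0 > 0" using weight_mass_pos by simp
  obtain D' where D': "D' \<ge> 1" "\<And>\<delta>. \<delta> > D' \<Longrightarrow> exp (- (2 * k) * (\<delta> - 1)) < ?N0 / (2 * C)"
    using exp_eventually_small[of "?N0 / (2 * C)" "2 * k"] k_pos N0 C(1) by auto
  have main: "\<exists>\<alpha>. eigenfunction (two_wall \<kappa> \<delta>) E \<alpha> \<and> norm_H \<alpha> = 1 \<and>
       norm_H (\<lambda>x. \<alpha> x - (1 / ?N0) *\<^sub>R spinor (exp (- W (x - \<delta>))) (\<sigma> * exp (- W (x + \<delta>))))
         \<le> (4 * C / ?N0) * eps \<delta>"
    if \<delta>: "\<delta> > max D D'" and \<sigma>: "\<sigma>\<^sup>2 = 1" and E: "\<bar>E\<bar> \<le> K" and b: "matching \<sigma> E \<delta>" for \<delta> \<sigma> E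
  proof -
    have \<delta>D: "\<delta> > D" "\<delta> > D'" using \<delta> by auto
    note Ek = in_gap[OF E]
    let ?S = "\<lambda>x. spinor (glued_u \<sigma> E \<delta> x) (glued_w \<sigma> E \<delta> x)"
    let ?T = "\<lambda>x. spinor (exp (- W (x - \<delta>))) (\<sigma> * exp (- W (x + \<delta>)))"
    note ode = two_wall_solution[OF \<sigma> b]
    have SL: "?S \<in> L2" by (rule spinor_L2[OF dirac_ode_continuous[OF ode] two_wall_L2[OF \<sigma> Ek b]])
    note T = approximate_state[OF \<sigma>, of \<delta>]
    have dL: "(\<lambda>x. ?S x - ?T x) \<in> L2"
    proof -
      have m: "?S \<in> borel_measurable lborel" "?T \<in> borel_measurable lborel" 
        and i: "integrable lborel (\<lambda>x. (norm (?S x))\<^sup>2)" "integrable lborel (\<lambda>x. (norm (?T x))\<^sup>2)"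
        using SL T(1) by (auto simp: L2_def)
      have m': "(\<lambda>x. ?S x - ?T x) \<in> borel_measurable lborel" using m by (rule borel_measurable_diff)
      have "integrable lborel (\<lambda>x. (norm (?S x - ?T x))\<^sup>2)"
      proof (rule Bochner_Integration.integrable_bound)
        show "integrable lborel (\<lambda>x. 2 * (norm (?S x))\<^sup>2 + 2 * (norm (?T x))\<^sup>2)"
          by (intro Bochner_Integration.integrable_add integrable_mult_right i)
        show "(\<lambda>x. (norm (?S x - ?T x))\<^sup>2) \<in> borel_measurable lborel" using m' by measurable
        have "(norm (?S x - ?T x))\<^sup>2 \<le> 2 * (norm (?S x))\<^sup>2 + 2 * (norm (?T x))\<^sup>2" for x
        proof -
          have "(norm (?S x - ?T x))\<^sup>2 \<le> (norm (?S x) + norm (?T x))\<^sup>2"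
            by (intro power_mono norm_triangle_ineq4) simp
          then show ?thesis using sum_squares_bound[of "norm (?S x)" "norm (?T x)"]
            by (simp add: power2_sum)
        qed
        then show "AE x in lborel. norm ((norm (?S x - ?T x))\<^sup>2)
            \<le> norm (2 * (norm (?S x))\<^sup>2 + 2 * (norm (?T x))\<^sup>2)"
          by (intro AE_I2) auto
      qed
      then show ?thesis using m' by (simp add: L2_def)
    qed
    have small: "C * eps \<delta> \<le> norm_H ?T / 2"
    proof -
      have "eps \<delta> \<le> exp (- (2 * k) * (\<delta> - 1))" using k_pos by (simp add: algebra_simps)
      also have "\<dots> \<le> ?N0 / (2 * C)" using D'(2)[OF \<delta>D(2)] by simp
      finally have "C * eps \<delta> \<le> C * (?N0 / (2 * C))" using C(1) by (intro mult_left_mono) auto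
      then show ?thesis unfolding T(2) using C(1) by simp
    qed
    have Tp: "norm_H ?T > 0" unfolding T(2) by (rule N0)
    note nc = normalized_comparison[OF SL T(1) dL Tp C(3)[OF \<delta>D(1) \<sigma> E b] small]
    define c where "c = 1 / norm_H ?S"
    have c: "c > 0" using nc(1) by (simp add: c_def)
    let ?\<alpha> = "\<lambda>x. c *\<^sub>R ?S x"
    have "eigenfunction (two_wall \<kappa> \<delta>) E (\<lambda>x. spinor (c * glued_u \<sigma> E \<delta> x) (c * glued_w \<sigma> E \<delta> x))"
    proof (rule dirac_ode_eigenfunction[OF two_wall_continuous two_wall_bound, where ?x0.0 = 0])
      show "dirac_ode (two_wall \<kappa> \<delta>) E UNIV (\<lambda>x. c * glued_u \<sigma> E \<delta> x) (\<lambda>x. c * glued_w \<sigma> E \<delta> x)"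
        using dirac_ode_linear[OF ode ode, of c 0] by simp
      show "integrable lborel (\<lambda>x. (c * glued_u \<sigma> E \<delta> x)\<^sup>2 + (c * glued_w \<sigma> E \<delta> x)\<^sup>2)"
        using integrable_mult_right[OF two_wall_L2[OF \<sigma> Ek b], of "c\<^sup>2"]
        by (simp add: power_mult_distrib distrib_left)
      have "c\<^sup>2 * ((glued_u \<sigma> E \<delta> 0)\<^sup>2 + (glued_w \<sigma> E \<delta> 0)\<^sup>2) > 0"
        using c dec_sol_nonzero[of E "- \<delta>"] by (simp add: glued_u_def glued_w_def)
      then show "(c * glued_u \<sigma> E \<delta> 0)\<^sup>2 + (c * glued_w \<sigma> E \<delta> 0)\<^sup>2 > 0"
        by (simp add: power_mult_distrib distrib_left)
    qed
    then have "eigenfunction (two_wall \<kappa> \<delta>) E ?\<alpha>" by (simp add: spinor_scaleR)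
    moreover have "norm_H ?\<alpha> = 1" unfolding norm_H_scaleR using nc(1) by (simp add: c_def)
    moreover have "norm_H (\<lambda>x. ?\<alpha> x - (1 / ?N0) *\<^sub>R ?T x) \<le> (4 * C / ?N0) * eps \<delta>"
      using nc(2) unfolding T(2) c_def by simp
    ultimately show ?thesis by blast
  qed
  have "4 * C / ?N0 > 0" using C(1) N0 by simp
  then show ?thesis using main C(2)
    by (intro exI[of _ "4 * C / ?N0"] conjI exI[of _ "max D D'"]) (auto simp: le_max_iff_disj)
qed

text \<open>
  With the sign \<open>\<sigma> = -1\<close> for the first combination, these are the normalized approximate bound
  states.
\<close>

lemma zero_mode_combination:
  "complex_of_real (1 / sqrt 2) *s (zero_mode_R \<kappa> \<delta> x + \<i> *s zero_mode_L \<kappa> \<delta> x)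
     = (1 / (2 * sqrt weight_mass)) *\<^sub>R spinor (exp (- W (x - \<delta>))) (- 1 * exp (- W (x + \<delta>)))"
  "complex_of_real (1 / sqrt 2) *s (zero_mode_R \<kappa> \<delta> x - \<i> *s zero_mode_L \<kappa> \<delta> x)
     = (1 / (2 * sqrt weight_mass)) *\<^sub>R spinor (exp (- W (x - \<delta>))) (1 * exp (- W (x + \<delta>)))"
proof -
  have g: "(1 / sqrt 2) * gamma_const \<kappa> = 1 / (2 * sqrt weight_mass)"
    by (simp add: gamma_const_eq mult.assoc[symmetric])
  have g': "complex_of_real (1 / sqrt 2) * complex_of_real (gamma_const \<kappa> * a)
      = complex_of_real (1 / (2 * sqrt weight_mass) * a)" for a
    unfolding g[symmetric] of_real_mult by (simp only: mult.assoc)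
  let ?a = "exp (- W (x - \<delta>))" and ?b = "exp (- W (x + \<delta>))" and ?g = "gamma_const \<kappa>"
  have lin: "complex_of_real (1 / sqrt 2) * (complex_of_real (?g * a) * z + complex_of_real (?g * b) * w)
      = complex_of_real (1 / (2 * sqrt weight_mass) * a) * z + complex_of_real (1 / (2 * sqrt weight_mass) *
          b) * w" for a b z w
    by (simp only: distrib_left mult.assoc[symmetric] g')
  have p: "(zero_mode_R \<kappa> \<delta> x + \<i> *s zero_mode_L \<kappa> \<delta> x) $ 1
      = complex_of_real (?g * ?a) * 1 + complex_of_real (?g * ?b) * \<i>"
    "(zero_mode_R \<kappa> \<delta> x + \<i> *s zero_mode_L \<kappa> \<delta> x) $ 2
        = complex_of_real (?g * ?a) * \<i> + complex_of_real (?g * ?b) * 1"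
    "(zero_mode_R \<kappa> \<delta> x - \<i> *s zero_mode_L \<kappa> \<delta> x) $ 1
        = complex_of_real (?g * ?a) * 1 + complex_of_real (?g * ?b) * (- \<i>)"
    "(zero_mode_R \<kappa> \<delta> x - \<i> *s zero_mode_L \<kappa> \<delta> x) $ 2
        = complex_of_real (?g * ?a) * \<i> + complex_of_real (?g * ?b) * (- 1)"
    by (simp_all add: zero_mode_R_def zero_mode_L_def zero_mode_def complex_eq_iff)
  show "complex_of_real (1 / sqrt 2) *s (zero_mode_R \<kappa> \<delta> x + \<i> *s zero_mode_L \<kappa> \<delta> x)
     = (1 / (2 * sqrt weight_mass)) *\<^sub>R spinor ?a (- 1 * ?b)"
    unfolding vec2_eq_iff spinor_scaleR spinor_nth vector_smult_component p lin by simp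
  show "complex_of_real (1 / sqrt 2) *s (zero_mode_R \<kappa> \<delta> x - \<i> *s zero_mode_L \<kappa> \<delta> x)
     = (1 / (2 * sqrt weight_mass)) *\<^sub>R spinor ?a (1 * ?b)"
    unfolding vec2_eq_iff spinor_scaleR spinor_nth vector_smult_component p lin by simp
qed

text \<open>
  The positive energy belongs to \<open>\<sigma> = -1\<close> and the negative one to \<open>\<sigma> = 1\<close>. They differ because both
  matching conditions together would make the decaying solution vanish at the midpoint.
\<close>

lemma two_wall_bound_states:
  "\<exists>\<delta>0>0. \<exists>C. \<forall>\<delta>>1. \<delta> > \<delta>0 \<longrightarrow>
    (\<exists>Ep Em. Ep \<noteq> Em \<and>
       {E \<in> {-K..K}. eigenvalue (two_wall \<kappa> \<delta>) E} = {Ep, Em} \<and>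
       simple_eigenvalue (two_wall \<kappa> \<delta>) Ep \<and> simple_eigenvalue (two_wall \<kappa> \<delta>) Em \<and>
       \<bar>Ep - 2 * (gamma_const \<kappa>)\<^sup>2 * exp (- 2 * W \<delta>)\<bar> \<le> C * exp (- 4 * k * \<delta>) \<and>
       \<bar>Em - (- 2 * (gamma_const \<kappa>)\<^sup>2 * exp (- 2 * W \<delta>))\<bar> \<le> C * exp (- 4 * k * \<delta>) \<and>
       (\<exists>\<alpha>p \<alpha>m.
          eigenfunction (two_wall \<kappa> \<delta>) Ep \<alpha>p \<and> norm_H \<alpha>p = 1 \<and>
          eigenfunction (two_wall \<kappa> \<delta>) Em \<alpha>m \<and> norm_H \<alpha>m = 1 \<and>
          norm_H (\<lambda>x. \<alpha>p x - complex_of_real (1 / sqrt 2) *s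
              (zero_mode_R \<kappa> \<delta> x + \<i> *s zero_mode_L \<kappa> \<delta> x)) \<le> C * exp (- 2 * k * \<delta>) \<and>
          norm_H (\<lambda>x. \<alpha>m x - complex_of_real (1 / sqrt 2) *s
              (zero_mode_R \<kappa> \<delta> x - \<i> *s zero_mode_L \<kappa> \<delta> x)) \<le> C * exp (- 2 * k * \<delta>)))"
proof -
  obtain D1 where D1: "D1 \<ge> 1" and ex: "\<forall>\<delta>>D1. \<forall>\<sigma>. \<sigma>\<^sup>2 = 1 \<longrightarrow> (\<exists>E. \<bar>E\<bar> \<le> K \<and> matching \<sigma> E \<delta>)"
    using bound_states_exist by blast
  obtain D2 where D2: "D2 \<ge> 1" and un: "\<forall>\<delta>>D2. \<forall>\<sigma> E E'. \<sigma>\<^sup>2 = 1 \<longrightarrow> \<bar>E\<bar> \<le> K \<longrightarrow> \<bar>E'\<bar> \<le> K \<longrightarrow>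
     matching \<sigma> E \<delta> \<longrightarrow> matching \<sigma> E' \<delta> \<longrightarrow> E = E'"
    using bound_states_unique by blast
  obtain C3 D3 where C3: "C3 > 0" "D3 \<ge> 1" and en: "\<forall>\<delta>>D3. \<forall>\<sigma> E. \<sigma>\<^sup>2 = 1 \<longrightarrow> \<bar>E\<bar> \<le> K \<longrightarrow> matching \<sigma> E \<delta> \<longrightarrow>
     \<bar>E + \<sigma> * (1 / weight_mass * exp (- 2 * W \<delta>))\<bar> \<le> C3 * (eps \<delta>)\<^sup>2"
    using bound_state_energy_expansion by blast
  obtain C4 D4 where C4: "C4 > 0" "D4 \<ge> 1" and ef: "\<forall>\<delta>>D4. \<forall>\<sigma> E. \<sigma>\<^sup>2 = 1 \<longrightarrow> \<bar>E\<bar> \<le> K \<longrightarrow> matching \<sigma> E \<delta> \<longrightarrow>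
     (\<exists>\<alpha>. eigenfunction (two_wall \<kappa> \<delta>) E \<alpha> \<and> norm_H \<alpha> = 1 \<and>
       norm_H (\<lambda>x. \<alpha> x - (1 / (2 * sqrt weight_mass)) *\<^sub>R spinor (exp (- W (x - \<delta>))) (\<sigma> * exp (- W (x + \<delta>))))
         \<le> C4 * eps \<delta>)"
    using bound_state_eigenfunction by blast
  define D where "D = max (max D1 D2) (max D3 D4)"
  define C where "C = max C3 C4"
  show ?thesis
  proof (rule exI[of _ D], rule conjI, use D1 in \<open>simp add: D_def\<close>, rule exI[of _ C], intro allI impI)
    fix \<delta> :: real assume \<delta>1: "\<delta> > 1" and "\<delta> > D"
    then have \<delta>: "\<delta> > D1" "\<delta> > D2" "\<delta> > D3" "\<delta> > D4" by (simp_all add: D_def)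
    have sg: "(- 1 :: real)\<^sup>2 = 1" "(1 :: real)\<^sup>2 = 1" by simp_all
    obtain Ep where Ep: "\<bar>Ep\<bar> \<le> K" "matching (- 1) Ep \<delta>" using ex \<delta>(1) sg(1) by blast
    obtain Em where Em: "\<bar>Em\<bar> \<le> K" "matching 1 Em \<delta>" using ex \<delta>(1) sg(2) by blast
    obtain \<alpha>p where \<alpha>p: "eigenfunction (two_wall \<kappa> \<delta>) Ep \<alpha>p" "norm_H \<alpha>p = 1"
      "norm_H (\<lambda>x. \<alpha>p x - (1 / (2 * sqrt weight_mass)) *\<^sub>R spinor (exp (- W (x - \<delta>))) (- 1 * exp (- W (x +
          \<delta>)))) \<le> C4 * eps \<delta>"
      using ef \<delta>(4) sg(1) Ep by blast
    obtain \<alpha>m where \<alpha>m: "eigenfunction (two_wall \<kappa> \<delta>) Em \<alpha>m" "norm_H \<alpha>m = 1"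
      "norm_H (\<lambda>x. \<alpha>m x - (1 / (2 * sqrt weight_mass)) *\<^sub>R spinor (exp (- W (x - \<delta>))) (1 * exp (- W (x + \<delta>))))
          \<le> C4 * eps \<delta>"
      using ef \<delta>(4) sg(2) Em by blast
    have "Ep \<noteq> Em"
    proof
      assume "Ep = Em"
      then have "dec_u Em (- \<delta>) = 0" "dec_w Em (- \<delta>) = 0" using Ep(2) Em(2) by (auto simp: matching_def)
      then show False using dec_sol_nonzero[of Em "- \<delta>"] by simp
    qed
    moreover have "{E \<in> {-K..K}. eigenvalue (two_wall \<kappa> \<delta>) E} = {Ep, Em}"
    proof (intro equalityI subsetI)
      fix E assume "E \<in> {E \<in> {-K..K}. eigenvalue (two_wall \<kappa> \<delta>) E}"
      then have E: "\<bar>E\<bar> \<le> K" "eigenvalue (two_wall \<kappa> \<delta>) E" by (auto simp: abs_le_iff)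
      then have "matching 1 E \<delta> \<or> matching (- 1) E \<delta>"
        using two_wall_eigenvalue_iff[OF in_gap[OF E(1)]] \<delta>1 by simp
      then show "E \<in> {Ep, Em}"
        using un[rule_format, OF \<delta>(2) sg(2) E(1) Em(1) _ Em(2)] un[rule_format, OF \<delta>(2) sg(1) E(1) Ep(1) _
            Ep(2)] by blast
    next
      fix E assume "E \<in> {Ep, Em}"
      then show "E \<in> {E \<in> {-K..K}. eigenvalue (two_wall \<kappa> \<delta>) E}"
        using Ep(1) Em(1) \<alpha>p(1) \<alpha>m(1) by (auto simp: eigenvalue_def abs_le_iff)
    qed
    moreover have "simple_eigenvalue (two_wall \<kappa> \<delta>) Ep" "simple_eigenvalue (two_wall \<kappa> \<delta>) Em"
      using two_wall_simple[OF sg(1) in_gap[OF Ep(1)] Ep(2)] two_wall_simple[OF sg(2) in_gap[OF Em(1)] Em(2)]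
          \<delta>1
      by simp_all
    moreover have "\<bar>Ep - 2 * (gamma_const \<kappa>)\<^sup>2 * exp (- 2 * W \<delta>)\<bar> \<le> C * exp (- 4 * k * \<delta>)"
      "\<bar>Em - (- 2 * (gamma_const \<kappa>)\<^sup>2 * exp (- 2 * W \<delta>))\<bar> \<le> C * exp (- 4 * k * \<delta>)"
    proof -
      have e4: "C3 * (eps \<delta>)\<^sup>2 \<le> C * exp (- 4 * k * \<delta>)"
      proof -
        have "(eps \<delta>)\<^sup>2 = exp (2 * (- 2 * k * \<delta>))" by (simp only: exp_double)
        then have "(eps \<delta>)\<^sup>2 = exp (- 4 * k * \<delta>)" by simp
        then show ?thesis by (simp add: C_def)
      qed
      have g: "- 2 * (gamma_const \<kappa>)\<^sup>2 = - (1 / weight_mass)" using gamma_sq by simp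
      show "\<bar>Ep - 2 * (gamma_const \<kappa>)\<^sup>2 * exp (- 2 * W \<delta>)\<bar> \<le> C * exp (- 4 * k * \<delta>)"
        using order_trans[OF en[rule_format, OF \<delta>(3) sg(1) Ep] e4] unfolding gamma_sq by simp
      show "\<bar>Em - (- 2 * (gamma_const \<kappa>)\<^sup>2 * exp (- 2 * W \<delta>))\<bar> \<le> C * exp (- 4 * k * \<delta>)"
        using order_trans[OF en[rule_format, OF \<delta>(3) sg(2) Em] e4] unfolding g by simp
    qed
    moreover have "norm_H (\<lambda>x. \<alpha>p x - complex_of_real (1 / sqrt 2) *s
              (zero_mode_R \<kappa> \<delta> x + \<i> *s zero_mode_L \<kappa> \<delta> x)) \<le> C * exp (- 2 * k * \<delta>)"
      "norm_H (\<lambda>x. \<alpha>m x - complex_of_real (1 / sqrt 2) *s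
              (zero_mode_R \<kappa> \<delta> x - \<i> *s zero_mode_L \<kappa> \<delta> x)) \<le> C * exp (- 2 * k * \<delta>)"
    proof -
      have "C4 * eps \<delta> \<le> C * exp (- 2 * k * \<delta>)" by (simp add: C_def)
      then show "norm_H (\<lambda>x. \<alpha>p x - complex_of_real (1 / sqrt 2) *s
              (zero_mode_R \<kappa> \<delta> x + \<i> *s zero_mode_L \<kappa> \<delta> x)) \<le> C * exp (- 2 * k * \<delta>)"
        "norm_H (\<lambda>x. \<alpha>m x - complex_of_real (1 / sqrt 2) *s
              (zero_mode_R \<kappa> \<delta> x - \<i> *s zero_mode_L \<kappa> \<delta> x)) \<le> C * exp (- 2 * k * \<delta>)"
        unfolding zero_mode_combination using \<alpha>p(3) \<alpha>m(3) by (blast intro: order_trans)+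
    qed
    ultimately show "\<exists>Ep Em. Ep \<noteq> Em \<and>
       {E \<in> {-K..K}. eigenvalue (two_wall \<kappa> \<delta>) E} = {Ep, Em} \<and>
       simple_eigenvalue (two_wall \<kappa> \<delta>) Ep \<and> simple_eigenvalue (two_wall \<kappa> \<delta>) Em \<and>
       \<bar>Ep - 2 * (gamma_const \<kappa>)\<^sup>2 * exp (- 2 * W \<delta>)\<bar> \<le> C * exp (- 4 * k * \<delta>) \<and>
       \<bar>Em - (- 2 * (gamma_const \<kappa>)\<^sup>2 * exp (- 2 * W \<delta>))\<bar> \<le> C * exp (- 4 * k * \<delta>) \<and>
       (\<exists>\<alpha>p \<alpha>m.
          eigenfunction (two_wall \<kappa> \<delta>) Ep \<alpha>p \<and> norm_H \<alpha>p = 1 \<and>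
          eigenfunction (two_wall \<kappa> \<delta>) Em \<alpha>m \<and> norm_H \<alpha>m = 1 \<and>
          norm_H (\<lambda>x. \<alpha>p x - complex_of_real (1 / sqrt 2) *s
              (zero_mode_R \<kappa> \<delta> x + \<i> *s zero_mode_L \<kappa> \<delta> x)) \<le> C * exp (- 2 * k * \<delta>) \<and>
          norm_H (\<lambda>x. \<alpha>m x - complex_of_real (1 / sqrt 2) *s
              (zero_mode_R \<kappa> \<delta> x - \<i> *s zero_mode_L \<kappa> \<delta> x)) \<le> C * exp (- 2 * k * \<delta>))"
      using \<alpha>p(1,2) \<alpha>m(1,2) by (intro exI[of _ Ep] exI[of _ Em] exI[of _ \<alpha>p] exI[of _ \<alpha>m] conjI)
  qed
qed

end

theorem theorem2p2:
  fixes \<kappa> :: "real \<Rightarrow> real" and \<kappa>inf K :: real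
  assumes "one_domain_wall \<kappa> \<kappa>inf"
    and "spectral_gap \<kappa> \<kappa>inf"
    and "K > 0" and "{-K..K} \<subseteq> {-\<kappa>inf<..<\<kappa>inf}"
  shows "\<exists>\<delta>0>0. \<exists>C. \<forall>\<delta>>1. \<delta> > \<delta>0 \<longrightarrow>
    (\<exists>Ep Em. Ep \<noteq> Em \<and>
       {E \<in> {-K..K}. eigenvalue (two_wall \<kappa> \<delta>) E} = {Ep, Em} \<and>
       simple_eigenvalue (two_wall \<kappa> \<delta>) Ep \<and> simple_eigenvalue (two_wall \<kappa> \<delta>) Em \<and>
       \<bar>Ep - 2 * (gamma_const \<kappa>)\<^sup>2 * exp (- 2 * (LBINT y=0..\<delta>. \<kappa> y))\<bar>
         \<le> C * exp (- 4 * \<kappa>inf * \<delta>) \<and>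
       \<bar>Em - (- 2 * (gamma_const \<kappa>)\<^sup>2 * exp (- 2 * (LBINT y=0..\<delta>. \<kappa> y)))\<bar>
         \<le> C * exp (- 4 * \<kappa>inf * \<delta>) \<and>
       (\<exists>\<alpha>p \<alpha>m.
          eigenfunction (two_wall \<kappa> \<delta>) Ep \<alpha>p \<and> norm_H \<alpha>p = 1 \<and>
          eigenfunction (two_wall \<kappa> \<delta>) Em \<alpha>m \<and> norm_H \<alpha>m = 1 \<and>
          norm_H (\<lambda>x. \<alpha>p x - complex_of_real (1 / sqrt 2) *s
              (zero_mode_R \<kappa> \<delta> x + \<i> *s zero_mode_L \<kappa> \<delta> x))
            \<le> C * exp (- 2 * \<kappa>inf * \<delta>) \<and>
          norm_H (\<lambda>x. \<alpha>m x - complex_of_real (1 / sqrt 2) *s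
              (zero_mode_R \<kappa> \<delta> x - \<i> *s zero_mode_L \<kappa> \<delta> x))
            \<le> C * exp (- 2 * \<kappa>inf * \<delta>)))"
proof -
  have "K \<in> {-K..K}" using assms(3) by simp
  from subsetD[OF assms(4) this] have "K < \<kappa>inf" by simp
  with assms interpret gapped_domain_wall \<kappa> \<kappa>inf K by unfold_locales auto
  show ?thesis using two_wall_bound_states unfolding wall_primitive_def .
qed

end
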